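(* Let $X=\mathrm{HTG}(m,n,\ell)$ be a 3-RDR graph. Then either $m$ is even and $n\equiv\ell\equiv0\pmod 6$, or $m$ is odd, $n\equiv0\pmod 6$ and $\ell\equiv3\pmod 6$. Moreover, one of the following holds: (i) $g(X)=4$, $\mathrm{sgn}(X)=(1,1,2)$, and $X$ is isomorphic to a prism or a Möbius ladder: for some integer $s$, $X\cong\mathrm{HTG}(1,2s,3)$, where $\mathrm{HTG}(1,2s,3)\cong\mathrm{Pr}(s)\cong\mathrm{GP}(s,1)\cong\mathrm{HTG}(2,s,0)$ with $s\equiv0\pmod 6$, or $\mathrm{HTG}(1,2s,3)\cong\mathrm{Ml}(s)\cong\mathrm{HTG}(1,2s,s)$ with $s\equiv3\pmod 6$. (ii) $g(X)=6$, $\mathrm{sgn}(X)=(4,4,4)$ and $X\cong\mathrm{HTG}(3,6,3)$ (the Pappus graph). (iii) $g(X)=6$, $\mathrm{sgn}(X)=(3,3,3)$ and, for some integer $s>6$, $X\cong\mathrm{HTG}(3,s,3)$, where $\mathrm{HTG}(3,s,3)\cong\mathrm{HTG}(\frac s2,6,0)$ with $s\equiv0\pmod{12}$, or $\mathrm{HTG}(3,s,3)\cong\mathrm{HTG}(\frac s2,6,3)$ with $s\equiv6\pmod{12}$. (iv) $g(X)=6$, $\mathrm{sgn}(X)=(2,3,3)$, and either $X\cong\mathrm{HTG}(s,6,0)$ for some even $s$, where $\mathrm{HTG}(s,6,0)\cong\mathrm{HTG}(1,6s,2s-1)$ if $s\equiv2\pmod6$ and $\mathrm{HTG}(s,6,0)\cong\mathrm{HTG}(1,6s,2s+1)$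 if $s\equiv4\pmod6$; or $X\cong\mathrm{HTG}(s,6,3)$ for some odd $s\ge5$, where $\mathrm{HTG}(s,6,3)\cong\mathrm{HTG}(1,6s,2s-1)$ if $s\equiv5\pmod6$ and $\mathrm{HTG}(s,6,3)\cong\mathrm{HTG}(1,6s,2s+1)$ if $s\equiv1\pmod6$. (v) $g(X)=6$, $\mathrm{sgn}(X)=(2,2,2)$, and either $X$ is isomorphic to a generalized Petersen graph, $X\cong\mathrm{HTG}(2,s,\frac s2)\cong\mathrm{GP}(s,\frac s2-1)$ for some $s\equiv0\pmod4$, or $X\cong\mathrm{HTG}(m,n,\ell)$ has parameters $m,n,\ell$ different from all the parameter triples listed in (i)–(iv) and in the first alternative of (v), and $X$ is not isomorphic to any generalized Petersen graph.
   Context: All graphs are finite and simple. For a graph $G=(V,E)$, $N(v)$ is the open neighbourhood of $v$. A $3$-rainbow dominating function (3-RDF) on $G$ is a map $f\colon V\to 2^{\{1,2,3\}}$ such that $f(v)=\emptyset$ implies $\bigcup_{u\in N(v)}f(u)=\{1,2,3\}$, for all $v\in V$; $\gamma_{r3}(G)$ is the minimum of $\sum_{v}|f(v)|$ over all 3-RDFs. A cubic (3-regular) graph $G$ is 3-RDR (3-rainbow domination regular) if $\gamma_{r3}(G)=|V|/2$ (the known lower bound for cubic graphs). For integers $m\ge1$, even $n\ge4$, and $0\le\ell\le n/2$ with $\ell\equiv m\pmod 2$, the honeycomb toroidal graph $\mathrm{HTG}(m,n,\ell)$ has vertex set $\{v_{i,j}: i\in\mathbb Z_m, j\in\mathbb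 Z_n\}$ and edge set the disjoint union of: vertical edges $\{v_{i,j},v_{i,j+1}\}$ for $i\in\mathbb Z_m$, $j\in\mathbb Z_n$; horizontal edges $\{v_{i,j},v_{i+1,j}\}$ for $i\in\mathbb Z_m\setminus\{m-1\}$, $j\in\mathbb Z_n$, $i+1\equiv j\pmod 2$; and jumps $\{v_{m-1,j},v_{0,j+\ell}\}$ for $j\in\mathbb Z_n$, $j\equiv m\pmod 2$. These graphs are known to be vertex-transitive. For $1\le k\le n/2$, the generalized Petersen graph $\mathrm{GP}(n,k)$ has vertex set $\{u_i,v_i: i\in\mathbb Z_n\}$ and edges $\{u_i,u_{i+1}\}$, $\{u_i,v_i\}$, $\{v_i,v_{i+k}\}$, $i\in\mathbb Z_n$. The prism $\mathrm{Pr}(n)$ has the same vertex set and edges $\{u_i,u_{i+1}\}$, $\{v_i,v_{i+1}\}$, $\{u_i,v_i\}$, $i\in\mathbb Z_n$. The Möbius ladder $\mathrm{Ml}(n)$ is obtained from $\mathrm{Pr}(n)$ by replacing the edges $\{u_{n-1},u_0\},\{v_{n-1},v_0\}$ with $\{u_{n-1},v_0\},\{v_{n-1},u_0\}$. The girth $g(X)$ is the length of a shortest cycle of $X$; cycles of this length are girth cycles. For an edge $e$, $\epsilon(e)$ is the number of girth cycles containing $e$. The signature of a vertex $v$ of degree $3$ is the triple of values $\epsilon(e)$ of the three edges at $v$, in non-decreasing order. In a vertex-transitive graph all vertex signatures coincide, and the common value is the signature $\mathrm{sgn}(X)$.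
   Formalization: In (i) the signature is stated as (4,4,4) instead of (1,1,2) when X = HTG(1,6,3), which is K_{3,3}: it is 3-RDR of girth 4 and each edge lies in four 4-cycles, so the original claim fails there. *)

theory Defs
  imports "HOL-Library.Multiset"
begin

type_synonym 'a graph = "'a set \<times> 'a set set"

abbreviation verts :: "'a graph \<Rightarrow> 'a set" where "verts \<equiv> fst"
abbreviation edges :: "'a graph \<Rightarrow> 'a set set" where "edges \<equiv> snd"

definition simple_graph :: "'a graph \<Rightarrow> bool" where
  "simple_graph G \<longleftrightarrow> finite (verts G) \<and> (\<forall>e\<in>edges G. e \<subseteq> verts G \<and> card e = 2)"

definition nbhd :: "'a graph \<Rightarrow> 'a \<Rightarrow> 'a set" where
  "nbhd G v = {u \<in> verts G. {u, v} \<in> edges G}"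

definition cubic :: "'a graph \<Rightarrow> bool" where
  "cubic G \<longleftrightarrow> (\<forall>v\<in>verts G. card (nbhd G v) = 3)"

definition graph_iso :: "'a graph \<Rightarrow> 'b graph \<Rightarrow> bool" (infix "\<cong>\<^sub>G" 50) where
  "G \<cong>\<^sub>G H \<longleftrightarrow> (\<exists>\<phi>. bij_betw \<phi> (verts G) (verts H) \<and>
     (\<forall>u\<in>verts G. \<forall>v\<in>verts G. {u, v} \<in> edges G \<longleftrightarrow> {\<phi> u, \<phi> v} \<in> edges H))"


subsection \<open>3-rainbow domination\<close>

definition is_3RDF :: "'a graph \<Rightarrow> ('a \<Rightarrow> nat set) \<Rightarrow> bool" where
  "is_3RDF G f \<longleftrightarrow> (\<forall>v\<in>verts G. f v \<subseteq> {1, 2, 3} \<and>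
     (f v = {} \<longrightarrow> (\<Union>u\<in>nbhd G v. f u) = {1, 2, 3}))"

definition gamma_r3 :: "'a graph \<Rightarrow> nat" where
  "gamma_r3 G = (LEAST w. \<exists>f. is_3RDF G f \<and> w = (\<Sum>v\<in>verts G. card (f v)))"

definition is_3RDR :: "'a graph \<Rightarrow> bool" where
  "is_3RDR G \<longleftrightarrow> simple_graph G \<and> cubic G \<and> 2 * gamma_r3 G = card (verts G)"


subsection \<open>Girth cycles and signatures\<close>

definition is_cycle :: "'a graph \<Rightarrow> 'a list \<Rightarrow> bool" where
  "is_cycle G xs \<longleftrightarrow> 3 \<le> length xs \<and> distinct xs \<and> set xs \<subseteq> verts G \<and>
     (\<forall>i<length xs. {xs ! i, xs ! ((i + 1) mod length xs)} \<in> edges G)"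

definition cycle_edges :: "'a list \<Rightarrow> 'a set set" where
  "cycle_edges xs = {{xs ! i, xs ! ((i + 1) mod length xs)} | i. i < length xs}"

text \<open>A cycle is identified with its edge set, so that rotations and reversals of a vertex
  sequence count as the same cycle; its length is the number of its edges.\<close>

definition cycles :: "'a graph \<Rightarrow> 'a set set set" where
  "cycles G = {cycle_edges xs | xs. is_cycle G xs}"

definition girth :: "'a graph \<Rightarrow> nat" where
  "girth G = (LEAST k. \<exists>C\<in>cycles G. card C = k)"

definition girth_cycles :: "'a graph \<Rightarrow> 'a set set set" where
  "girth_cycles G = {C \<in> cycles G. card C = girth G}"

definition eps :: "'a graph \<Rightarrow> 'a set \<Rightarrow> nat" where
  "eps G e = card {C \<in> girth_cycles G. e \<in> C}"

definition vertex_signature :: "'a graph \<Rightarrow> 'a \<Rightarrow> nat list" where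
  "vertex_signature G v =
     sorted_list_of_multiset (image_mset (eps G) (mset_set {e \<in> edges G. v \<in> e}))"

text \<open>The signature of a graph is the common value of its vertex signatures;
  \<open>has_signature G s\<close> says that this common value exists and equals \<open>s\<close>.\<close>

definition has_signature :: "'a graph \<Rightarrow> nat list \<Rightarrow> bool" where
  "has_signature G s \<longleftrightarrow> (\<forall>v\<in>verts G. vertex_signature G v = s)"


subsection \<open>The graph families\<close>

text \<open>The elements of \<open>\<int>\<^sub>n\<close> are represented by \<open>0, \<dots>, n - 1\<close>.
  The edge set of the honeycomb toroidal graph is a disjoint union in the intended cases; in the
  degenerate case \<open>m = \<ell> = 1\<close>, where jumps coincide with vertical edges, the graph below is
  a cycle and hence not cubic.\<close>

definition HTG_params :: "nat \<Rightarrow> nat \<Rightarrow> nat \<Rightarrow> bool" where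
  "HTG_params m n l \<longleftrightarrow> 1 \<le> m \<and> even n \<and> 4 \<le> n \<and> 2 * l \<le> n \<and> l mod 2 = m mod 2"

definition HTG :: "nat \<Rightarrow> nat \<Rightarrow> nat \<Rightarrow> (nat \<times> nat) graph" where
  "HTG m n l =
    ({(i, j). i < m \<and> j < n},
     {{(i, j), (i, (j + 1) mod n)} | i j. i < m \<and> j < n} \<union>
     {{(i, j), (i + 1, j)} | i j. i + 1 < m \<and> j < n \<and> (i + 1) mod 2 = j mod 2} \<union>
     {{(m - 1, j), (0, (j + l) mod n)} | j. j < n \<and> j mod 2 = m mod 2})"

text \<open>Below, \<open>Inl i\<close> and \<open>Inr i\<close> stand for the vertices \<open>u\<^sub>i\<close> and \<open>v\<^sub>i\<close>.\<close>

definition GP :: "nat \<Rightarrow> nat \<Rightarrow> (nat + nat) graph" where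
  "GP n k =
    ({0..<n} <+> {0..<n},
     {{Inl i, Inl ((i + 1) mod n)} | i. i < n} \<union>
     {{Inl i, Inr i} | i. i < n} \<union>
     {{Inr i, Inr ((i + k) mod n)} | i. i < n})"

definition Prism :: "nat \<Rightarrow> (nat + nat) graph" where
  "Prism n =
    ({0..<n} <+> {0..<n},
     {{Inl i, Inl ((i + 1) mod n)} | i. i < n} \<union>
     {{Inr i, Inr ((i + 1) mod n)} | i. i < n} \<union>
     {{Inl i, Inr i} | i. i < n})"

definition Moebius_ladder :: "nat \<Rightarrow> (nat + nat) graph" where
  "Moebius_ladder n =
    (verts (Prism n),
     edges (Prism n) - {{Inl (n - 1), Inl 0}, {Inr (n - 1), Inr 0}}
       \<union> {{Inl (n - 1), Inr 0}, {Inr (n - 1), Inl 0}})"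

text \<open>The parameter triples occurring in the classification of 3-RDR honeycomb toroidal graphs,
  grouped by girth and signature; the last group is the generalized Petersen family
  \<open>HTG(2, s, s/2)\<close>.\<close>

definition listed_triples :: "(nat \<times> nat \<times> nat) set" where
  "listed_triples =
     {(1, 2 * s, 3) | s. s mod 6 = 0 \<or> s mod 6 = 3} \<union>
     {(2, s, 0) | s. s mod 6 = 0} \<union>
     {(1, 2 * s, s) | s. s mod 6 = 3} \<union>

     {(3, 6, 3)} \<union>

     {(3, s, 3) | s. s > 6 \<and> (s mod 12 = 0 \<or> s mod 12 = 6)} \<union>
     {(s div 2, 6, 0) | s. s > 6 \<and> s mod 12 = 0} \<union>
     {(s div 2, 6, 3) | s. s > 6 \<and> s mod 12 = 6} \<union>

     {(s, 6, 0) | s. even s} \<union>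
     {(1, 6 * s, 2 * s - 1) | s. even s \<and> s mod 6 = 2} \<union>
     {(1, 6 * s, 2 * s + 1) | s. even s \<and> s mod 6 = 4} \<union>
     {(s, 6, 3) | s. odd s \<and> s \<ge> 5} \<union>
     {(1, 6 * s, 2 * s - 1) | s. odd s \<and> s \<ge> 5 \<and> s mod 6 = 5} \<union>
     {(1, 6 * s, 2 * s + 1) | s. odd s \<and> s \<ge> 5 \<and> s mod 6 = 1} \<union>

     {(2, s, s div 2) | s. s mod 4 = 0}"

end

theory Submission
  imports Defs "HOL-Library.Product_Plus"
begin

text \<open>A honeycomb toroidal graph is the quotient of the brick wall on \<open>\<int>\<^sup>2\<close> by a lattice \<open>L\<close>. A 3-rainbow
  dominating function of weight \<open>|V| / 2\<close> colours one bipartition class so that every vertex of the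
  other class sees all three colours; lifted to the brick wall, this colouring is unique up to permutation and
  depends only on the second coordinate modulo three. Hence 3-RDR forces \<open>3\<close> to divide the second
  coordinate of every vector of \<open>L\<close>. The non-contractible cycles of length at most six come from short
  vectors of \<open>L\<close>, and up to the symmetries of the honeycomb only \<open>(1, -3)\<close> and
  \<open>(0, 6)\<close> remain: the first gives girth four and \<open>HTG(1, 2 s, 3)\<close>, the second gives
  \<open>HTG(s, 6, 0)\<close> or \<open>HTG(s, 6, 3)\<close>, and without either of them the only six-cycles are the hexagons.
  Lattices with vectors of type \<open>(1, 5)\<close>, which would yield signature \<open>(3, 3, 3)\<close>, violate the
  divisibility; the graphs \<open>HTG(3, s, 3)\<close> with \<open>s > 6\<close> have signature \<open>(2, 3, 3)\<close>.\<close>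

subsection \<open>Isomorphisms and rooted cycles\<close>

text \<open>The translations of the brick wall are the points with even coordinate sum, and its
  symmetries preserve the form 3 i^2 + j^2 on them. The unit translations are, up to sign, (0, 2),
  (1, 1) and (1, -1). Two steps along different edges make one unit translation, so a closed walk of
  length 2 r ends at a lattice vector at most r units away ("hexagon distance"); cycles of length at
  most six see only distances up to three. The suffixes \<open>norm_2\<close> and
  \<open>norm_3\<close> below refer to this distance. The translations with 3 dividing the second
  coordinate are the multiples of sqrt(-3) in the Eisenstein integers. This sublattice is stable
  under all symmetries, so the divisibility survives every change of coordinates. Up to sign, it has
  the vectors (1, 3), (1, -3), (2, 0) at distance two and (0, 6), (3, 3), (3, -3) at distance three,
  each triple being a single orbit, and none at distance one. Whether a word of directions closes up
  does not depend on its starting vertex. Hence all vertices have the same signature without any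
  appeal to transitivity, and signatures are found by listing finitely many words.\<close>

lemma graph_iso_refl: "G \<cong>\<^sub>G G"
  unfolding graph_iso_def by (rule exI[of _ id]) auto

lemma graph_iso_sym: assumes "G \<cong>\<^sub>G H" shows "H \<cong>\<^sub>G G"
proof -
  obtain f where f: "bij_betw f (verts G) (verts H)"
    and e: "\<And>u v. u \<in> verts G \<Longrightarrow> v \<in> verts G \<Longrightarrow> {u, v} \<in> edges G \<longleftrightarrow> {f u, f v} \<in> edges H"
    using assms unfolding graph_iso_def by blast
  let ?g = "inv_into (verts G) f"
  have g: "bij_betw ?g (verts H) (verts G)"
    using f by (rule bij_betw_inv_into)
  have "{u, v} \<in> edges H \<longleftrightarrow> {?g u, ?g v} \<in> edges G" if "u \<in> verts H" "v \<in> verts H" for u v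
    using e[of "?g u" "?g v"] that bij_betw_apply[OF g] bij_betw_inv_into_right[OF f] by simp
  with g show ?thesis unfolding graph_iso_def by blast
qed

lemma graph_iso_trans: assumes "G \<cong>\<^sub>G H" "H \<cong>\<^sub>G K" shows "G \<cong>\<^sub>G K"
proof -
  obtain f where f: "bij_betw f (verts G) (verts H)"
    and ef: "\<And>u v. u \<in> verts G \<Longrightarrow> v \<in> verts G \<Longrightarrow> {u, v} \<in> edges G \<longleftrightarrow> {f u, f v} \<in> edges H"
    using assms(1) unfolding graph_iso_def by blast
  obtain g where g: "bij_betw g (verts H) (verts K)"
    and eg: "\<And>u v. u \<in> verts H \<Longrightarrow> v \<in> verts H \<Longrightarrow> {u, v} \<in> edges H \<longleftrightarrow> {g u, g v} \<in> edges K"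
    using assms(2) unfolding graph_iso_def by blast
  have "bij_betw (g \<circ> f) (verts G) (verts K)" using f g by (rule bij_betw_trans)
  moreover have "{u, v} \<in> edges G \<longleftrightarrow> {(g \<circ> f) u, (g \<circ> f) v} \<in> edges K"
    if "u \<in> verts G" "v \<in> verts G" for u v
    using ef[OF that] eg[of "f u" "f v"] that f by (auto dest: bij_betw_apply)
  ultimately show ?thesis unfolding graph_iso_def by blast
qed

lemma graph_isoI:
  assumes "\<And>u. u \<in> verts G \<Longrightarrow> f u \<in> verts H" "\<And>v. v \<in> verts H \<Longrightarrow> g v \<in> verts G"
    and "\<And>u. u \<in> verts G \<Longrightarrow> g (f u) = u" "\<And>v. v \<in> verts H \<Longrightarrow> f (g v) = v"
    and "\<And>e. e \<in> edges G \<Longrightarrow> f ` e \<in> edges H" "\<And>e. e \<in> edges H \<Longrightarrow> g ` e \<in> edges G"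
  shows "G \<cong>\<^sub>G H"
  unfolding graph_iso_def
proof (intro exI[of _ f] conjI ballI iffI)
  show "bij_betw f (verts G) (verts H)"
    by (rule bij_betw_byWitness[where f' = g]) (use assms in auto)
next
  fix u v assume "{u, v} \<in> edges G"
  then show "{f u, f v} \<in> edges H" using assms(5) by fastforce
next
  fix u v assume "u \<in> verts G" "v \<in> verts G" "{f u, f v} \<in> edges H"
  then show "{u, v} \<in> edges G" using assms(6)[of "{f u, f v}"] assms(3) by auto
qed

lemma nat_mod_less: "i < k \<Longrightarrow> j mod k < k" for i j k :: nat
  by simp

text \<open>Two positions with the same edge would each be the cyclic successor of the other, which
  happens only in length two.\<close>

lemma inj_on_cycle_edge:
  assumes "distinct xs" "3 \<le> length xs"
  shows "inj_on (\<lambda>i. {xs ! i, xs ! ((i + 1) mod length xs)}) {..<length xs}"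
proof (rule inj_onI)
  let ?k = "length xs"
  fix i j assume ij: "i \<in> {..<?k}" "j \<in> {..<?k}"
    and eq: "{xs ! i, xs ! ((i + 1) mod ?k)} = {xs ! j, xs ! ((j + 1) mod ?k)}"
  have l: "(i + 1) mod ?k < ?k" "(j + 1) mod ?k < ?k"
    using ij nat_mod_less[of i ?k] nat_mod_less[of j ?k] by auto
  show "i = j"
  proof (rule ccontr)
    assume ne: "i \<noteq> j"
    then have "i = (j + 1) mod ?k" "j = (i + 1) mod ?k"
      using eq ij l assms(1) by (auto simp: doubleton_eq_iff nth_eq_iff_index_eq)
    moreover have "(x + 1) mod ?k = (if Suc x = ?k then 0 else Suc x)" if "x < ?k" for x
      using that by simp
    ultimately have "Suc j = ?k \<and> i = 0 \<or> i = Suc j" "Suc i = ?k \<and> j = 0 \<or> j = Suc i"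
      using ij by (metis lessThan_iff)+
    then show False using assms(2) by linarith
  qed
qed

lemma card_cycle_edges:
  assumes "distinct xs" "3 \<le> length xs" shows "card (cycle_edges xs) = length xs"
proof -
  have "cycle_edges xs = (\<lambda>i. {xs ! i, xs ! ((i + 1) mod length xs)}) ` {..<length xs}"
    unfolding cycle_edges_def by auto
  then show ?thesis using card_image[OF inj_on_cycle_edge[OF assms]] by simp
qed

lemma girth_def_list: "girth G = (LEAST k. \<exists>xs. is_cycle G xs \<and> length xs = k)"
proof -
  have "(\<exists>C\<in>cycles G. card C = k) \<longleftrightarrow> (\<exists>xs. is_cycle G xs \<and> length xs = k)" for k
  proof
    assume "\<exists>C\<in>cycles G. card C = k"
    then obtain xs where "is_cycle G xs" "card (cycle_edges xs) = k"
      unfolding cycles_def by auto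
    then show "\<exists>xs. is_cycle G xs \<and> length xs = k"
      using card_cycle_edges[of xs] unfolding is_cycle_def by auto
  next
    assume "\<exists>xs. is_cycle G xs \<and> length xs = k"
    then obtain xs where "is_cycle G xs" "length xs = k" by blast
    then show "\<exists>C\<in>cycles G. card C = k"
      using card_cycle_edges[of xs] unfolding is_cycle_def cycles_def by blast
  qed
  then show ?thesis unfolding girth_def by simp
qed

lemma is_cycle_rotate:
  assumes "is_cycle G xs" shows "is_cycle G (rotate r xs)"
proof -
  let ?k = "length xs"
  have k: "3 \<le> ?k" using assms unfolding is_cycle_def by auto
  have "{rotate r xs ! i, rotate r xs ! ((i + 1) mod ?k)} \<in> edges G" if "i < ?k" for i
  proof -
    have "rotate r xs ! ((i + 1) mod ?k) = xs ! (((r + i) mod ?k + 1) mod ?k)"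
      using nth_rotate[OF nat_mod_less[OF that], of r "i + 1"] by (simp add: mod_simps ac_simps)
    moreover have "rotate r xs ! i = xs ! ((r + i) mod ?k)"
      using that by (simp add: nth_rotate ac_simps)
    moreover have "(r + i) mod ?k < ?k" using nat_mod_less[OF that] .
    ultimately show ?thesis using assms unfolding is_cycle_def by simp
  qed
  then show ?thesis using assms unfolding is_cycle_def by auto
qed

lemma cycle_edges_rotate: "cycle_edges (rotate r xs) = cycle_edges xs"
proof (induction r)
  case (Suc r)
  have *: "cycle_edges (rotate1 ys) = cycle_edges ys" for ys :: "'a list"
  proof (cases "ys = []")
    case False
    let ?k = "length ys"
    have k: "0 < ?k" using False by simp
    have n: "rotate1 ys ! j = ys ! (Suc j mod ?k)" if "j < ?k" for j
      using that nth_rotate[of j ys 1] by simp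
    show ?thesis
    proof (intro equalityI subsetI)
      fix e assume "e \<in> cycle_edges (rotate1 ys)"
      then obtain i where i: "i < ?k" "e = {rotate1 ys ! i, rotate1 ys ! ((i + 1) mod ?k)}"
        unfolding cycle_edges_def by auto
      then have "e = {ys ! (Suc i mod ?k), ys ! ((Suc i mod ?k + 1) mod ?k)}"
        using n k by (simp add: mod_simps)
      then show "e \<in> cycle_edges ys" unfolding cycle_edges_def using k by fastforce
    next
      fix e assume "e \<in> cycle_edges ys"
      then obtain i where i: "i < ?k" "e = {ys ! i, ys ! ((i + 1) mod ?k)}"
        unfolding cycle_edges_def by auto
      define j where "j = (if i = 0 then ?k - 1 else i - 1)"
      have "Suc (?k - Suc 0) = ?k" using i by linarith
      then have j: "Suc j mod ?k = i" "j < ?k" using i(1) unfolding j_def by auto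
      have "e = {rotate1 ys ! j, rotate1 ys ! ((j + 1) mod ?k)}"
        using n[OF j(2)] n[OF nat_mod_less[OF j(2), of "j + 1"]] j i by simp
      then show "e \<in> cycle_edges (rotate1 ys)" unfolding cycle_edges_def using j by fastforce
    qed
  qed (simp add: cycle_edges_def)
  show ?case using Suc * by simp
qed simp

lemma is_cycle_rev:
  assumes "is_cycle G xs" shows "is_cycle G (rev xs)"
proof -
  let ?k = "length xs"
  have k: "3 \<le> ?k" using assms unfolding is_cycle_def by auto
  have "{rev xs ! i, rev xs ! ((i + 1) mod ?k)} \<in> edges G" if "i < ?k" for i
  proof -
    let ?j = "?k - 1 - (i + 1) mod ?k"
    have "(i + 1) mod ?k < ?k" using nat_mod_less[OF that] .
    moreover have "Suc (?k - Suc 0) = ?k" using that by linarith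
    then have "?k - 1 - i = (?j + 1) mod ?k"
      using that k by (cases "Suc i = ?k") (auto simp: Suc_diff_Suc)
    ultimately show ?thesis using assms that k unfolding is_cycle_def
      by (simp add: rev_nth insert_commute)
  qed
  then show ?thesis using assms unfolding is_cycle_def by auto
qed

lemma cycle_edges_rev: "cycle_edges (rev xs) = cycle_edges xs"
proof -
  have sub: "cycle_edges (rev ys) \<subseteq> cycle_edges ys" for ys :: "'a list"
  proof
    let ?k = "length ys"
    fix e assume "e \<in> cycle_edges (rev ys)"
    then obtain i where i: "i < ?k" "e = {rev ys ! i, rev ys ! ((i + 1) mod ?k)}"
      unfolding cycle_edges_def by auto
    let ?j = "?k - 1 - (i + 1) mod ?k"
    have "(i + 1) mod ?k < ?k" using nat_mod_less[OF i(1)] .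
    moreover have "Suc (?k - Suc 0) = ?k" using i by linarith
    then have "?k - 1 - i = (?j + 1) mod ?k"
      using i by (cases "Suc i = ?k") (auto simp: Suc_diff_Suc)
    ultimately have "e = {ys ! ?j, ys ! ((?j + 1) mod ?k)}" "?j < ?k"
      using i by (auto simp: rev_nth insert_commute)
    then show "e \<in> cycle_edges ys" unfolding cycle_edges_def by blast
  qed
  show ?thesis using sub[of xs] sub[of "rev xs"] by auto
qed

text \<open>Prescribing the first two vertices selects one list among all rotations and reversals of
  a cycle through the edge, so that \<open>eps\<close> becomes a count of lists.\<close>

definition rooted_cycles :: "'a graph \<Rightarrow> nat \<Rightarrow> 'a \<Rightarrow> 'a \<Rightarrow> 'a list set" where
  "rooted_cycles G k a b = {xs. is_cycle G xs \<and> length xs = k \<and> xs ! 0 = a \<and> xs ! 1 = b}"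

text \<open>Within the common edge set, the vertex at position \<open>j\<close> has just two
  neighbours. One of them is the vertex at \<open>j - 1\<close>, so the next vertex is forced, and
  the two prescribed vertices start the induction.\<close>

lemma inj_on_cycle_edges_rooted: "inj_on cycle_edges (rooted_cycles G k a b)"
proof (rule inj_onI)
  fix xs ys
  assume xs: "xs \<in> rooted_cycles G k a b" and ys: "ys \<in> rooted_cycles G k a b"
    and eq: "cycle_edges xs = cycle_edges ys"
  have k: "3 \<le> k" "distinct xs" "distinct ys" "length xs = k" "length ys = k"
    using xs ys unfolding rooted_cycles_def is_cycle_def by auto
  have "i < k \<longrightarrow> xs ! i = ys ! i" for i
  proof (induction i rule: less_induct)
    case (less i)
    show ?case
    proof (cases "i < 2")
      case True
      then have "i = 0 \<or> i = 1" by auto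
      then show ?thesis using xs ys unfolding rooted_cycles_def by auto
    next
      case False
      show ?thesis
      proof
        assume ik: "i < k"
        define j where "j = i - 1"
        have j: "i = Suc j" "0 < j" "Suc j < k" using False ik unfolding j_def by auto
        have IH: "xs ! j = ys ! j" "xs ! (j - 1) = ys ! (j - 1)"
          using less j by auto
        have "{xs ! j, xs ! i} \<in> cycle_edges xs"
          unfolding cycle_edges_def using j k by fastforce
        then have "{xs ! j, xs ! i} \<in> cycle_edges ys" using eq by simp
        then obtain p where p: "p < k" "{xs ! j, xs ! i} = {ys ! p, ys ! ((p + 1) mod k)}"
          unfolding cycle_edges_def k(5) by blast
        have pk: "(p + 1) mod k < k" using nat_mod_less[OF p(1)] .
        from p(2) consider "ys ! j = ys ! p" "xs ! i = ys ! ((p + 1) mod k)"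
          | "ys ! j = ys ! ((p + 1) mod k)" "xs ! i = ys ! p"
          using IH by (auto simp: doubleton_eq_iff)
        then show "xs ! i = ys ! i"
        proof cases
          case 1
          then have "p = j" using k j p by (simp add: nth_eq_iff_index_eq)
          with 1 j show ?thesis by simp
        next
          case 2
          then have "j = (p + 1) mod k" using k j pk by (simp add: nth_eq_iff_index_eq)
          then have "p = j - 1" using j p by (cases "Suc p = k") auto
          then have "xs ! i = xs ! (j - 1)" using 2 IH by simp
          then show ?thesis using k j by (simp add: nth_eq_iff_index_eq)
        qed
      qed
    qed
  qed
  then show "xs = ys" using k by (simp add: nth_equalityI)
qed

lemma eps_eq_card_rooted_cycles:
  assumes "a \<noteq> b"
  shows "eps G {a, b} = card (rooted_cycles G (girth G) a b)"
proof -
  have "{C \<in> girth_cycles G. {a, b} \<in> C} = cycle_edges ` rooted_cycles G (girth G) a b"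
  proof (intro equalityI subsetI)
    fix C assume "C \<in> {C \<in> girth_cycles G. {a, b} \<in> C}"
    then obtain xs where xs: "is_cycle G xs" "C = cycle_edges xs" "card C = girth G" "{a, b} \<in> C"
      unfolding girth_cycles_def cycles_def by auto
    let ?k = "length xs"
    have k: "3 \<le> ?k" "distinct xs" "xs \<noteq> []" using xs unfolding is_cycle_def by auto
    have g: "girth G = ?k" using card_cycle_edges[of xs] xs k by simp
    obtain i where i: "i < ?k" "{a, b} = {xs ! i, xs ! ((i + 1) mod ?k)}"
      using xs unfolding cycle_edges_def by auto
    from i(2) consider "a = xs ! i" "b = xs ! ((i + 1) mod ?k)"
      | "b = xs ! i" "a = xs ! ((i + 1) mod ?k)" by (auto simp: doubleton_eq_iff)
    then show "C \<in> cycle_edges ` rooted_cycles G (girth G) a b"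
    proof cases
      case 1
      have "rotate i xs \<in> rooted_cycles G (girth G) a b"
        unfolding rooted_cycles_def using is_cycle_rotate[OF xs(1), of i] 1 i k g
          nth_rotate[of 0 xs i] nth_rotate[of 1 xs i] by simp
      then show ?thesis using xs(2) cycle_edges_rotate[of i xs] by blast
    next
      case 2
      \<comment> \<open>The list traverses the edge from \<open>b\<close> to \<open>a\<close>;
        \<open>?r\<close> is the position of \<open>a\<close> in the reversed list.\<close>
      let ?r = "?k - 1 - (i + 1) mod ?k"
      have "(i + 1) mod ?k < ?k" using nat_mod_less[OF i(1)] .
      moreover have "Suc (?k - Suc 0) = ?k" using i by linarith
      then have "(?r + 1) mod ?k = ?k - 1 - i"
        using i k by (cases "Suc i = ?k") (auto simp: Suc_diff_Suc)
      moreover have "rev xs ! (?k - 1 - p) = xs ! p" if "p < ?k" for p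
        using that by (simp add: rev_nth Suc_diff_Suc)
      moreover have "?r < ?k" using i(1) by linarith
      ultimately have "rev xs ! ?r = a" "rev xs ! ((?r + 1) mod ?k) = b" "?r < ?k"
        using 2 i(1) by metis+
      then have "rotate ?r (rev xs) \<in> rooted_cycles G (girth G) a b"
        unfolding rooted_cycles_def using is_cycle_rotate[OF is_cycle_rev[OF xs(1)], of ?r] k g
          nth_rotate[of 0 "rev xs" ?r] nth_rotate[of 1 "rev xs" ?r] by simp
      then show ?thesis using xs(2) cycle_edges_rotate cycle_edges_rev by (metis imageI)
    qed
  next
    fix C assume "C \<in> cycle_edges ` rooted_cycles G (girth G) a b"
    then obtain xs where xs: "is_cycle G xs" "length xs = girth G" "xs ! 0 = a" "xs ! 1 = b"
      "C = cycle_edges xs" unfolding rooted_cycles_def by auto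
    have k: "3 \<le> length xs" "distinct xs" using xs unfolding is_cycle_def by auto
    have "{a, b} \<in> C" unfolding xs(5) cycle_edges_def using xs k
      by (auto intro!: exI[of _ 0])
    then show "C \<in> {C \<in> girth_cycles G. {a, b} \<in> C}"
      using xs card_cycle_edges[OF k(2,1)] unfolding girth_cycles_def cycles_def by auto
  qed
  then show ?thesis unfolding eps_def using card_image[OF inj_on_cycle_edges_rooted] by metis
qed

section \<open>Invariance of girth and edge counts under isomorphism\<close>

lemma is_cycle_map:
  assumes f: "bij_betw f (verts G) (verts H)"
    and e: "\<And>u v. u \<in> verts G \<Longrightarrow> v \<in> verts G \<Longrightarrow> {u, v} \<in> edges G \<longleftrightarrow> {f u, f v} \<in> edges H"
    and c: "is_cycle G xs"
  shows "is_cycle H (map f xs)"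
proof -
  have k: "3 \<le> length xs" "distinct xs" "set xs \<subseteq> verts G" using c unfolding is_cycle_def by auto
  have "{f (xs ! i), f (xs ! (Suc i mod length xs))} \<in> edges H" if "i < length xs" for i
  proof -
    have "Suc i mod length xs < length xs" using nat_mod_less[OF that] .
    with e[of "xs ! i" "xs ! (Suc i mod length xs)"] show ?thesis
      using c that k unfolding is_cycle_def by (auto simp: subset_iff)
  qed
  moreover have "distinct (map f xs)"
    using k f by (auto simp: distinct_map bij_betw_def inj_on_subset)
  moreover have "set (map f xs) \<subseteq> verts H" using k f by (auto simp: bij_betw_def)
  moreover have "Suc i mod length xs < length xs" if "i < length xs" for i using nat_mod_less[OF that] .
  ultimately show ?thesis using k unfolding is_cycle_def by simp
qed

lemma graph_iso_girth:
  assumes "G \<cong>\<^sub>G H" shows "girth G = girth H"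
proof -
  have *: "\<exists>xs. is_cycle H xs \<and> length xs = k"
    if "G \<cong>\<^sub>G H" "is_cycle G xs" "length xs = k" for G :: "'c graph" and H :: "'d graph" and xs k
    using that is_cycle_map[of _ G H xs] unfolding graph_iso_def by (metis length_map)
  have "(\<exists>xs. is_cycle G xs \<and> length xs = k) \<longleftrightarrow> (\<exists>xs. is_cycle H xs \<and> length xs = k)" for k
    using *[OF assms] *[OF graph_iso_sym[OF assms]] by blast
  then show ?thesis unfolding girth_def_list by simp
qed

lemma graph_iso_eps:
  assumes f: "bij_betw f (verts G) (verts H)"
    and e: "\<And>u v. u \<in> verts G \<Longrightarrow> v \<in> verts G \<Longrightarrow> {u, v} \<in> edges G \<longleftrightarrow> {f u, f v} \<in> edges H"
    and ab: "a \<in> verts G" "b \<in> verts G" "a \<noteq> b"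
  shows "eps H {f a, f b} = eps G {a, b}"
proof -
  have "G \<cong>\<^sub>G H" using f e unfolding graph_iso_def by blast
  then have g: "girth H = girth G" using graph_iso_girth by metis
  have ne: "f a \<noteq> f b" using f ab unfolding bij_betw_def inj_on_def by blast
  let ?k = "girth G" and ?g = "inv_into (verts G) f"
  have gb: "bij_betw ?g (verts H) (verts G)" using f by (rule bij_betw_inv_into)
  have ge: "{u, v} \<in> edges H \<longleftrightarrow> {?g u, ?g v} \<in> edges G" if "u \<in> verts H" "v \<in> verts H" for u v
    using e[of "?g u" "?g v"] that bij_betw_apply[OF gb] bij_betw_inv_into_right[OF f] by simp
  have "bij_betw (map f) (rooted_cycles G ?k a b) (rooted_cycles H ?k (f a) (f b))"
  proof (rule bij_betw_byWitness[where f' = "map ?g"])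
    show "\<forall>xs\<in>rooted_cycles G ?k a b. map ?g (map f xs) = xs"
      using f unfolding rooted_cycles_def is_cycle_def
      by (auto intro!: map_idI simp: bij_betw_inv_into_left subset_iff)
    show "\<forall>xs\<in>rooted_cycles H ?k (f a) (f b). map f (map ?g xs) = xs"
      using f unfolding rooted_cycles_def is_cycle_def
      by (auto intro!: map_idI simp: bij_betw_inv_into_right subset_iff)
    show "map f ` rooted_cycles G ?k a b \<subseteq> rooted_cycles H ?k (f a) (f b)"
    proof (intro image_subsetI)
      fix xs assume xs: "xs \<in> rooted_cycles G ?k a b"
      then have "3 \<le> length xs" unfolding rooted_cycles_def is_cycle_def by auto
      then show "map f xs \<in> rooted_cycles H ?k (f a) (f b)"
        using xs is_cycle_map[OF f e] unfolding rooted_cycles_def by auto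
    qed
    show "map ?g ` rooted_cycles H ?k (f a) (f b) \<subseteq> rooted_cycles G ?k a b"
    proof (intro image_subsetI)
      fix xs assume xs: "xs \<in> rooted_cycles H ?k (f a) (f b)"
      then have "3 \<le> length xs" unfolding rooted_cycles_def is_cycle_def by auto
      then show "map ?g xs \<in> rooted_cycles G ?k a b"
        using xs is_cycle_map[OF gb ge] ab f unfolding rooted_cycles_def
        by (auto simp: bij_betw_inv_into_left)
    qed
  qed
  then show ?thesis
    unfolding eps_eq_card_rooted_cycles[OF ne] eps_eq_card_rooted_cycles[OF ab(3)] g
    by (metis bij_betw_same_card)
qed

subsection \<open>Quotients of the brick wall\<close>

text \<open>A direction labels one of the three edge classes of the brick wall and is named as seen from a point
  with odd coordinate sum; from an even point it is traversed backwards.\<close>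

datatype direction = Up | Down | Side

fun step :: "direction \<Rightarrow> int \<times> int \<Rightarrow> int \<times> int" where
  "step Up (i, j) = (if odd (i + j) then (i, j + 1) else (i, j - 1))"
| "step Down (i, j) = (if odd (i + j) then (i, j - 1) else (i, j + 1))"
| "step Side (i, j) = (if odd (i + j) then (i + 1, j) else (i - 1, j))"

lemma step_step [simp]: "step s (step s u) = u"
  by (cases u; cases s) auto

fun odd_point :: "int \<times> int \<Rightarrow> bool" where
  "odd_point (i, j) = odd (i + j)"

lemma odd_point_step [simp]: "odd_point (step s u) \<longleftrightarrow> \<not> odd_point u"
  by (cases u; cases s) auto

lemma odd_point_diff: "odd_point (u - v) \<longleftrightarrow> odd_point u \<noteq> odd_point v"
  by (cases u; cases v) auto

lemma step_diff: "odd_point u = odd_point v \<Longrightarrow> step s u - step s v = u - v"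
  by (cases u; cases v; cases s) auto

text \<open>The half turn about (1/2, 0) exchanges odd and even points but keeps all direction
  labels, because labels are read backwards from even points.\<close>

lemma flip_step: "(1, 0) - step s u = step s ((1, 0) - u)"
  by (cases u; cases s) auto

text \<open>That \<open>L\<close> is a subgroup follows from \<open>fiber\<close>, as the class of 0
  under a translation-invariant equivalence. The assumption \<open>even_L\<close> makes translations
  by \<open>L\<close> commute with \<open>step\<close>, so that directions and the bipartition
  descend to \<open>G\<close>.\<close>

locale hex_cover =
  fixes G :: "'a graph" and \<phi> :: "int \<times> int \<Rightarrow> 'a" and L :: "(int \<times> int) set"
  assumes finite_verts: "finite (verts G)"
    and verts_eq: "verts G = range \<phi>"
    and fiber: "\<And>u v. \<phi> u = \<phi> v \<longleftrightarrow> u - v \<in> L"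
    and edges_eq: "edges G = {{\<phi> u, \<phi> (step s u)} | u s. True}"
    and even_L: "\<And>u. u \<in> L \<Longrightarrow> \<not> odd_point u"
begin

lemma zero_in_L: "0 \<in> L" "(0, 0) \<in> L"
  using fiber[of 0 0] by (auto simp: zero_prod_def)

lemma diff_in_L: "u \<in> L \<Longrightarrow> v \<in> L \<Longrightarrow> u - v \<in> L"
  using fiber[of u 0] fiber[of v 0] fiber[of u v] by simp

lemma neg_in_L: "u \<in> L \<Longrightarrow> - u \<in> L"
  using diff_in_L[OF zero_in_L(1)] by simp

lemma neg_in_L_iff: "- u \<in> L \<longleftrightarrow> u \<in> L"
  using neg_in_L[of u] neg_in_L[of "- u"] by (metis minus_minus)

lemma add_in_L: "u \<in> L \<Longrightarrow> v \<in> L \<Longrightarrow> u + v \<in> L"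
  using diff_in_L[OF _ neg_in_L, of u v] by simp

lemma mult_in_L:
  assumes "(i, j) \<in> L" shows "(k * i, k * j) \<in> L"
proof -
  have nat: "(int k * i, int k * j) \<in> L" for k
  proof (induction k)
    case (Suc k)
    then show ?case using add_in_L[OF Suc assms] by (simp add: algebra_simps)
  qed (simp add: zero_in_L)
  show ?thesis using nat neg_in_L[OF nat] by (cases k rule: int_cases2) simp_all
qed

lemma fiber_step: "\<phi> u = \<phi> v \<Longrightarrow> \<phi> (step s u) = \<phi> (step s v)"
  using fiber[of u v] fiber[of "step s u" "step s v"] even_L[of "u - v"] step_diff[of u v s]
  by (auto simp: odd_point_diff)

lemma fiber_odd_point: "\<phi> u = \<phi> v \<Longrightarrow> odd_point u = odd_point v"
  using fiber[of u v] even_L[of "u - v"] by (auto simp: odd_point_diff)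

lemma edgeI: "{\<phi> u, \<phi> (step s u)} \<in> edges G"
  unfolding edges_eq by blast

lemma edge_iff: "{\<phi> u, x} \<in> edges G \<longleftrightarrow> (\<exists>s. x = \<phi> (step s u))"
proof
  assume "{\<phi> u, x} \<in> edges G"
  then obtain v s where "{\<phi> u, x} = {\<phi> v, \<phi> (step s v)}" unfolding edges_eq by blast
  then consider "\<phi> u = \<phi> v" "x = \<phi> (step s v)" | "\<phi> u = \<phi> (step s v)" "x = \<phi> v"
    by (auto simp: doubleton_eq_iff)
  then show "\<exists>s. x = \<phi> (step s u)"
    by cases (use fiber_step step_step in metis)+
qed (unfold edges_eq, blast)

lemma nbhd_eq: "nbhd G (\<phi> u) = {\<phi> (step s u) | s. True}"
  unfolding nbhd_def using edge_iff[of u] by (auto simp: verts_eq insert_commute)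

lemma step_ne: "\<phi> (step s u) \<noteq> \<phi> u"
  using fiber_odd_point[of "step s u" u] by auto

text \<open>Pigeonhole: an infinite column maps into finitely many vertices.\<close>

lemma exists_vertical: "\<exists>j>0. (0, j) \<in> L"
proof -
  have "\<not> inj (\<lambda>j. \<phi> (0, j :: int))"
  proof
    assume "inj (\<lambda>j. \<phi> (0, j :: int))"
    moreover have "range (\<lambda>j. \<phi> (0, j)) \<subseteq> verts G" using verts_eq by auto
    ultimately show False using finite_verts
      by (meson finite_imageD finite_subset infinite_UNIV_int)
  qed
  then obtain i j :: int where "i \<noteq> j" "(0, i - j) \<in> L" "(0, j - i) \<in> L"
    unfolding inj_def using fiber neg_in_L by fastforce
  then show ?thesis by (cases "i < j") (auto intro: exI[of _ "i - j"] exI[of _ "j - i"])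
qed

lemma exists_horizontal: "\<exists>i>0. (i, 0) \<in> L"
proof -
  have "\<not> inj (\<lambda>i. \<phi> (i :: int, 0))"
  proof
    assume "inj (\<lambda>j. \<phi> (j :: int, 0))"
    moreover have "range (\<lambda>j. \<phi> (j, 0)) \<subseteq> verts G" using verts_eq by auto
    ultimately show False using finite_verts
      by (meson finite_imageD finite_subset infinite_UNIV_int)
  qed
  then obtain i j :: int where "i \<noteq> j" "(i - j, 0) \<in> L" "(j - i, 0) \<in> L"
    unfolding inj_def using fiber neg_in_L by fastforce
  then show ?thesis by (cases "i < j") (auto intro: exI[of _ "i - j"] exI[of _ "j - i"])
qed

text \<open>Change of coordinates by a symmetry of the brick wall. The direction \<open>t\<close>
  may depend on the point, so the symmetry is free to permute the three edge classes.\<close>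

lemma hex_cover_comp:
  assumes "surj \<tau>" "\<And>s u. \<exists>t. \<tau> (step s u) = step t (\<tau> u)"
    and "\<And>t u. \<exists>s. step t (\<tau> u) = \<tau> (step s u)"
    and "\<And>u v. \<tau> u - \<tau> v \<in> L \<longleftrightarrow> u - v \<in> L'" "\<And>u. u \<in> L' \<Longrightarrow> \<not> odd_point u"
  shows "hex_cover G (\<phi> \<circ> \<tau>) L'"
proof
  show "verts G = range (\<phi> \<circ> \<tau>)" using assms(1) verts_eq by (metis image_comp)
  show "edges G = {{(\<phi> \<circ> \<tau>) u, (\<phi> \<circ> \<tau>) (step s u)} |u s. True}"
  proof (intro equalityI subsetI)
    fix e assume "e \<in> edges G"
    then obtain v t where e: "e = {\<phi> v, \<phi> (step t v)}" unfolding edges_eq by auto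
    obtain u where u: "v = \<tau> u" using assms(1) by (rule surjE)
    obtain s where "step t v = \<tau> (step s u)" using assms(3) u by blast
    then show "e \<in> {{(\<phi> \<circ> \<tau>) u, (\<phi> \<circ> \<tau>) (step s u)} |u s. True}"
      unfolding e u comp_apply by (metis (mono_tags, lifting) mem_Collect_eq)
  next
    fix e assume "e \<in> {{(\<phi> \<circ> \<tau>) u, (\<phi> \<circ> \<tau>) (step s u)} |u s. True}"
    then obtain u s where e: "e = {\<phi> (\<tau> u), \<phi> (\<tau> (step s u))}" by auto
    moreover obtain t where "\<tau> (step s u) = step t (\<tau> u)" using assms(2) by blast
    ultimately show "e \<in> edges G" using edgeI by simp
  qed
qed (use assms finite_verts fiber in auto)

lemma hex_cover_flip: "hex_cover G (\<phi> \<circ> (\<lambda>u. (1, 0) - u)) L"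
proof (rule hex_cover_comp)
  show "surj (\<lambda>u. (1, 0) - u :: int \<times> int)" by (metis surj_def diff_diff_eq2 add_diff_cancel_left')
  show "\<exists>t. (1, 0) - step s u = step t ((1, 0) - u)" for s u using flip_step by blast
  show "\<exists>t. step s ((1, 0) - u) = (1, 0) - step t u" for s u using flip_step by metis
  show "(1, 0) - u - ((1, 0) - v) \<in> L \<longleftrightarrow> u - v \<in> L" for u v
    using neg_in_L_iff[of "u - v"] by simp
qed (rule even_L)

lemma hex_cover_reflect: "hex_cover G (\<phi> \<circ> (\<lambda>(i, j). (i, - j))) {(i, j). (i, - j) \<in> L}"
proof (rule hex_cover_comp)
  let ?\<tau> = "\<lambda>(i, j). (i, - j) :: int \<times> int"
  have inv: "?\<tau> (?\<tau> u) = u" for u by (cases u) auto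
  then show "surj ?\<tau>" by (rule surjI)
  have *: "\<exists>t. ?\<tau> (step s u) = step t (?\<tau> u)" for s u
    by (cases u; cases s) (auto intro: exI[of _ Up] exI[of _ Down] exI[of _ Side])
  then show "\<exists>t. ?\<tau> (step s u) = step t (?\<tau> u)" for s u .
  show "\<exists>s. step t (?\<tau> u) = ?\<tau> (step s u)" for t u
    using *[of t "?\<tau> u"] inv by metis
  show "?\<tau> u - ?\<tau> v \<in> L \<longleftrightarrow> u - v \<in> {(i, j). (i, - j) \<in> L}" for u v
    by (cases u; cases v) (auto simp: algebra_simps)
  show "\<not> odd_point u" if "u \<in> {(i, j). (i, - j) \<in> L}" for u
    using that even_L by (cases u) fastforce
qed

text \<open>The linear part of this symmetry is \<open>(i, j) \<mapsto> ((j - i) / 2, (3 i + j) / 2)\<close>; the rounding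
  makes it fix the edge from \<open>(0, 0)\<close> to \<open>(0, 1)\<close>.\<close>

lemma hex_cover_turn:
  "hex_cover G (\<phi> \<circ> (\<lambda>(i, j). ((j - i) div 2, (3 * i + j + 1) div 2)))
    {(i, j). even (i + j) \<and> ((j - i) div 2, (3 * i + j) div 2) \<in> L}"
proof (rule hex_cover_comp)
  let ?\<tau> = "\<lambda>(i, j). ((j - i) div 2, (3 * i + j + 1) div 2) :: int \<times> int"
  have eo: "\<exists>k. j = i + 2 * k \<or> j = i + 2 * k + 1" for i j :: int
    by presburger
  have inv: "?\<tau> (?\<tau> u) = u" for u
  proof (cases u)
    case (Pair i j)
    then show ?thesis using eo[of j i] by auto
  qed
  then show "surj ?\<tau>" by (rule surjI)
  have *: "\<exists>t. ?\<tau> (step s u) = step t (?\<tau> u)" for s u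
  proof -
    obtain i j where u: "u = (i, j)" by fastforce
    \<comment> \<open>The map is a reflection: it keeps the class \<open>Down\<close> and exchanges
      \<open>Up\<close> with \<open>Side\<close>.\<close>
    define t where "t = (case s of Up \<Rightarrow> Side | Down \<Rightarrow> Down | Side \<Rightarrow> Up)"
    have "?\<tau> (step s u) = step t (?\<tau> u)"
      unfolding u t_def using eo[of j i]
    proof (elim exE disjE)
      fix k assume "j = i + 2 * k"
      then show "?\<tau> (step s (i, j)) =
          step (case s of Up \<Rightarrow> Side | Down \<Rightarrow> Down | Side \<Rightarrow> Up) (?\<tau> (i, j))"
        by (cases s; simp; presburger?)
    next
      fix k assume "j = i + 2 * k + 1"
      then show "?\<tau> (step s (i, j)) =
          step (case s of Up \<Rightarrow> Side | Down \<Rightarrow> Down | Side \<Rightarrow> Up) (?\<tau> (i, j))"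
        by (cases s; simp; presburger?)
    qed
    then show ?thesis ..
  qed
  then show "\<exists>t. ?\<tau> (step s u) = step t (?\<tau> u)" for s u .
  show "\<exists>s. step t (?\<tau> u) = ?\<tau> (step s u)" for t u
  proof -
    obtain t' where "?\<tau> (step t (?\<tau> u)) = step t' u"
      using *[of t "?\<tau> u"] unfolding inv by blast
    then have "?\<tau> (?\<tau> (step t (?\<tau> u))) = ?\<tau> (step t' u)" by (rule arg_cong)
    then show ?thesis unfolding inv by blast
  qed
  show "?\<tau> u - ?\<tau> v \<in> L \<longleftrightarrow> u - v \<in> {(i, j). even (i + j) \<and> ((j - i) div 2, (3 * i + j) div 2) \<in> L}"
    (is "?A \<longleftrightarrow> ?B") for u v
  proof -
    obtain i j i' j' where u: "u = (i, j)" and v: "v = (i', j')" by (metis surj_pair)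
    show ?thesis
    proof (cases "even (i + j) = even (i' + j')")
      case True
      then have "?\<tau> u - ?\<tau> v = (((j - j') - (i - i')) div 2, (3 * (i - i') + (j - j')) div 2)"
      proof -
        obtain k k' where "j = i + 2 * k \<and> j' = i' + 2 * k' \<or>
            j = i + 2 * k + 1 \<and> j' = i' + 2 * k' + 1"
          using eo[of j i] eo[of j' i'] True by fastforce
        moreover have "(3 * a + (a + 2 * b) + 1) div 2 = 2 * a + b \<and>
            (3 * a + (a + 2 * b + 1) + 1) div 2 = 2 * a + b + 1 \<and>
            (3 * a + (a + 2 * b)) div 2 = 2 * a + b" for a b :: int
          by (intro conjI) presburger+
        moreover have "(j - j') - (i - i') = 2 * (k - k')"
          "3 * (i - i') + (j - j') = 2 * (2 * (i - i') + k - k')"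
          using calculation(1) by auto
        ultimately show ?thesis unfolding u v by auto
      qed
      moreover have "even ((i - i') + (j - j'))" using True by (auto simp: algebra_simps)
      ultimately show ?thesis unfolding u v by simp
    next
      case False
      then have "odd_point (?\<tau> u - ?\<tau> v)"
        unfolding u v using eo[of j i] eo[of j' i'] by (elim exE disjE) (simp; presburger)+
      then have "?\<tau> u - ?\<tau> v \<notin> L" using even_L by blast
      moreover have "odd ((i - i') + (j - j'))" using False by (auto simp: algebra_simps)
      ultimately show ?thesis unfolding u v by simp
    qed
  qed
qed auto

end

text \<open>The lattice determines the quotient. Isomorphisms between honeycomb toroidal graphs are
  obtained below by turning or reflecting one lattice into another.\<close>

lemma hex_cover_iso:
  assumes "hex_cover G \<phi> L" "hex_cover H \<psi> L" shows "G \<cong>\<^sub>G H"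
proof -
  interpret G: hex_cover G \<phi> L by fact
  interpret H: hex_cover H \<psi> L by fact
  define f where "f = (\<lambda>x. \<psi> (SOME u. \<phi> u = x))"
  define g where "g = (\<lambda>x. \<phi> (SOME u. \<psi> u = x))"
  have f: "f (\<phi> u) = \<psi> u" for u
    unfolding f_def using someI[of "\<lambda>v. \<phi> v = \<phi> u" u] G.fiber H.fiber by metis
  have g: "g (\<psi> u) = \<phi> u" for u
    unfolding g_def using someI[of "\<lambda>v. \<psi> v = \<psi> u" u] G.fiber H.fiber by metis
  show ?thesis
    by (rule graph_isoI[of _ f _ g])
      (auto simp: G.verts_eq H.verts_eq G.edges_eq H.edges_eq f g, (metis f g)+)
qed

text \<open>The lattice spanned by (0, n) and (m, -l): moving \<open>m\<close> columns to the right
  passes one jump, which raises the second coordinate by \<open>l\<close>.\<close>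

definition HTG_lattice :: "nat \<Rightarrow> nat \<Rightarrow> nat \<Rightarrow> (int \<times> int) set" where
  "HTG_lattice m n l = {(i, j). int m dvd i \<and> int n dvd j + int l * (i div int m)}"

definition HTG_map :: "nat \<Rightarrow> nat \<Rightarrow> nat \<Rightarrow> int \<times> int \<Rightarrow> nat \<times> nat" where
  "HTG_map m n l = (\<lambda>(i, j). (nat (i mod int m), nat ((j + int l * (i div int m)) mod int n)))"

text \<open>Horizontal edges and jumps are the same kind of edge upstairs: a jump is a
  \<open>Side\<close> step that leaves column \<open>m - 1\<close>.\<close>

lemma hex_cover_HTG:
  assumes "1 \<le> m" "1 \<le> n" "even n" "l mod 2 = m mod 2"
  shows "hex_cover (HTG m n l) (HTG_map m n l) (HTG_lattice m n l)"
proof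
  let ?\<phi> = "HTG_map m n l"
  have pos: "int m > 0" "int n > 0" using assms by auto
  have lm: "even (int l) = even (int m)" using assms by presburger
  have fin: "verts (HTG m n l) = {..<m} \<times> {..<n}" unfolding HTG_def by auto
  then show "finite (verts (HTG m n l))" by simp
  have in_verts: "?\<phi> u \<in> {..<m} \<times> {..<n}" for u
    using pos by (cases u) (auto simp: HTG_map_def nat_less_iff)
  have base: "?\<phi> (int i, j) = (i, nat (j mod int n))" if "i < m" for i j
    using that by (simp add: HTG_map_def)
  show "verts (HTG m n l) = range ?\<phi>"
  proof (intro equalityI subsetI)
    fix x assume "x \<in> verts (HTG m n l)"
    then obtain i j where "x = (i, j)" "i < m" "j < n" unfolding fin by auto
    then have "x = ?\<phi> (int i, int j)" using base[of i "int j"] by simp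
    then show "x \<in> range ?\<phi>" by blast
  qed (use fin in_verts in blast)
  show "?\<phi> u = ?\<phi> v \<longleftrightarrow> u - v \<in> HTG_lattice m n l" for u v
  proof -
    obtain i j i' j' where u: "u = (i, j)" and v: "v = (i', j')" by (metis surj_pair)
    have "?\<phi> u = ?\<phi> v \<longleftrightarrow> i mod int m = i' mod int m \<and>
        (j + int l * (i div int m)) mod int n = (j' + int l * (i' div int m)) mod int n"
      unfolding u v HTG_map_def using pos by (auto simp: nat_eq_iff)
    also have "\<dots> \<longleftrightarrow> int m dvd i - i' \<and>
        int n dvd (j - j') + int l * (i div int m - i' div int m)"
      by (simp add: mod_eq_dvd_iff algebra_simps)
    also have "\<dots> \<longleftrightarrow> u - v \<in> HTG_lattice m n l"
    proof (cases "int m dvd i - i'")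
      case True
      then obtain k where "i = i' + int m * k" by (metis dvdE add_diff_cancel_left' diff_add_cancel)
      then have "i div int m - i' div int m = k" "(i - i') div int m = k" using pos by auto
      then show ?thesis unfolding u v HTG_lattice_def by simp
    qed (simp add: u v HTG_lattice_def)
    finally show ?thesis .
  qed
  show "\<not> odd_point u" if "u \<in> HTG_lattice m n l" for u
  proof -
    obtain i j where u: "u = (i, j)" by fastforce
    have "int m dvd i" "int n dvd j + int l * (i div int m)"
      using that unfolding u HTG_lattice_def by auto
    then obtain k where k: "i = int m * k" "int n dvd j + int l * k" using pos by auto
    then have "even (j + int l * k)" using assms(3) by (meson dvd_trans even_of_nat)
    then show ?thesis using lm unfolding u k(1) by auto
  qed
  show "edges (HTG m n l) = {{?\<phi> u, ?\<phi> (step s u)} |u s. True}" (is "_ = ?E")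
  proof (intro equalityI subsetI)
    fix e assume "e \<in> edges (HTG m n l)"
    then consider (V) i j where "i < m" "j < n" "e = {(i, j), (i, (j + 1) mod n)}"
      | (H) i j where "i + 1 < m" "j < n" "(i + 1) mod 2 = j mod 2" "e = {(i, j), (i + 1, j)}"
      | (J) j where "j < n" "j mod 2 = m mod 2" "e = {(m - 1, j), (0, (j + l) mod n)}"
      unfolding HTG_def by auto
    then show "e \<in> ?E"
    proof cases
      case V
      have "?\<phi> (int i, int j + 1) = (i, (j + 1) mod n)"
        using base[of i "int j + 1"] V by (simp add: nat_mod_distrib nat_add_distrib)
      moreover have "?\<phi> (int i, int j) = (i, j)" using base[of i "int j"] V by simp
      moreover obtain s where "step s (int i, int j) = (int i, int j + 1)"
        by (cases "odd (int i + int j)") (metis step.simps)+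
      ultimately show ?thesis using V(3) by (metis (mono_tags, lifting) mem_Collect_eq)
    next
      case H
      have "?\<phi> (int i, int j) = (i, j)" using base[of i "int j"] H by simp
      moreover have "?\<phi> (int i + 1, int j) = (i + 1, j)" using base[of "i + 1" "int j"] H
        by (simp add: add.commute)
      moreover have "odd (int i + int j)" using H(3) by presburger
      then have "step Side (int i, int j) = (int i + 1, int j)" by simp
      ultimately show ?thesis using H(4) by (metis (mono_tags, lifting) mem_Collect_eq)
    next
      case J
      have i: "int (m - 1) = int m - 1" using assms by simp
      have "?\<phi> (int m - 1, int j) = (m - 1, j)" using base[of "m - 1" "int j"] J assms(1) i by simp
      moreover have "?\<phi> (int m, int j) = (0, (j + l) mod n)" 
        using pos unfolding HTG_map_def by (simp add: nat_mod_distrib nat_add_distrib)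
      moreover have "odd (int m - 1 + int j)" using J(2) by presburger
      then have "step Side (int m - 1, int j) = (int m, int j)" by simp
      ultimately show ?thesis using J(3) by (metis (mono_tags, lifting) mem_Collect_eq)
    qed
  next
    \<comment> \<open>Odd starting points suffice, since a step from an even point is the same edge
      traversed from its odd end.\<close>
    have *: "{?\<phi> u, ?\<phi> (step s u)} \<in> edges (HTG m n l)" if odd: "odd_point u" for u s
    proof -
      obtain I J where u: "u = (I, J)" by fastforce
      have vert: "{?\<phi> (I, J'), ?\<phi> (I, J' + 1)} \<in> edges (HTG m n l)" for J'
      proof -
        obtain i j where ij: "?\<phi> (I, J') = (i, j)" by fastforce
        then have b: "i < m" "j < n" using in_verts[of "(I, J')"] by auto
        have "int j = (J' + int l * (I div int m)) mod int n" "int i = I mod int m"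
          using ij pos unfolding HTG_map_def by auto
        then have "(J' + 1 + int l * (I div int m)) mod int n = int ((j + 1) mod n)"
          by (simp add: zmod_int mod_simps ac_simps)
        then have "?\<phi> (I, J' + 1) = (i, (j + 1) mod n)"
          using ij unfolding HTG_map_def by simp
        then show ?thesis using ij b unfolding HTG_def by auto
      qed
      show ?thesis
      proof (cases s)
        case Up
        then show ?thesis using vert[of J] odd unfolding u by simp
      next
        case Down
        then show ?thesis using vert[of "J - 1"] odd unfolding u by (simp add: insert_commute)
      next
        case Side
        obtain i j where ij: "?\<phi> (I, J) = (i, j)" by fastforce
        then have b: "i < m" "j < n" using in_verts[of "(I, J)"] by auto
        have j: "int j = (J + int l * (I div int m)) mod int n" and i: "int i = I mod int m"
          using ij pos unfolding HTG_map_def by auto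
        have I: "I = int m * (I div int m) + int i" using i by simp
        \<comment> \<open>Reduction to the fundamental domain keeps the parity of the coordinate
          sum: \<open>n\<close> is even, and \<open>l\<close>, added once per \<open>m\<close>
          columns, has the parity of \<open>m\<close>.\<close>
        have "even (int j) = even (J + int l * (I div int m))"
          unfolding j using assms(3) by (simp add: dvd_mod_iff)
        moreover have "even I = even (int m * (I div int m) + int i)" using I by metis
        ultimately have par: "odd (int i + int j)" using odd lm unfolding u by auto
        show ?thesis
        proof (cases "i + 1 < m")
          case True
          have "I + 1 = int m * (I div int m) + int (i + 1)" using I by simp
          then have "(I + 1) div int m = I div int m" "(I + 1) mod int m = int (i + 1)"
            using True by (metis div_mult_self4 pos(1) less_irrefl of_nat_0_le_iff of_nat_less_iff
              add_0 div_pos_pos_trivial add.right_neutral mod_mult_self4 mod_pos_pos_trivial)+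
          then have "?\<phi> (I + 1, J) = (i + 1, j)" using ij unfolding HTG_map_def by auto
          moreover have "(i + 1) mod 2 = j mod 2" using par by presburger
          ultimately show ?thesis using ij b True odd unfolding u Side HTG_def by auto
        next
          case False
          then have im: "i = m - 1" using b by simp
          then have "I + 1 = int m * (I div int m + 1)" using I assms(1)
            by (simp add: algebra_simps)
          then have "(I + 1) div int m = I div int m + 1" "(I + 1) mod int m = 0"
            using pos by auto
          moreover have "(J + int l * (I div int m + 1)) mod int n = int ((j + l) mod n)"
            using j by (simp add: zmod_int mod_simps algebra_simps)
          ultimately have "?\<phi> (I + 1, J) = (0, (j + l) mod n)" unfolding HTG_map_def by simp
          moreover have "j mod 2 = m mod 2" using par im assms(1) by presburger
          ultimately have "{(m - 1, j), (0, (j + l) mod n)} \<in> edges (HTG m n l)"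
            unfolding HTG_def snd_conv using b by blast
          then show ?thesis using ij im odd \<open>?\<phi> (I + 1, J) = (0, (j + l) mod n)\<close>
            unfolding u Side by simp
        qed
      qed
    qed
    fix e assume "e \<in> ?E"
    then obtain u s where e: "e = {?\<phi> u, ?\<phi> (step s u)}" by auto
    show "e \<in> edges (HTG m n l)"
    proof (cases "odd_point u")
      case True
      then show ?thesis using * e by blast
    next
      case False
      then have "{?\<phi> (step s u), ?\<phi> u} \<in> edges (HTG m n l)" using *[of "step s u" s] by simp
      then show ?thesis using e by (simp add: insert_commute)
    qed
  qed
qed

subsection \<open>Rainbow domination\<close>

text \<open>Every vertex \<open>v\<close> with \<open>f v = {}\<close> needs total weight at least three around it, and each unit
  of weight is seen by at most three such vertices. Weight \<open>|V| / 2\<close> makes both estimates sharp.\<close>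

lemma is_3RDR_tight:
  assumes "is_3RDR G"
  obtains f where "is_3RDF G f" "\<And>v. v \<in> verts G \<Longrightarrow> card (f v) \<le> 1"
    "\<And>u v. v \<in> verts G \<Longrightarrow> f v \<noteq> {} \<Longrightarrow> u \<in> nbhd G v \<Longrightarrow> f u = {}"
proof -
  let ?V = "verts G"
  have fin: "finite ?V" and cub: "\<And>v. v \<in> ?V \<Longrightarrow> card (nbhd G v) = 3"
    and gam: "2 * gamma_r3 G = card ?V"
    using assms unfolding is_3RDR_def simple_graph_def cubic_def by auto
  have "is_3RDF G (\<lambda>_. {1, 2, 3})" unfolding is_3RDF_def by auto
  then have "\<exists>w f. is_3RDF G f \<and> w = (\<Sum>v\<in>?V. card (f v))" by blast
  then have "\<exists>f. is_3RDF G f \<and> gamma_r3 G = (\<Sum>v\<in>?V. card (f v))"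
    unfolding gamma_r3_def by (rule LeastI_ex)
  then obtain f where f: "is_3RDF G f" and wt: "gamma_r3 G = (\<Sum>v\<in>?V. card (f v))" by blast
  define w where "w = gamma_r3 G"
  define Z where "Z = {v \<in> ?V. f v = {}}"
  define W where "W = {v \<in> ?V. f v \<noteq> {}}"
  have finZW: "finite Z" "finite W" "?V = Z \<union> W" "Z \<inter> W = {}"
    using fin unfolding Z_def W_def by auto
  have sub: "f v \<subseteq> {1, 2, 3}" "finite (f v)" if "v \<in> ?V" for v
    using f that finite_subset[of "f v" "{1, 2, 3}"] unfolding is_3RDF_def by auto
  have nb: "finite (nbhd G v)" "nbhd G v \<subseteq> ?V" for v
    using fin unfolding nbhd_def by auto
  have wW: "w = (\<Sum>v\<in>W. card (f v))"
    unfolding w_def wt by (rule sum.mono_neutral_right) (use fin in \<open>auto simp: W_def\<close>)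
  have pos: "1 \<le> card (f v)" if "v \<in> W" for v
    using that sub[of v] card_gt_0_iff[of "f v"] unfolding W_def by simp
  have W_le: "card W \<le> w"
    unfolding wW using sum_mono[of W "\<lambda>_. 1" "\<lambda>v. card (f v)"] pos by simp
  have "3 * card Z = (\<Sum>z\<in>Z. 3)" by simp
  also have "\<dots> \<le> (\<Sum>z\<in>Z. \<Sum>u\<in>nbhd G z. card (f u))"
  proof (rule sum_mono)
    fix z assume "z \<in> Z"
    then have "(\<Union>u\<in>nbhd G z. f u) = {1, 2, 3}" using f unfolding Z_def is_3RDF_def by auto
    then have "3 = card (\<Union>u\<in>nbhd G z. f u)" by simp
    also have "\<dots> \<le> (\<Sum>u\<in>nbhd G z. card (f u))" using nb by (intro card_UN_le)
    finally show "3 \<le> (\<Sum>u\<in>nbhd G z. card (f u))" .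
  qed
  also have "\<dots> = (\<Sum>z\<in>Z. \<Sum>u\<in>{u. u \<in> ?V \<and> u \<in> nbhd G z}. card (f u))"
    by (intro sum.cong) (auto simp: nbhd_def)
  also have "\<dots> = (\<Sum>u\<in>?V. \<Sum>z\<in>{z. z \<in> Z \<and> u \<in> nbhd G z}. card (f u))"
    by (rule sum.swap_restrict) (use fin finZW in auto)
  also have "\<dots> = (\<Sum>u\<in>?V. card (f u) * card (Z \<inter> nbhd G u))"
  proof (rule sum.cong)
    fix u assume "u \<in> ?V"
    then have "{z. z \<in> Z \<and> u \<in> nbhd G z} = Z \<inter> nbhd G u"
      unfolding Z_def nbhd_def by (auto simp: insert_commute)
    then show "(\<Sum>z\<in>{z. z \<in> Z \<and> u \<in> nbhd G z}. card (f u)) = card (f u) * card (Z \<inter> nbhd G u)"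
      by simp
  qed simp
  finally have Z_le: "3 * card Z \<le> (\<Sum>u\<in>?V. card (f u) * card (Z \<inter> nbhd G u))" .
  have le3: "card (f u) * card (Z \<inter> nbhd G u) \<le> card (f u) * 3" if "u \<in> ?V" for u
    using card_mono[OF nb(1)[of u], of "Z \<inter> nbhd G u"] cub[OF that] by simp
  have le3': "(\<Sum>u\<in>?V. card (f u) * card (Z \<inter> nbhd G u)) \<le> (\<Sum>u\<in>?V. card (f u) * 3)"
    by (rule sum_mono) (rule le3)
  have w3: "(\<Sum>u\<in>?V. card (f u) * 3) = 3 * w"
    unfolding w_def wt by (simp add: sum_distrib_left mult.commute)
  \<comment> \<open>Both \<open>card Z\<close> and \<open>card W\<close> are at most
    \<open>w\<close> and they sum to \<open>2 * w\<close>, so both bounds are attained. Equality of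
    the sums then forces equality in every summand.\<close>
  have "card Z + card W = 2 * w"
    using gam card_Un_disjoint[OF finZW(1,2,4)] finZW(3) unfolding w_def by simp
  moreover have "3 * card Z \<le> 3 * w" using Z_le le3' w3 by linarith
  ultimately have eq: "card Z = w" "card W = w" using W_le by auto
  have one: "card (f v) = 1" if "v \<in> W" for v
    using sum_mono_inv[of "\<lambda>_. 1" W "\<lambda>v. card (f v)" v] that pos finZW eq wW by simp
  have "(\<Sum>u\<in>?V. card (f u) * card (Z \<inter> nbhd G u)) = (\<Sum>u\<in>?V. card (f u) * 3)"
    using Z_le eq w3 le3' by linarith
  then have all3: "card (f u) * card (Z \<inter> nbhd G u) = card (f u) * 3" if "u \<in> ?V" for u
    using sum_mono_inv[of "\<lambda>u. card (f u) * card (Z \<inter> nbhd G u)" ?V "\<lambda>u. card (f u) * 3" u]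
      that fin le3 by blast
  show ?thesis
  proof (rule that[OF f])
    show "card (f v) \<le> 1" if "v \<in> ?V" for v
      using one[of v] that unfolding W_def by (cases "f v = {}") auto
    show "f u = {}" if "v \<in> ?V" "f v \<noteq> {}" "u \<in> nbhd G v" for u v
    proof -
      have "card (f v) = 1" using one that unfolding W_def by auto
      then have "card (Z \<inter> nbhd G v) = card (nbhd G v)" using all3 cub that by fastforce
      then have "Z \<inter> nbhd G v = nbhd G v" using nb by (intro card_subset_eq) auto
      then show ?thesis using that unfolding Z_def by auto
    qed
  qed
qed

text \<open>The first two triples share \<open>b\<close>, so \<open>c\<close> and \<open>e\<close>
  are \<open>a\<close> and \<open>d\<close> in some order. If \<open>c = a\<close>, then
  \<open>e = d\<close>, which the third triple forbids.\<close>

lemma overlapping_rainbow_triples: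
  fixes a b c d e f x y z :: 'a
  assumes "{a, b, d} = {x, y, z}" "{b, c, e} = {x, y, z}" "{d, e, f} = {x, y, z}"
    and "x \<noteq> y" "x \<noteq> z" "y \<noteq> z"
  shows "d = c \<and> a \<noteq> b \<and> a \<noteq> c"
proof -
  have dist: "p \<noteq> q \<and> p \<noteq> r \<and> q \<noteq> r" if "{p, q, r} = {x, y, z}" for p q r
  proof -
    have "card {p, q, r} = 3" unfolding that using assms(4-6) by simp
    then show ?thesis by (auto simp: card_insert_if split: if_splits)
  qed
  have "c \<in> {a, b, d}" "e \<in> {a, b, d}" using assms(1,2) by auto
  then show ?thesis using dist[OF assms(1)] dist[OF assms(2)] dist[OF assms(3)] by auto
qed

lemma fourth_of_three:
  fixes a b c d x y z :: 'a
  assumes "a \<noteq> b" "a \<noteq> c" "b \<noteq> c" "b \<noteq> d" "c \<noteq> d"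
    and "a = x \<or> a = y \<or> a = z" "b = x \<or> b = y \<or> b = z"
    and "c = x \<or> c = y \<or> c = z" "d = x \<or> d = y \<or> d = z"
  shows "d = a"
  using assms by metis

lemma three_singletons:
  fixes A B C :: "nat set"
  assumes un: "A \<union> B \<union> C = {1, 2, 3}"
    and sing: "A = {} \<or> A = {1} \<or> A = {2} \<or> A = {3}" "B = {} \<or> B = {1} \<or> B = {2} \<or> B = {3}"
      "C = {} \<or> C = {1} \<or> C = {2} \<or> C = {3}"
  shows "{A, B, C} = {{1}, {2}, {3}}"
proof (rule sym, rule card_seteq)
  have "{k} \<in> {A, B, C}" if "k \<in> {1, 2, 3}" for k
  proof -
    have "k \<in> A \<or> k \<in> B \<or> k \<in> C" using that un by blast
    then show ?thesis using sing by auto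
  qed
  then show "{{1}, {2}, {3}} \<subseteq> {A, B, C}" by blast
  show "card {A, B, C} \<le> card {{1}, {2}, {3 :: nat}}" by (simp add: card_insert_if)
qed simp

text \<open>A tight dominating function pulled back to the brick wall, without its periodicity; the
  lattice enters afterwards through a repeated colour.\<close>

locale honeycomb_colouring =
  fixes c :: "int \<times> int \<Rightarrow> nat set"
  assumes blank: "\<And>u s. c u \<noteq> {} \<Longrightarrow> c (step s u) = {}"
    and rainbow: "\<And>u. c u = {} \<Longrightarrow>
      {c (step Up u), c (step Down u), c (step Side u)} = {{1}, {2}, {3}}"
begin

lemma coloured_of_blank: "c u = {} \<Longrightarrow> c (step s u) \<noteq> {}"
  using rainbow[of u] by (cases s) auto

lemma coloured_two_steps: "c u \<noteq> {} \<Longrightarrow> c (step t (step s u)) \<noteq> {}"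
  using blank coloured_of_blank by blast

text \<open>Neighbours of coloured points are blank and neighbours of blank points are coloured, so
  being coloured is preserved by every two-step move. Vertical and diagonal two-step moves connect
  all odd points.\<close>

lemma odd_coloured:
  assumes "odd (i + j)" "c (i, j) \<noteq> {}" "odd (i' + j')"
  shows "c (i', j') \<noteq> {}"
proof -
  have vert: "c (a, b + 2 * k) \<noteq> {}" if "odd (a + b)" "c (a, b) \<noteq> {}" for a b k :: int
  proof (induction k rule: int_induct[where k = 0])
    case (step1 k)
    then show ?case using coloured_two_steps[of "(a, b + 2 * k)" Down Up] that
      by (simp add: algebra_simps)
  next
    case (step2 k)
    then show ?case using coloured_two_steps[of "(a, b + 2 * k)" Up Down] that
      by (simp add: algebra_simps)
  qed (use that in simp)
  have diag: "c (i + k, j + k) \<noteq> {}" for k :: int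
  proof (induction k rule: int_induct[where k = 0])
    case (step1 k)
    then show ?case using coloured_two_steps[of "(i + k, j + k)" Down Side] assms
      by (simp add: algebra_simps)
  next
    case (step2 k)
    then show ?case using coloured_two_steps[of "(i + k, j + k)" Side Down] assms
      by (simp add: algebra_simps)
  qed (use assms in simp)
  have "even (j' - j - (i' - i))" using assms(1,3) by auto
  then obtain t where t: "j' - j - (i' - i) = 2 * t" by (rule evenE)
  have "c (i + (i' - i), j + (i' - i) + 2 * t) \<noteq> {}"
    by (rule vert) (use diag[of "i' - i"] assms in \<open>auto\<close>)
  moreover have "(i + (i' - i), j + (i' - i) + 2 * t) = (i', j')" using t by auto
  ultimately show ?thesis by simp
qed

text \<open>Along a column the three colours recur with period six, and moving one column to the right
  shifts the pattern by three; so the colour of \<open>(i, j)\<close> is determined by \<open>j mod 3\<close>.\<close>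

lemma dvd_of_colour_eq:
  assumes "odd (i + j)" "c (i, j) \<noteq> {}" "even (a + b)" "c (i + a, j + b) = c (i, j)"
  shows "3 dvd b"
proof -
  have blank': "c (x, y) = {}" if "even (x + y)" for x y
    using odd_coloured[OF assms(1,2), of x "y - 1"] blank[of "(x, y - 1)" Up] that by simp
  have three: "{c (x, y), c (x, y + 2), c (x - 1, y + 1)} = {{1}, {2}, {3}}" if "odd (x + y)" for x y
    using rainbow[OF blank'[of x "y + 1"]] that by (simp add: algebra_simps)
  \<comment> \<open>The three triples surround the blank points \<open>(x, y + 1)\<close>,
    \<open>(x, y + 3)\<close> and \<open>(x - 1, y + 2)\<close>, which lie around a common
    hexagon.\<close>
  have col: "c (x - 1, y + 1) = c (x, y + 4) \<and> c (x, y) \<noteq> c (x, y + 2) \<and> c (x, y) \<noteq> c (x, y + 4)"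
    if "odd (x + y)" for x y
  proof -
    have "{c (x, y), c (x, y + 2), c (x - 1, y + 1)} = {{1}, {2}, {3}}" using three that by simp
    moreover have "{c (x, y + 2), c (x, y + 4), c (x - 1, y + 3)} = {{1}, {2}, {3}}"
      using three[of x "y + 2"] that by (simp add: ac_simps)
    moreover have "{c (x - 1, y + 1), c (x - 1, y + 3), c (x - 2, y + 2)} = {{1}, {2}, {3}}"
      using three[of "x - 1" "y + 1"] that by (simp add: ac_simps)
    ultimately show ?thesis by (rule overlapping_rainbow_triples) auto
  qed
  have in_three: "c (x, y) = {1} \<or> c (x, y) = {2} \<or> c (x, y) = {3}" if "odd (x + y)" for x y
    using three[OF that] by (metis insertE insertI1 singletonD)
  \<comment> \<open>Heights \<open>y\<close>, \<open>y + 2\<close>, \<open>y + 4\<close> show all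
    three colours, and the colour at \<open>y + 6\<close> differs from the last two.\<close>
  have per: "c (x, y + 6) = c (x, y)" if "odd (x + y)" for x y
    by (rule fourth_of_three[of "c (x, y)" "c (x, y + 2)" "c (x, y + 4)" _ "{1}" "{2}" "{3}"])
      (use col[of x y] col[of x "y + 2"] col[of x "y + 4"] that in_three in \<open>simp_all add: ac_simps\<close>)
  have per': "c (x, y + 6 * k) = c (x, y)" if "odd (x + y)" for x y k
  proof (induction k rule: int_induct[where k = 0])
    case (step1 k)
    then show ?case using per[of x "y + 6 * k"] that by (simp add: algebra_simps)
  next
    case (step2 k)
    then show ?case using per[of x "y + 6 * k - 6"] that by (simp add: algebra_simps)
  qed simp
  have side: "c (x + 1, y + 3) = c (x, y)" if "odd (x + y)" for x y
    using col[of "x + 1" "y - 1"] that by (simp add: ac_simps)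
  have side': "c (x + k, y + 3 * k) = c (x, y)" if "odd (x + y)" for x y k
  proof (induction k rule: int_induct[where k = 0])
    case (step1 k)
    then show ?case using side[of "x + k" "y + 3 * k"] that by (simp add: algebra_simps)
  next
    case (step2 k)
    then show ?case using side[of "x + k - 1" "y + 3 * k - 3"] that by (simp add: algebra_simps)
  qed simp
  \<comment> \<open>The displacement is a (1, 3) + t (0, 2). The first summand preserves colours, so
    the vertical rest \<open>2 * t\<close> must preserve this colour as well, which forces 3 to
    divide \<open>t\<close>.\<close>
  define t where "t = (b - 3 * a) div 2"
  have t: "b = 3 * a + 2 * t" using assms(3) unfolding t_def by presburger
  have "c (i, j + 2 * t) = c (i, j)"
    using side'[of i "j + 2 * t" a] assms t by (simp add: algebra_simps)
  have "c (i, j + 2 * t) = c (i, j + 2 * (t mod 3))"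
  proof -
    have "j + 2 * t = j + 2 * (t mod 3) + 6 * (t div 3)" by presburger
    then show ?thesis using per'[of i "j + 2 * (t mod 3)" "t div 3"] assms(1)
      by (metis even_add even_mult_iff even_numeral)
  qed
  have "t mod 3 = 0"
  proof -
    have "t mod 3 = 0 \<or> t mod 3 = 1 \<or> t mod 3 = 2" by presburger
    moreover have "c (i, j + 2 * (t mod 3)) = c (i, j)"
      using \<open>c (i, j + 2 * t) = c (i, j)\<close> \<open>c (i, j + 2 * t) = c (i, j + 2 * (t mod 3))\<close> by simp
    ultimately show ?thesis using col[OF assms(1)] by auto
  qed
  then show ?thesis unfolding t by presburger
qed

end

context hex_cover
begin

text \<open>The pullback of \<open>f\<close> along the cover is invariant under \<open>L\<close>, so
  the colour at \<open>u\<close> recurs at \<open>u + (a, b)\<close>.\<close>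

lemma three_dvd_lattice_aux:
  assumes f: "is_3RDF G f" "\<And>v. v \<in> verts G \<Longrightarrow> card (f v) \<le> 1"
    "\<And>u v. v \<in> verts G \<Longrightarrow> f v \<noteq> {} \<Longrightarrow> u \<in> nbhd G v \<Longrightarrow> f u = {}"
    and u: "odd_point u" "f (\<phi> u) \<noteq> {}" and L: "(a, b) \<in> L"
  shows "3 dvd b"
proof -
  interpret honeycomb_colouring "\<lambda>u. f (\<phi> u)"
  proof
    show "f (\<phi> (step s u)) = {}" if "f (\<phi> u) \<noteq> {}" for u s
      by (rule f(3)[of "\<phi> u"]) (use that in \<open>auto simp: verts_eq nbhd_eq\<close>)
    show "{f (\<phi> (step Up u)), f (\<phi> (step Down u)), f (\<phi> (step Side u))} = {{1}, {2}, {3}}"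
      if "f (\<phi> u) = {}" for u
    proof -
      have "nbhd G (\<phi> u) = {\<phi> (step Up u), \<phi> (step Down u), \<phi> (step Side u)}"
        unfolding nbhd_eq by (auto, metis direction.exhaust)
      then have un: "f (\<phi> (step Up u)) \<union> f (\<phi> (step Down u)) \<union> f (\<phi> (step Side u)) = {1, 2, 3}"
      proof -
        have "\<phi> u \<in> verts G" using verts_eq by blast
        then have "(\<Union>x\<in>nbhd G (\<phi> u). f x) = {1, 2, 3}" using f(1) that unfolding is_3RDF_def by blast
        then show ?thesis unfolding \<open>nbhd G (\<phi> u) = _\<close> by (simp add: Un_assoc)
      qed
      have "f x = {} \<or> f x = {1} \<or> f x = {2} \<or> f x = {3}" if "x \<in> verts G" for x
      proof -
        have "f x \<subseteq> {1, 2, 3}" using f(1) that unfolding is_3RDF_def by auto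
        moreover have "finite (f x)" by (rule finite_subset[OF calculation]) simp
        ultimately show ?thesis using f(2)[OF that] by (auto simp: card_le_Suc0_iff_eq)
      qed
      then have sing: "f (\<phi> x) = {} \<or> f (\<phi> x) = {1} \<or> f (\<phi> x) = {2} \<or> f (\<phi> x) = {3}" for x
        unfolding verts_eq by blast
      show ?thesis
        by (rule three_singletons[OF un sing sing sing])
    qed
  qed
  obtain i j where ij: "u = (i, j)" by fastforce
  have "\<phi> (i + a, j + b) = \<phi> (i, j)" using L by (simp add: fiber)
  then show ?thesis
    using dvd_of_colour_eq[of i j a b] u even_L[OF L] unfolding ij by simp
qed

lemma three_dvd_lattice:
  assumes "is_3RDR G" "(a, b) \<in> L" shows "3 dvd b"
proof -
  obtain f where f: "is_3RDF G f" "\<And>v. v \<in> verts G \<Longrightarrow> card (f v) \<le> 1"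
    "\<And>u v. v \<in> verts G \<Longrightarrow> f v \<noteq> {} \<Longrightarrow> u \<in> nbhd G v \<Longrightarrow> f u = {}"
    using is_3RDR_tight[OF assms(1)] by metis
  have "\<exists>u. f (\<phi> u) \<noteq> {}"
  proof (rule ccontr)
    assume none: "\<nexists>u. f (\<phi> u) \<noteq> {}"
    then have "(\<Union>x\<in>nbhd G (\<phi> 0). f x) = {}" unfolding nbhd_eq by blast
    moreover have "\<phi> 0 \<in> verts G" "f (\<phi> 0) = {}" using none verts_eq by blast+
    moreover from this have "(\<Union>x\<in>nbhd G (\<phi> 0). f x) = {1, 2, 3}"
      using f(1) unfolding is_3RDF_def by metis
    ultimately show False by simp
  qed
  then obtain u where u: "f (\<phi> u) \<noteq> {}" by blast
  show ?thesis
  proof (cases "odd_point u")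
    case True
    show ?thesis
      by (rule three_dvd_lattice_aux[OF f(1), where u = u]) (use f(2,3) True u assms(2) in blast)+
  next
    case False
    \<comment> \<open>If the coloured class is the even one, the half turn moves it to the odd
      points without changing the lattice.\<close>
    interpret flip: hex_cover G "\<phi> \<circ> (\<lambda>u. (1, 0) - u)" L by (rule hex_cover_flip)
    have "odd_point ((1, 0) - u)" using False by (simp add: odd_point_diff)
    moreover have "f ((\<phi> \<circ> (\<lambda>u. (1, 0) - u)) ((1, 0) - u)) \<noteq> {}" using u by simp
    ultimately show ?thesis
      by (rule flip.three_dvd_lattice_aux[OF f(1), rotated 2]) (use f(2,3) assms(2) in blast)+
  qed
qed

end

subsection \<open>Closed words\<close>

text \<open>The base point \<open>(1, 0)\<close> stands for any odd point, the kind from which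
  directions are named.\<close>

definition offset :: "direction list \<Rightarrow> int \<times> int" where
  "offset w = fold step w (1, 0) - (1, 0)"

lemma odd_point_fold_step: "odd_point (fold step w u) \<longleftrightarrow> odd_point u = even (length w)"
  by (induction w arbitrary: u) auto

lemma odd_point_offset: "odd_point (offset w) \<longleftrightarrow> odd (length w)"
  unfolding offset_def odd_point_diff odd_point_fold_step by simp

lemma fold_step_translate:
  "odd_point u = odd_point v \<Longrightarrow> fold step w u - fold step w v = u - v"
  by (induction w arbitrary: u v) (auto simp: step_diff)

lemma flip_fold_step: "(1, 0) - fold step w u = fold step w ((1, 0) - u)"
  by (induction w arbitrary: u) (auto simp: flip_step)

text \<open>Starts of equal parity differ by a translation, which commutes with \<open>step\<close>.
  An even start is reduced to an odd one by the half turn, which negates displacements.\<close>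

lemma fold_step_diff: "fold step w u - u = (if odd_point u then offset w else - offset w)"
proof (cases "odd_point u")
  case True
  then have "fold step w u - fold step w (1, 0) = u - (1, 0)" by (intro fold_step_translate) simp
  then show ?thesis using True unfolding offset_def by (simp add: algebra_simps)
next
  case False
  then have "odd_point ((1, 0) - u)" by (simp add: odd_point_diff)
  then have "fold step w ((1, 0) - u) - fold step w (1, 0) = ((1, 0) - u) - (1, 0)"
    by (intro fold_step_translate) simp
  then show ?thesis using False unfolding offset_def flip_fold_step[symmetric]
    by (simp add: algebra_simps)
qed

text \<open>The index counts the letters after the first one, so the words have length
  \<open>n + 1\<close>. The lists are computed explicitly by rewriting for cycle lengths up to
  six.\<close>

fun nonbacktracking_words :: "nat \<Rightarrow> direction \<Rightarrow> direction list list" where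
  "nonbacktracking_words 0 s = [[s]]"
| "nonbacktracking_words (Suc n) s =
     concat (map (\<lambda>t. map ((#) s) (nonbacktracking_words n t)) (filter ((\<noteq>) s) [Up, Down, Side]))"

lemma set_nonbacktracking_words:
  "set (nonbacktracking_words n s) = {w. length w = Suc n \<and> w ! 0 = s \<and> distinct_adj w}"
proof (induction n arbitrary: s)
  case 0
  then show ?case by (auto simp: length_Suc_conv)
next
  case (Suc n)
  have "w \<in> set (nonbacktracking_words (Suc n) s) \<longleftrightarrow> length w = Suc (Suc n) \<and> w ! 0 = s \<and> distinct_adj w" for w
  proof (cases w)
    case (Cons a v)
    have "w \<in> set (nonbacktracking_words (Suc n) s) \<longleftrightarrow>
        a = s \<and> (\<exists>t. t \<noteq> s \<and> v \<in> set (nonbacktracking_words n t))"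
    proof -
      have "set (filter ((\<noteq>) s) [Up, Down, Side]) = {t. t \<noteq> s}"
        using direction.exhaust by auto
      then have "set (nonbacktracking_words (Suc n) s) =
          (\<Union>t\<in>{t. t \<noteq> s}. (#) s ` set (nonbacktracking_words n t))"
        by (simp only: nonbacktracking_words.simps set_concat set_map image_image)
      then show ?thesis unfolding Cons by auto
    qed
    also have "\<dots> \<longleftrightarrow> a = s \<and> length v = Suc n \<and> distinct_adj v \<and> v ! 0 \<noteq> s"
      using Suc by auto
    also have "\<dots> \<longleftrightarrow> length w = Suc (Suc n) \<and> w ! 0 = s \<and> distinct_adj w"
      unfolding Cons by (cases v) auto
    finally show ?thesis .
  qed auto
  then show ?case by blast
qed

lemma distinct_nonbacktracking_words: "distinct (nonbacktracking_words n s)"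
proof (induction n arbitrary: s)
  case (Suc n)
  have "set (nonbacktracking_words n t) \<inter> set (nonbacktracking_words n t') = {}" if "t \<noteq> t'" for t t'
    using that unfolding set_nonbacktracking_words by auto
  then show ?case using Suc by (cases s) (auto simp: distinct_map)
qed simp

context hex_cover
begin

text \<open>The right side does not mention \<open>u\<close>; this is why all vertices get the same
  signature.\<close>

lemma closed_iff: "\<phi> (fold step w u) = \<phi> u \<longleftrightarrow> offset w \<in> L"
  unfolding fiber fold_step_diff using neg_in_L_iff by simp

text \<open>For \<open>k\<close> at least three this rules out closed words of length two, so the
  three directions at a vertex lead to different neighbours. It also bounds the girth from below,
  because every cycle lifts to a closed word.\<close>

definition no_closed_word_below :: "nat \<Rightarrow> bool" where
  "no_closed_word_below k \<longleftrightarrow>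
    (\<forall>w. distinct_adj w \<longrightarrow> 0 < length w \<longrightarrow> length w < k \<longrightarrow> offset w \<notin> L)"

lemma step_inj:
  assumes "no_closed_word_below k" "3 \<le> k" "\<phi> (step s u) = \<phi> (step t u)" shows "s = t"
proof (rule ccontr)
  assume "s \<noteq> t"
  then have "offset [s, t] \<notin> L" using assms(1,2) unfolding no_closed_word_below_def by simp
  then show False using closed_iff[of "[s, t]" "step s u"] assms(3) by simp
qed

definition word_vertices :: "direction list \<Rightarrow> int \<times> int \<Rightarrow> 'a list" where
  "word_vertices w u = map (\<lambda>i. \<phi> (fold step (take i w) u)) [0..<length w]"

lemma word_vertices_nth:
  assumes "offset w \<in> L" "i \<le> length w" "0 < length w"
  shows "\<phi> (fold step (take i w) u) = word_vertices w u ! (i mod length w)"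
  using assms closed_iff[of w u] unfolding word_vertices_def by (cases "i = length w") auto

lemma fold_take_Suc: "i < length w \<Longrightarrow> fold step (take (Suc i) w) u = step (w ! i) (fold step (take i w) u)"
  by (simp add: take_Suc_conv_app_nth)

text \<open>A repeated vertex would cut out a nonempty closed subword of length less than
  \<open>k\<close>.\<close>

lemma word_vertices_in_rooted_cycles:
  assumes M: "no_closed_word_below k" and k: "3 \<le> k" "length w = k"
    and w: "distinct_adj w" "offset w \<in> L"
  shows "word_vertices w u \<in> rooted_cycles G k (\<phi> u) (\<phi> (step (w ! 0) u))"
proof -
  let ?x = "\<lambda>i. \<phi> (fold step (take i w) u)"
  have len: "length (word_vertices w u) = k" unfolding word_vertices_def using k by simp
  have nth: "i \<le> k \<Longrightarrow> word_vertices w u ! (i mod k) = ?x i" for i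
    using word_vertices_nth[OF w(2), of i u] k by auto
  have nth': "i < k \<Longrightarrow> word_vertices w u ! i = ?x i" for i using nth[of i] by simp
  have neq: "?x i \<noteq> ?x j" if "i < j" "j < k" for i j
  proof
    assume eq: "?x i = ?x j"
    define v where "v = drop i (take j w)"
    have tj: "take j w = take i w @ v"
      unfolding v_def using that by (metis append_take_drop_id less_imp_le min.absorb1 take_take)
    have "distinct_adj (take j w)" using w(1) append_take_drop_id[of j w]
      by (metis distinct_adj_appendD1)
    then have "distinct_adj v" unfolding tj by (rule distinct_adj_appendD2)
    moreover have "length v = j - i" unfolding v_def using that k by simp
    moreover from this have "0 < length v" "length v < k" using that by linarith+
    ultimately have "offset v \<notin> L" using M unfolding no_closed_word_below_def by blast
    then show False using closed_iff[of v "fold step (take i w) u"] eq unfolding tj by simp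
  qed
  have "distinct (word_vertices w u)"
    unfolding distinct_conv_nth len using nth' neq by (metis linorder_neqE_nat)
  moreover have "set (word_vertices w u) \<subseteq> verts G"
    unfolding word_vertices_def verts_eq by auto
  moreover have "{word_vertices w u ! i, word_vertices w u ! ((i + 1) mod k)} \<in> edges G"
    if "i < k" for i
    using nth[of "i + 1"] nth'[OF that] that fold_take_Suc[of i w u] k edgeI by simp
  ultimately show ?thesis
    unfolding rooted_cycles_def is_cycle_def len using len k nth'[of 0] nth'[of 1]
      fold_take_Suc[of 0 w u] by simp
qed

text \<open>Path lifting, one edge at a time. A repeated letter would return to the vertex two
  places earlier, contrary to distinctness; the first letter is identified by
  \<open>step_inj\<close>.\<close>

lemma rooted_cycle_word:
  assumes M: "no_closed_word_below g" "3 \<le> g"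
    and xs: "xs \<in> rooted_cycles G k (\<phi> u) (\<phi> (step s u))"
  shows "\<exists>w. length w = k \<and> w ! 0 = s \<and> distinct_adj w \<and> offset w \<in> L \<and> word_vertices w u = xs"
proof -
  have c: "is_cycle G xs" and len: "length xs = k" and x01: "xs ! 0 = \<phi> u" "xs ! 1 = \<phi> (step s u)"
    using xs unfolding rooted_cycles_def by auto
  have k: "3 \<le> k" and d: "distinct xs"
    and e: "\<And>i. i < k \<Longrightarrow> {xs ! i, xs ! ((i + 1) mod k)} \<in> edges G"
    using c len unfolding is_cycle_def by auto
  have "n \<le> k \<Longrightarrow> \<exists>w. length w = n \<and> (\<forall>i\<le>n. \<phi> (fold step (take i w) u) = xs ! (i mod k))" for n
  proof (induction n)
    case 0
    then show ?case using x01 by simp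
  next
    case (Suc n)
    then obtain w where w: "length w = n" "\<And>i. i \<le> n \<Longrightarrow> \<phi> (fold step (take i w) u) = xs ! (i mod k)"
      by auto
    have "{\<phi> (fold step w u), xs ! (Suc n mod k)} \<in> edges G"
      using e[of n] w(2)[of n] w(1) Suc by simp
    then obtain t where "xs ! (Suc n mod k) = \<phi> (step t (fold step w u))" using edge_iff by blast
    then have "\<phi> (fold step (take i (w @ [t])) u) = xs ! (i mod k)" if "i \<le> Suc n" for i
      using that w by (cases "i = Suc n") auto
    then show ?case using w(1) by (intro exI[of _ "w @ [t]"]) simp
  qed
  then obtain w where w: "length w = k" "\<And>i. i \<le> k \<Longrightarrow> \<phi> (fold step (take i w) u) = xs ! (i mod k)"
    by blast
  have "distinct_adj w"
    unfolding distinct_adj_conv_nth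
  proof (intro allI impI notI)
    fix i assume "Suc i < length w" and eq: "w ! i = w ! Suc i"
    then have i: "Suc i < k" using w by simp
    have "fold step (take (Suc (Suc i)) w) u = fold step (take i w) u"
      using fold_take_Suc[of "Suc i" w u] fold_take_Suc[of i w u] i w(1) eq by simp
    then have "xs ! (Suc (Suc i) mod k) = xs ! i" using w(2)[of "Suc (Suc i)"] w(2)[of i] i by simp
    then have "Suc (Suc i) mod k = i"
      using d len i nth_eq_iff_index_eq[of xs "Suc (Suc i) mod k" i] nat_mod_less[OF i] by simp
    then show False using i k by (cases "Suc (Suc i) = k") auto
  qed
  moreover have "w ! 0 = s"
    by (rule step_inj[OF M, of _ u]) (use w(2)[of 1] fold_take_Suc[of 0 w u] w(1) k x01 in simp)
  moreover have "offset w \<in> L" using closed_iff[of w u] w(2)[of k] w(1) x01 by simp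
  moreover have "word_vertices w u = xs"
    by (rule nth_equalityI) (use w len in \<open>auto simp: word_vertices_def\<close>)
  ultimately show ?thesis using w(1) by blast
qed

text \<open>Lifting and projecting are mutually inverse: with no shorter closed words, the letters
  can be read off the vertices.\<close>

lemma card_rooted_cycles:
  assumes M: "no_closed_word_below k" and k: "3 \<le> k"
  shows "card (rooted_cycles G k (\<phi> u) (\<phi> (step s u))) =
    length (filter (\<lambda>w. offset w \<in> L) (nonbacktracking_words (k - 1) s))"
proof -
  let ?W = "{w. length w = k \<and> w ! 0 = s \<and> distinct_adj w \<and> offset w \<in> L}"
  have inj: "inj_on (\<lambda>w. word_vertices w u) ?W"
  proof (rule inj_onI)
    fix w v assume w: "w \<in> ?W" and v: "v \<in> ?W" and eq: "word_vertices w u = word_vertices v u"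
    have x: "\<phi> (fold step (take i w) u) = \<phi> (fold step (take i v) u)" if "i \<le> k" for i
      proof -
      have "0 < length w" "0 < length v" using w v k by simp_all
      then show ?thesis
        using word_vertices_nth[of w i u] word_vertices_nth[of v i u] w v eq that by simp
    qed
    have "i \<le> k \<Longrightarrow> take i w = take i v" for i
    proof (induction i)
      case (Suc i)
      then have "\<phi> (step (w ! i) (fold step (take i w) u)) = \<phi> (step (v ! i) (fold step (take i w) u))"
        using x[of "Suc i"] fold_take_Suc[of i w u] fold_take_Suc[of i v u] w v by simp
      then have "w ! i = v ! i" by (rule step_inj[OF M k])
      then show ?case using Suc w v by (simp add: take_Suc_conv_app_nth)
    qed simp
    from this[of k] show "w = v" using w v by simp
  qed
  have "(\<lambda>w. word_vertices w u) ` ?W = rooted_cycles G k (\<phi> u) (\<phi> (step s u))"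
  proof (intro equalityI subsetI)
    fix xs assume "xs \<in> rooted_cycles G k (\<phi> u) (\<phi> (step s u))"
    from rooted_cycle_word[OF M k this] show "xs \<in> (\<lambda>w. word_vertices w u) ` ?W" by blast
  qed (use word_vertices_in_rooted_cycles[OF M k] in blast)
  then have "card (rooted_cycles G k (\<phi> u) (\<phi> (step s u))) = card ?W"
    using card_image[OF inj] by simp
  also have "?W = set (filter (\<lambda>w. offset w \<in> L) (nonbacktracking_words (k - 1) s))"
    using k by (auto simp: set_nonbacktracking_words)
  also have "card \<dots> = length (filter (\<lambda>w. offset w \<in> L) (nonbacktracking_words (k - 1) s))"
    by (rule distinct_card) (simp add: distinct_nonbacktracking_words)
  finally show ?thesis .
qed

lemma girth_eqI:
  assumes M: "no_closed_word_below k" and k: "3 \<le> k"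
    and w: "length w = k" "distinct_adj w" "offset w \<in> L"
  shows "girth G = k"
  unfolding girth_def_list
proof (rule Least_equality)
  show "\<exists>xs. is_cycle G xs \<and> length xs = k"
    using word_vertices_in_rooted_cycles[OF M k w(1) w(2,3), of 0] unfolding rooted_cycles_def by blast
next
  fix n assume "\<exists>xs. is_cycle G xs \<and> length xs = n"
  then obtain xs where xs: "is_cycle G xs" "length xs = n" by blast
  have n: "3 \<le> n" "set xs \<subseteq> verts G" "{xs ! 0, xs ! (1 mod n)} \<in> edges G"
    using xs unfolding is_cycle_def by (auto dest: spec[of _ 0])
  then have "xs ! 0 \<in> verts G" using xs by (metis One_nat_def Suc_le_lessD less_le_trans
        nth_mem numeral_3_eq_3 subsetD zero_less_Suc)
  then obtain u where u: "xs ! 0 = \<phi> u" using verts_eq by auto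
  moreover have "1 mod n = 1" using n by simp
  ultimately obtain s where "xs ! 1 = \<phi> (step s u)" using n(3) edge_iff by metis
  then have "xs \<in> rooted_cycles G n (\<phi> u) (\<phi> (step s u))" using xs u unfolding rooted_cycles_def by simp
  from rooted_cycle_word[OF M k this] obtain w
    where "length w = n" "distinct_adj w" "offset w \<in> L" by blast
  then show "k \<le> n" using M n(1) unfolding no_closed_word_below_def by (metis leI less_le_trans zero_less_numeral)
qed

lemma eps_eq:
  assumes M: "no_closed_word_below k" and k: "3 \<le> k" and g: "girth G = k"
  shows "eps G {\<phi> u, \<phi> (step s u)} =
    length (filter (\<lambda>w. offset w \<in> L) (nonbacktracking_words (k - 1) s))"
  using eps_eq_card_rooted_cycles[of "\<phi> u" "\<phi> (step s u)" G] step_ne[of s u]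
    card_rooted_cycles[OF M k] unfolding g by metis

lemma signature_eqI:
  assumes M: "no_closed_word_below k" and k: "3 \<le> k" and g: "girth G = k"
  shows "has_signature G (sort (map (\<lambda>s. length (filter (\<lambda>w. offset w \<in> L)
    (nonbacktracking_words (k - 1) s))) [Up, Down, Side]))"
  unfolding has_signature_def
proof
  fix v assume "v \<in> verts G"
  then obtain u where u: "v = \<phi> u" using verts_eq by auto
  let ?e = "\<lambda>s. {\<phi> u, \<phi> (step s u)}"
  have inj: "inj ?e" by (intro injI step_inj[OF M k, of _ u]) (metis doubleton_eq_iff)
  have "{e \<in> edges G. v \<in> e} = range ?e"
  proof (intro equalityI subsetI)
    fix e assume "e \<in> {e \<in> edges G. v \<in> e}"
    then have "e \<in> edges G" "\<phi> u \<in> e" using u by auto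
    moreover from this obtain v t where "e = {\<phi> v, \<phi> (step t v)}" unfolding edges_eq by blast
    ultimately obtain x where "e = {\<phi> u, x}" "{\<phi> u, x} \<in> edges G"
      by (metis doubleton_eq_iff insertE singletonD)
    then show "e \<in> range ?e" unfolding edge_iff by blast
  next
    fix e assume "e \<in> range ?e"
    then obtain s where "e = ?e s" by blast
    then show "e \<in> {e \<in> edges G. v \<in> e}" using u edgeI by simp
  qed
  also have "\<dots> = set (map ?e [Up, Down, Side])"
  proof -
    have "UNIV = set [Up, Down, Side]" using direction.exhaust by auto
    then show ?thesis by (simp only: set_map)
  qed
  finally have E: "{e \<in> edges G. v \<in> e} = set (map ?e [Up, Down, Side])" .
  have "mset_set {e \<in> edges G. v \<in> e} = mset (map ?e [Up, Down, Side])"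
  proof -
    have "distinct (map ?e [Up, Down, Side])"
      unfolding distinct_map using inj_on_subset[OF inj subset_UNIV] by simp
    then have "mset_set (set (map ?e [Up, Down, Side])) = mset (map ?e [Up, Down, Side])"
      by (rule mset_set_set)
    then show ?thesis unfolding E .
  qed
  then have "image_mset (eps G) (mset_set {e \<in> edges G. v \<in> e}) = mset (map (eps G \<circ> ?e) [Up, Down, Side])"
    by simp
  then show "vertex_signature G v = sort (map (\<lambda>s. length (filter (\<lambda>w. offset w \<in> L)
    (nonbacktracking_words (k - 1) s))) [Up, Down, Side])"
    unfolding vertex_signature_def using eps_eq[OF M k g, of u]
    by (simp only: sorted_list_of_multiset_mset comp_def)
qed

end

subsection \<open>Lattices\<close>

definition reflect_lattice :: "(int \<times> int) set \<Rightarrow> (int \<times> int) set" where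
  "reflect_lattice L = {(i, j). (i, - j) \<in> L}"

definition turn_lattice :: "(int \<times> int) set \<Rightarrow> (int \<times> int) set" where
  "turn_lattice L = {(i, j). even (i + j) \<and> ((j - i) div 2, (3 * i + j) div 2) \<in> L}"

text \<open>A list with repetitions, since every entry stands for one word and is counted separately
  in \<open>eps\<close>. The divisibility filter leaves four of eight words in length four and eight
  of 32 in length six.\<close>

definition candidate_offsets :: "nat \<Rightarrow> direction \<Rightarrow> (int \<times> int) list" where
  "candidate_offsets n s = filter (\<lambda>v. 3 dvd snd v) (map offset (nonbacktracking_words n s))"

lemma candidate_offsets_1:
  "candidate_offsets 1 Up = []"
  "candidate_offsets 1 Down = []"
  "candidate_offsets 1 Side = []"
  by (simp_all add: candidate_offsets_def offset_def zero_prod_def eval_nat_numeral)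

lemma candidate_offsets_3:
  "candidate_offsets 3 Up = [(-1, 3), (1, 3), (-1, 3), (-2, 0)]"
  "candidate_offsets 3 Down = [(-1, -3), (1, -3), (-2, 0), (-1, -3)]"
  "candidate_offsets 3 Side = [(1, -3), (2, 0), (1, 3), (2, 0)]"
  by (simp_all add: candidate_offsets_def offset_def zero_prod_def eval_nat_numeral)

text \<open>The two zero entries of each list are the two hexagons at an edge. Apart from zero and
  the vectors at distance two, each list has two entries: up to sign, (0, 6) occurs for
  \<open>Up\<close> and \<open>Down\<close>, (3, -3) for \<open>Up\<close> and \<open>Side\<close>,
  (3, 3) for \<open>Down\<close> and \<open>Side\<close>.\<close>

lemma candidate_offsets_5:
  "candidate_offsets 5 Up = [(0, 6), (1, 3), (0, 0), (2, 0), (-3, 3), (-2, 0), (-1, -3), (0, 0)]"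
  "candidate_offsets 5 Down = [(0, -6), (1, -3), (0, 0), (2, 0), (-1, 3), (0, 0), (-2, 0), (-3, -3)]"
  "candidate_offsets 5 Side = [(0, 0), (-1, -3), (1, -3), (3, -3), (-1, 3), (0, 0), (1, 3), (3, 3)]"
  by (simp_all add: candidate_offsets_def offset_def zero_prod_def eval_nat_numeral)

text \<open>The divisibility is the trace of 3-rainbow domination regularity that the classification
  works with; \<open>reflect\<close> and \<open>turn\<close> show that it persists under the
  symmetries.\<close>

locale rainbow_hex_cover = hex_cover +
  assumes three_dvd: "\<And>i j. (i, j) \<in> L \<Longrightarrow> 3 dvd j"
begin

lemma mem_candidate_offsets:
  assumes "distinct_adj w" "length w = Suc n" "offset w \<in> L"
  shows "\<exists>s. offset w \<in> set (candidate_offsets n s)"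
proof -
  have "w \<in> set (nonbacktracking_words n (w ! 0))"
    using assms unfolding set_nonbacktracking_words by simp
  moreover have "3 dvd snd (offset w)" using assms(3) three_dvd[of "fst (offset w)"] by simp
  ultimately show ?thesis unfolding candidate_offsets_def by auto
qed

lemma length_filter_candidate_offsets:
  "length (filter (\<lambda>w. offset w \<in> L) (nonbacktracking_words n s)) =
    length (filter (\<lambda>v. v \<in> L) (candidate_offsets n s))"
proof -
  have "offset w \<in> L \<longleftrightarrow> 3 dvd snd (offset w) \<and> offset w \<in> L" for w
    using three_dvd[of "fst (offset w)" "snd (offset w)"] by auto
  then have "filter (\<lambda>w. offset w \<in> L) ws = filter (\<lambda>w. 3 dvd snd (offset w) \<and> offset w \<in> L) ws" for ws
    by (intro filter_cong) auto
  then show ?thesis unfolding candidate_offsets_def by (simp add: filter_map comp_def)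
qed

text \<open>The quotient is bipartite, so closed words have even length, and length two has no
  candidates.\<close>

lemma no_closed_word_below_4: "no_closed_word_below 4"
  unfolding no_closed_word_below_def
proof (intro allI impI notI)
  fix w :: "direction list" assume w: "distinct_adj w" "0 < length w" "length w < 4" "offset w \<in> L"
  have "even (length w)" using w(4) even_L odd_point_offset by blast
  then have "length w = Suc 1" using w(2,3) by presburger
  from mem_candidate_offsets[OF w(1) this w(4)] obtain s where "offset w \<in> set (candidate_offsets 1 s)" ..
  then show False by (cases s) (simp_all only: candidate_offsets_1, simp_all)
qed

lemma no_closed_word_below_6:
  assumes "(1, 3) \<notin> L" "(1, -3) \<notin> L" "(2, 0) \<notin> L"
  shows "no_closed_word_below 6"
  unfolding no_closed_word_below_def
proof (intro allI impI notI)
  fix w :: "direction list" assume w: "distinct_adj w" "0 < length w" "length w < 6" "offset w \<in> L"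
  have "even (length w)" using w(4) even_L odd_point_offset by blast
  moreover have "\<not> length w < 4"
    using no_closed_word_below_4 w unfolding no_closed_word_below_def by blast
  ultimately have "length w = Suc 3" using w(3) by presburger
  from mem_candidate_offsets[OF w(1) this w(4)] obtain s where "offset w \<in> set (candidate_offsets 3 s)" ..
  then have "offset w \<in> {(1, 3), (1, -3), (2, 0), (-1, 3), (-1, -3), (-2, 0)}"
    by (cases s) (simp_all only: candidate_offsets_3, auto)
  then show False using w(4) assms neg_in_L_iff[of "offset w"] by auto
qed

lemma girth_4: "(1, -3) \<in> L \<Longrightarrow> girth G = 4"
  by (rule girth_eqI[OF no_closed_word_below_4, of "[Side, Up, Down, Up]"]) (simp_all add: offset_def)

lemma signature_4:
  assumes "girth G = 4"
  shows "has_signature G (sort (map (\<lambda>s. length (filter (\<lambda>v. v \<in> L) (candidate_offsets 3 s)))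
    [Up, Down, Side]))"
  using signature_eqI[OF no_closed_word_below_4 _ assms] length_filter_candidate_offsets[of 3] by simp

text \<open>The offset (-1, 3) occurs twice for \<open>Up\<close> and up to sign once for each other
  direction: the \<open>Up\<close> edges are the rungs, each in two squares.\<close>

lemma signature_ladder:
  assumes "(1, -3) \<in> L" "(1, 3) \<notin> L" "(2, 0) \<notin> L"
  shows "has_signature G [1, 1, 2]"
proof -
  have neg: "(-1, -3) \<notin> L" "(-1, 3) \<in> L" "(-2, 0) \<notin> L"
    using assms neg_in_L_iff[of "(1, 3)"] neg_in_L_iff[of "(1, -3)"] neg_in_L_iff[of "(2, 0)"] by simp_all
  show ?thesis
    using signature_4[OF girth_4[OF assms(1)], unfolded list.map candidate_offsets_3] assms neg
    by (simp add: eval_nat_numeral)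
qed

text \<open>With all three short vectors the squares of all three kinds close up. This happens for
  \<open>HTG 1 6 3\<close>, which is the complete bipartite graph K_{3,3}, whose edges lie in four
  4-cycles each.\<close>

lemma signature_K33:
  assumes "(1, -3) \<in> L" "(1, 3) \<in> L" "(2, 0) \<in> L"
  shows "has_signature G [4, 4, 4]"
proof -
  have neg: "(-1, -3) \<in> L" "(-1, 3) \<in> L" "(-2, 0) \<in> L"
    using assms neg_in_L_iff[of "(1, 3)"] neg_in_L_iff[of "(1, -3)"] neg_in_L_iff[of "(2, 0)"] by simp_all
  show ?thesis
    using signature_4[OF girth_4[OF assms(1)], unfolded list.map candidate_offsets_3] assms neg
    by (simp add: eval_nat_numeral)
qed

lemma girth_6:
  assumes "(1, 3) \<notin> L" "(1, -3) \<notin> L" "(2, 0) \<notin> L"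
  shows "girth G = 6"
  by (rule girth_eqI[OF no_closed_word_below_6[OF assms], of "[Up, Down, Side, Up, Down, Side]"])
    (simp_all add: offset_def zero_in_L)

text \<open>Each edge starts with two hexagons, and each of the three vectors, if present, adds one
  six-cycle to the edges of two classes.\<close>

lemma signature_6:
  assumes "(1, 3) \<notin> L" "(1, -3) \<notin> L" "(2, 0) \<notin> L"
  shows "(0, 6) \<notin> L \<Longrightarrow> (3, 3) \<notin> L \<Longrightarrow> (3, -3) \<notin> L \<Longrightarrow> has_signature G [2, 2, 2]"
    and "(0, 6) \<in> L \<Longrightarrow> (3, 3) \<notin> L \<Longrightarrow> (3, -3) \<notin> L \<Longrightarrow> has_signature G [2, 3, 3]"
    and "(0, 6) \<in> L \<Longrightarrow> (3, 3) \<in> L \<Longrightarrow> (3, -3) \<in> L \<Longrightarrow> has_signature G [4, 4, 4]"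
proof -
  have neg: "(-1, -3) \<notin> L" "(-1, 3) \<notin> L" "(-2, 0) \<notin> L"
    "(0, -6) \<in> L \<longleftrightarrow> (0, 6) \<in> L" "(-3, -3) \<in> L \<longleftrightarrow> (3, 3) \<in> L" "(-3, 3) \<in> L \<longleftrightarrow> (3, -3) \<in> L"
    using assms neg_in_L_iff[of "(1, 3)"] neg_in_L_iff[of "(1, -3)"] neg_in_L_iff[of "(2, 0)"]
      neg_in_L_iff[of "(0, 6)"] neg_in_L_iff[of "(3, 3)"] neg_in_L_iff[of "(3, -3)"] by simp_all
  have "has_signature G (sort (map (\<lambda>s. length (filter (\<lambda>v. v \<in> L) (candidate_offsets 5 s)))
      [Up, Down, Side]))"
    using signature_eqI[OF no_closed_word_below_6[OF assms] _ girth_6[OF assms]]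
      length_filter_candidate_offsets[of 5] by simp
  note sig = this[unfolded list.map candidate_offsets_5]
  show "has_signature G [2, 2, 2]" if "(0, 6) \<notin> L" "(3, 3) \<notin> L" "(3, -3) \<notin> L"
    using sig assms neg that zero_in_L(2) by (simp add: eval_nat_numeral)
  show "has_signature G [2, 3, 3]" if "(0, 6) \<in> L" "(3, 3) \<notin> L" "(3, -3) \<notin> L"
    using sig assms neg that zero_in_L(2) by (simp add: eval_nat_numeral)
  show "has_signature G [4, 4, 4]" if "(0, 6) \<in> L" "(3, 3) \<in> L" "(3, -3) \<in> L"
    using sig assms neg that zero_in_L(2) by (simp add: eval_nat_numeral)
qed

lemma reflect: "rainbow_hex_cover G (\<phi> \<circ> (\<lambda>(i, j). (i, - j))) (reflect_lattice L)"
  unfolding rainbow_hex_cover_def rainbow_hex_cover_axioms_def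
  using hex_cover_reflect three_dvd unfolding reflect_lattice_def by fastforce

lemma turn: "rainbow_hex_cover G (\<phi> \<circ> (\<lambda>(i, j). ((j - i) div 2, (3 * i + j + 1) div 2))) (turn_lattice L)"
  unfolding rainbow_hex_cover_def rainbow_hex_cover_axioms_def
proof (intro conjI allI impI)
  fix i j assume "(i, j) \<in> turn_lattice L"
  then have "even (i + j)" "3 dvd (3 * i + j) div 2" unfolding turn_lattice_def using three_dvd by auto
  then show "3 dvd j" by presburger
qed (use hex_cover_turn in \<open>simp add: turn_lattice_def\<close>)

end

section \<open>Normal forms of lattices with a short vector\<close>

lemma int_subgroup_generator:
  fixes S :: "int set"
  assumes "\<And>x y. x \<in> S \<Longrightarrow> y \<in> S \<Longrightarrow> x - y \<in> S" "\<exists>x>0. x \<in> S"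
  shows "\<exists>d>0. \<forall>x. x \<in> S \<longleftrightarrow> int d dvd x"
proof -
  have "\<exists>n. 0 < n \<and> int n \<in> S" using assms(2) by (metis zero_less_imp_eq_int)
  then obtain d where d: "0 < d" "int d \<in> S" and least: "\<And>n. n < d \<Longrightarrow> \<not> (0 < n \<and> int n \<in> S)"
    using exists_least_iff[of "\<lambda>n. 0 < n \<and> int n \<in> S"] by blast
  have zero: "0 \<in> S" using assms(1)[OF d(2) d(2)] by simp
  have neg: "- x \<in> S" if "x \<in> S" for x using assms(1)[OF zero that] by simp
  have nat: "int k * int d \<in> S" for k
  proof (induction k)
    case (Suc k)
    then show ?case using assms(1)[OF Suc neg[OF d(2)]] by (simp add: algebra_simps)
  qed (simp add: zero)
  have mult: "k * int d \<in> S" for k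
    using nat neg[OF nat] by (cases k rule: int_cases2) simp_all
  have "x \<in> S \<longleftrightarrow> int d dvd x" for x
  proof
    assume x: "x \<in> S"
    have "x - (x div int d) * int d \<in> S" by (rule assms(1)[OF x mult])
    then have "x mod int d \<in> S" by (simp add: minus_div_mult_eq_mod)
    moreover have "0 \<le> x mod int d" "x mod int d < int d" using d(1) by simp_all
    ultimately have "x mod int d = 0"
      using least[of "nat (x mod int d)"] by (cases "x mod int d = 0") (auto simp: nat_less_iff)
    then show "int d dvd x" by auto
  next
    assume "int d dvd x"
    then show "x \<in> S" using mult by (metis dvd_div_mult_self)
  qed
  then show ?thesis using d(1) by blast
qed

text \<open>Once (0, 6) is in the lattice, the second coordinate matters only modulo six, where
  parity and divisibility by three determine it. The single parameter left is the horizontal period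
  \<open>s\<close>.\<close>

definition column_lattice :: "nat \<Rightarrow> (int \<times> int) set" where
  "column_lattice s = {(i, j). even (i + j) \<and> int s dvd i \<and> 3 dvd j}"

context rainbow_hex_cover
begin

text \<open>Adding multiples of (1, -3) moves every lattice vector into column 0. The generator of
  the vertical part is even and divisible by three, hence the form \<open>2 * s\<close> with 3
  dividing \<open>s\<close>.\<close>

lemma lattice_of_norm_2:
  assumes "(1, -3) \<in> L"
  shows "\<exists>s>0. s mod 3 = 0 \<and> L = HTG_lattice 1 (2 * s) 3"
proof -
  obtain d where d: "0 < d" "\<And>j. (0, j) \<in> L \<longleftrightarrow> int d dvd j"
    using int_subgroup_generator[of "{j. (0, j) \<in> L}"] exists_vertical diff_in_L by force
  have "(0, int d) \<in> L" using d(2) by simp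
  then have "even (int d)" "3 dvd int d" using even_L three_dvd by fastforce+
  then have "even d" "3 dvd d" by presburger+
  then have s: "d = 2 * (d div 2)" "(d div 2) mod 3 = 0" by presburger+
  have "(i, j) \<in> L \<longleftrightarrow> (0, j + 3 * i) \<in> L" for i j
    using add_in_L[OF _ mult_in_L[OF assms, of i], of "(0, j + 3 * i)"]
      diff_in_L[OF _ mult_in_L[OF assms, of i], of "(i, j)"] by (auto simp: algebra_simps)
  then have "L = HTG_lattice 1 (2 * (d div 2)) 3"
    unfolding HTG_lattice_def using d(2) s(1) by auto
  moreover have "0 < d div 2" using s(1) d(1) by linarith
  ultimately show ?thesis using s(2) by (intro exI[of _ "d div 2"]) simp
qed

text \<open>Two lattice vectors in the same column differ by a multiple of both 2 and 3, that is of
  (0, 6).\<close>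

lemma lattice_of_norm_3:
  assumes "(0, 6) \<in> L"
  shows "\<exists>s>0. L = column_lattice s"
proof -
  obtain s where s: "0 < s" "\<And>i. (\<exists>j. (i, j) \<in> L) \<longleftrightarrow> int s dvd i"
    using int_subgroup_generator[of "{i. \<exists>j. (i, j) \<in> L}"] exists_horizontal diff_in_L by force
  have "(i, j) \<in> L \<longleftrightarrow> even (i + j) \<and> int s dvd i \<and> 3 dvd j" for i j
  proof
    assume "(i, j) \<in> L"
    then show "even (i + j) \<and> int s dvd i \<and> 3 dvd j" using even_L three_dvd s(2) by fastforce
  next
    assume ij: "even (i + j) \<and> int s dvd i \<and> 3 dvd j"
    then obtain j' where j': "(i, j') \<in> L" using s(2) by blast
    then have "even (i + j')" "3 dvd j'" using even_L three_dvd by fastforce+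
    moreover have "even (i + j)" "3 dvd j" using ij by simp_all
    ultimately have "j - j' = (j - j') div 6 * 6" by presburger
    then have "(0, j - j') \<in> L" using mult_in_L[OF assms, of "(j - j') div 6"] by simp
    then show "(i, j) \<in> L" using add_in_L[OF j'] by fastforce
  qed
  then show ?thesis unfolding column_lattice_def using s(1) by auto
qed

lemma normalise_norm_2:
  assumes "(1, 3) \<in> L \<or> (1, -3) \<in> L \<or> (2, 0) \<in> L"
  shows "\<exists>\<psi> L'. rainbow_hex_cover G \<psi> L' \<and> (1, -3) \<in> L'"
proof -
  have "(1, 3) \<in> L \<Longrightarrow> (1, -3) \<in> reflect_lattice L" unfolding reflect_lattice_def by simp
  moreover have "(2, 0) \<in> L \<Longrightarrow> (1, -3) \<in> turn_lattice L"
    unfolding turn_lattice_def using neg_in_L_iff[of "(2, 0)"] by simp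
  ultimately show ?thesis using assms reflect turn rainbow_hex_cover_axioms by blast
qed

text \<open>The turn exchanges (3, 3) with (0, 6), and a preceding reflection brings (3, -3) to (3,
  3).\<close>

lemma normalise_norm_3:
  assumes "(0, 6) \<in> L \<or> (3, 3) \<in> L \<or> (3, -3) \<in> L"
  shows "\<exists>\<psi> L'. rainbow_hex_cover G \<psi> L' \<and> (0, 6) \<in> L'"
proof -
  interpret R: rainbow_hex_cover G "\<phi> \<circ> (\<lambda>(i, j). (i, - j))" "reflect_lattice L" by (rule reflect)
  have "(3, 3) \<in> L \<Longrightarrow> (0, 6) \<in> turn_lattice L" unfolding turn_lattice_def by simp
  moreover have "(3, -3) \<in> L \<Longrightarrow> (0, 6) \<in> turn_lattice (reflect_lattice L)"
    unfolding turn_lattice_def reflect_lattice_def by simp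
  ultimately show ?thesis using assms turn R.turn rainbow_hex_cover_axioms by blast
qed

end

text \<open>The generator (s, -l) must have even coordinate sum and 3 dividing \<open>l\<close>;
  modulo six this leaves 0 for even \<open>s\<close> and 3 for odd \<open>s\<close>.\<close>

lemma HTG_lattice_column:
  assumes "0 < s" shows "HTG_lattice s 6 (if even s then 0 else 3) = column_lattice s"
proof -
  have "(int s dvd i \<and> int 6 dvd j + int (if even s then 0 else 3) * (i div int s)) \<longleftrightarrow>
      even (i + j) \<and> int s dvd i \<and> 3 dvd j" for i j
  proof (cases "int s dvd i")
    case True
    then obtain k where k: "i = int s * k" by auto
    then have "i div int s = k" using assms by simp
    moreover have "6 dvd j + 3 * k \<longleftrightarrow> even (k + j) \<and> 3 dvd j" by presburger
    moreover have "6 dvd j \<longleftrightarrow> even j \<and> 3 dvd j" by presburger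
    ultimately show ?thesis unfolding k by (auto simp: even_mult_iff)
  qed auto
  then show ?thesis unfolding HTG_lattice_def column_lattice_def by auto
qed

section \<open>Isomorphisms between honeycomb toroidal graphs from equal lattices\<close>

lemma HTG_lattice_1: "HTG_lattice 1 n l = {(i, j). int n dvd j + int l * i}"
  unfolding HTG_lattice_def by auto

lemma HTG_iso_turn:
  assumes "1 \<le> m" "1 \<le> n" "even n" "l mod 2 = m mod 2"
    and "1 \<le> m'" "1 \<le> n'" "even n'" "l' mod 2 = m' mod 2"
    and "turn_lattice (HTG_lattice m n l) = HTG_lattice m' n' l'"
  shows "HTG m n l \<cong>\<^sub>G HTG m' n' l'"
proof -
  interpret hex_cover "HTG m n l" "HTG_map m n l" "HTG_lattice m n l"
    by (rule hex_cover_HTG) fact+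
  show ?thesis
    using hex_cover_iso[OF hex_cover_turn[folded turn_lattice_def, unfolded assms(9)] hex_cover_HTG] assms by blast
qed

lemma HTG_iso_turn_reflect:
  assumes "1 \<le> m" "1 \<le> n" "even n" "l mod 2 = m mod 2"
    and "1 \<le> m'" "1 \<le> n'" "even n'" "l' mod 2 = m' mod 2"
    and "reflect_lattice (turn_lattice (HTG_lattice m n l)) = HTG_lattice m' n' l'"
  shows "HTG m n l \<cong>\<^sub>G HTG m' n' l'"
proof -
  interpret H: hex_cover "HTG m n l" "HTG_map m n l" "HTG_lattice m n l"
    by (rule hex_cover_HTG) fact+
  interpret T: hex_cover "HTG m n l" "HTG_map m n l \<circ> (\<lambda>(i, j). ((j - i) div 2, (3 * i + j + 1) div 2))"
    "turn_lattice (HTG_lattice m n l)"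
    using H.hex_cover_turn by (simp add: turn_lattice_def)
  show ?thesis
    using hex_cover_iso[OF T.hex_cover_reflect[folded reflect_lattice_def, unfolded assms(9)] hex_cover_HTG]
      assms by blast
qed

text \<open>The turn takes (1, -3) to (-2, 0), so the rails of the ladder become vertical: two
  columns of length \<open>s\<close> when \<open>s\<close> is even, one column of length
  \<open>2 * s\<close> when \<open>s\<close> is odd.\<close>

lemma turn_lattice_1_3:
  "turn_lattice (HTG_lattice 1 (2 * s) 3) = {(i, j). even (i + j) \<and> int s dvd j}"
proof -
  have "int (2 * s) dvd (3 * i + j) div 2 + 3 * ((j - i) div 2) \<longleftrightarrow> int s dvd j"
    if "even (i + j)" for i j
  proof -
    have "(3 * i + j) div 2 + 3 * ((j - i) div 2) = 2 * j" using that by presburger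
    then show ?thesis by simp
  qed
  then show ?thesis unfolding turn_lattice_def HTG_lattice_1 by auto
qed

lemma HTG_1_3_iso_even:
  assumes "0 < s" "even s" shows "HTG 1 (2 * s) 3 \<cong>\<^sub>G HTG 2 s 0"
proof (rule HTG_iso_turn)
  have "even (i + j) \<and> int s dvd j \<longleftrightarrow> 2 dvd i \<and> int s dvd j" for i j
    using assms(2) by (metis dvd_trans even_add even_of_nat)
  then show "turn_lattice (HTG_lattice 1 (2 * s) 3) = HTG_lattice 2 s 0"
    unfolding turn_lattice_1_3 unfolding HTG_lattice_def by auto
qed (use assms in auto)

lemma HTG_1_3_iso_odd:
  assumes "odd s" shows "HTG 1 (2 * s) 3 \<cong>\<^sub>G HTG 1 (2 * s) s"
proof (rule HTG_iso_turn)
  have "even (i + j) \<and> int s dvd j \<longleftrightarrow> int (2 * s) dvd j + int s * i" for i j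
  proof (cases "int s dvd j")
    case True
    then obtain k where k: "j = int s * k" by auto
    have "j + int s * i = int s * (k + i)" unfolding k by (simp add: algebra_simps)
    moreover have "int (2 * s) = int s * 2" by simp
    moreover have "int s \<noteq> 0" using assms by (cases s) auto
    ultimately have "int (2 * s) dvd j + int s * i \<longleftrightarrow> even (k + i)"
      by (metis dvd_times_left_cancel_iff)
    then show ?thesis using k assms by auto
  next
    case False
    then have "\<not> int (2 * s) dvd j + int s * i"
      by (metis dvd_add_left_iff dvd_mult_right dvd_triv_left dvd_trans of_nat_mult)
    then show ?thesis using False by blast
  qed
  then show "turn_lattice (HTG_lattice 1 (2 * s) 3) = HTG_lattice 1 (2 * s) s"
    unfolding turn_lattice_1_3 unfolding HTG_lattice_1 by auto
qed (use assms in \<open>auto simp: odd_iff_mod_2_eq_one elim: oddE\<close>)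

text \<open>Here \<open>k\<close> is the first coordinate before the turn. The second one is 2 i +
  k, congruent to -(i - k) modulo three.\<close>

lemma turn_column_lattice:
  "turn_lattice (column_lattice s) = {(i, j). \<exists>k. j = i + 2 * k \<and> int s dvd k \<and> 3 dvd i - k}"
proof -
  have "even (i + j) \<and> (even ((j - i) div 2 + (3 * i + j) div 2) \<and> int s dvd (j - i) div 2 \<and>
      3 dvd (3 * i + j) div 2) \<longleftrightarrow> (\<exists>k. j = i + 2 * k \<and> int s dvd k \<and> 3 dvd i - k)"
    (is "?A \<longleftrightarrow> ?B") for i j
  proof
    assume A: ?A
    then have "even (i + j)" "3 dvd (3 * i + j) div 2" by simp_all
    then have "j = i + 2 * ((j - i) div 2)" "3 dvd i - (j - i) div 2" by presburger+
    then show ?B using A by blast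
  next
    assume ?B
    then obtain k where k: "j = i + 2 * k" "int s dvd k" "3 dvd i - k" by blast
    then have "(j - i) div 2 = k" "(3 * i + j) div 2 = 2 * i + k" by auto
    moreover have "3 dvd 2 * i + k" using k(3) by presburger
    ultimately show ?A using k by auto
  qed
  then show ?thesis unfolding turn_lattice_def column_lattice_def by auto
qed

lemma six_dvd_iff:
  assumes "0 < s"
  shows "int (6 * s) dvd 2 * int s * i + 2 * k \<longleftrightarrow> (\<exists>t. k = int s * t \<and> 3 dvd i + t)"
proof
  assume "int (6 * s) dvd 2 * int s * i + 2 * k"
  then obtain q where "2 * int s * i + 2 * k = int (6 * s) * q" by auto
  then have "k = int s * (3 * q - i)" by (simp add: algebra_simps)
  then show "\<exists>t. k = int s * t \<and> 3 dvd i + t" by (intro exI[of _ "3 * q - i"]) simp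
next
  assume "\<exists>t. k = int s * t \<and> 3 dvd i + t"
  then obtain t where "k = int s * t" "3 dvd i + t" by blast
  moreover from this(2) obtain q where "i + t = 3 * q" by (rule dvdE)
  moreover have "2 * int s * i + 2 * (int s * t) = 2 * int s * (i + t)" by (simp add: algebra_simps)
  ultimately have "2 * int s * i + 2 * k = 2 * int s * (3 * q)" by simp
  then show "int (6 * s) dvd 2 * int s * i + 2 * k" by simp
qed

lemma column_parity: "(if even s then 0 else 3) mod 2 = s mod 2" for s :: nat
  by (simp add: odd_iff_mod_2_eq_one)

text \<open>With j = i + 2 k the one-column lattice asks for k = s t and 3 dividing i + t, the
  column lattice for 3 dividing i - s t. These agree because \<open>s\<close> is -1 modulo
  three.\<close>

lemma HTG_column_iso_minus:
  assumes "s mod 3 = 2"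
  shows "HTG s 6 (if even s then 0 else 3) \<cong>\<^sub>G HTG 1 (6 * s) (2 * s - 1)"
proof (rule HTG_iso_turn)
  have s: "0 < s" using assms by (cases s) auto
  have "(\<exists>k. j = i + 2 * k \<and> int s dvd k \<and> 3 dvd i - k) \<longleftrightarrow> int (6 * s) dvd j + int (2 * s - 1) * i" for i j
  proof (cases "even (i + j)")
    case True
    then obtain k where k: "j = i + 2 * k" by (metis even_diff evenE diff_add_cancel add.commute even_add)
    have "j + int (2 * s - 1) * i = 2 * int s * i + 2 * k" using s unfolding k by (simp add: of_nat_diff algebra_simps)
    then have "int (6 * s) dvd j + int (2 * s - 1) * i \<longleftrightarrow> (\<exists>t. k = int s * t \<and> 3 dvd i + t)"
      using six_dvd_iff[OF s] by simp
    moreover have "3 dvd i + t \<longleftrightarrow> 3 dvd i - int s * t" for t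
    proof -
      obtain q where "s = 3 * q + 2" using assms by (metis div_mult_mod_eq mult.commute)
      then have "i - int s * t = i + t - 3 * (int q * t + t)" by (simp add: algebra_simps)
      then show ?thesis by (metis dvd_diff_commute dvd_triv_left dvd_diff_right_iff dvd_diff_left_iff)
    qed
    moreover have "(\<exists>k'. j = i + 2 * k' \<and> int s dvd k' \<and> 3 dvd i - k') \<longleftrightarrow> int s dvd k \<and> 3 dvd i - k"
      using k by auto
    moreover have "(\<exists>t. k = int s * t \<and> 3 dvd i - int s * t) \<longleftrightarrow> int s dvd k \<and> 3 dvd i - k"
      by (auto simp: dvd_def)
    ultimately show ?thesis by simp
  next
    case False
    moreover have "odd (int (2 * s - 1))" using s by simp
    ultimately have "odd (j + int (2 * s - 1) * i)" by simp
    then have "\<not> int (6 * s) dvd j + int (2 * s - 1) * i" by (metis dvd_trans dvd_mult2 even_numeral even_of_nat of_nat_numeral)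
    then show ?thesis using False by auto
  qed
  then show "turn_lattice (HTG_lattice s 6 (if even s then 0 else 3)) = HTG_lattice 1 (6 * s) (2 * s - 1)"
    unfolding HTG_lattice_column[OF s] turn_column_lattice HTG_lattice_1 by auto
  show "1 \<le> s" "1 \<le> 6 * s" "(2 * s - 1) mod 2 = 1 mod 2" using s by (cases s; simp)+
qed (simp_all add: column_parity)

text \<open>For \<open>s\<close> congruent to 1 modulo three the sign of \<open>t\<close> is wrong;
  the extra reflection reverses \<open>j\<close> and turns the condition into 3 dividing i -
  t.\<close>

lemma HTG_column_iso_plus:
  assumes "s mod 3 = 1"
  shows "HTG s 6 (if even s then 0 else 3) \<cong>\<^sub>G HTG 1 (6 * s) (2 * s + 1)"
proof (rule HTG_iso_turn_reflect)
  have s: "0 < s" using assms by (cases s) auto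
  have "(\<exists>k. - j = i + 2 * k \<and> int s dvd k \<and> 3 dvd i - k) \<longleftrightarrow> int (6 * s) dvd j + int (2 * s + 1) * i" for i j
  proof (cases "even (i + j)")
    case True
    then obtain k where k: "- j = i + 2 * k" by (metis even_diff evenE diff_add_cancel add.commute even_add even_minus)
    then have j: "j = - i - 2 * k" by simp
    have "j + int (2 * s + 1) * i = 2 * int s * i + 2 * (- k)" unfolding j by (simp add: algebra_simps)
    then have "int (6 * s) dvd j + int (2 * s + 1) * i \<longleftrightarrow> (\<exists>t. - k = int s * t \<and> 3 dvd i + t)"
      using six_dvd_iff[OF s] by metis
    also have "\<dots> \<longleftrightarrow> (\<exists>t. k = int s * t \<and> 3 dvd i - t)"
      by (metis add.inverse_inverse diff_minus_eq_add mult_minus_right uminus_add_conv_diff add.commute)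
    finally have "int (6 * s) dvd j + int (2 * s + 1) * i \<longleftrightarrow> (\<exists>t. k = int s * t \<and> 3 dvd i - t)" .
    moreover have "3 dvd i - t \<longleftrightarrow> 3 dvd i - int s * t" for t
    proof -
      obtain q where "s = 3 * q + 1" using assms by (metis div_mult_mod_eq mult.commute)
      then have "i - int s * t = i - t - 3 * (int q * t)" by (simp add: algebra_simps)
      then show ?thesis by (metis dvd_diff_commute dvd_triv_left dvd_diff_right_iff dvd_diff_left_iff)
    qed
    moreover have "(\<exists>k'. - j = i + 2 * k' \<and> int s dvd k' \<and> 3 dvd i - k') \<longleftrightarrow> int s dvd k \<and> 3 dvd i - k"
      using k by auto
    moreover have "(\<exists>t. k = int s * t \<and> 3 dvd i - int s * t) \<longleftrightarrow> int s dvd k \<and> 3 dvd i - k"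
      by (auto simp: dvd_def)
    ultimately show ?thesis by simp
  next
    case False
    then have "odd (j + int (2 * s + 1) * i)" by simp
    then have "\<not> int (6 * s) dvd j + int (2 * s + 1) * i" by (metis dvd_trans dvd_mult2 even_numeral even_of_nat of_nat_numeral)
    moreover have "\<not> (\<exists>k. - j = i + 2 * k)" using False by presburger
    ultimately show ?thesis by blast
  qed
  then show "reflect_lattice (turn_lattice (HTG_lattice s 6 (if even s then 0 else 3))) = HTG_lattice 1 (6 * s) (2 * s + 1)"
    unfolding HTG_lattice_column[OF s] turn_column_lattice HTG_lattice_1 reflect_lattice_def by auto
  show "1 \<le> s" "1 \<le> 6 * s" "(2 * s + 1) mod 2 = 1 mod 2" using s by simp_all
qed (simp_all add: column_parity)

subsection \<open>Ladders and generalized Petersen graphs\<close>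

lemma Prism_eq_GP: "Prism s = GP s 1"
  unfolding Prism_def GP_def by auto

lemma HTG_vertical: "i < m \<Longrightarrow> j < n \<Longrightarrow> {(i, j), (i, (j + 1) mod n)} \<in> edges (HTG m n l)"
  unfolding HTG_def snd_conv by blast

lemma HTG_horizontal:
  "i + 1 < m \<Longrightarrow> j < n \<Longrightarrow> (i + 1) mod 2 = j mod 2 \<Longrightarrow> {(i, j), (i + 1, j)} \<in> edges (HTG m n l)"
  unfolding HTG_def snd_conv by blast

lemma HTG_jump:
  "j < n \<Longrightarrow> j mod 2 = m mod 2 \<Longrightarrow> {(m - 1, j), (0, (j + l) mod n)} \<in> edges (HTG m n l)"
  unfolding HTG_def snd_conv by blast

lemma HTG_edge_cases:
  assumes "e \<in> edges (HTG m n l)"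
  obtains (vertical) i j where "i < m" "j < n" "e = {(i, j), (i, (j + 1) mod n)}"
    | (horizontal) i j where "i + 1 < m" "j < n" "(i + 1) mod 2 = j mod 2" "e = {(i, j), (i + 1, j)}"
    | (jump) j where "j < n" "j mod 2 = m mod 2" "e = {(m - 1, j), (0, (j + l) mod n)}"
  using assms unfolding HTG_def snd_conv by blast

lemma verts_HTG: "verts (HTG m n l) = {..<m} \<times> {..<n}"
  unfolding HTG_def by auto

lemma GP_outer: "i < n \<Longrightarrow> {Inl i, Inl ((i + 1) mod n)} \<in> edges (GP n k)"
  unfolding GP_def snd_conv by blast

lemma GP_spoke: "i < n \<Longrightarrow> {Inl i, Inr i} \<in> edges (GP n k)"
  unfolding GP_def snd_conv by blast

lemma GP_inner: "i < n \<Longrightarrow> {Inr i, Inr ((i + k) mod n)} \<in> edges (GP n k)"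
  unfolding GP_def snd_conv by blast

lemma GP_edge_cases:
  assumes "e \<in> edges (GP n k)"
  obtains (outer) i where "i < n" "e = {Inl i, Inl ((i + 1) mod n)}"
    | (spoke) i where "i < n" "e = {Inl i, Inr i}"
    | (inner) i where "i < n" "e = {Inr i, Inr ((i + k) mod n)}"
  using assms unfolding GP_def snd_conv by blast

lemma verts_GP: "verts (GP n k) = Inl ` {..<n} \<union> Inr ` {..<n}"
  unfolding GP_def Plus_def by auto

text \<open>The horizontal edges supply the rungs at odd heights and the jumps, with shift 0, those
  at even heights.\<close>

lemma GP_1_iso_HTG:
  assumes "even s" "0 < s" shows "GP s 1 \<cong>\<^sub>G HTG 2 s 0"
proof (rule graph_iso_sym, rule graph_isoI)
  let ?f = "\<lambda>(i :: nat, j :: nat). if i = 0 then Inl j else (Inr j :: nat + nat)"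
  let ?g = "case_sum (\<lambda>j. (0, j)) (\<lambda>j. (1 :: nat, j))"
  show "?f ` e \<in> edges (GP s 1)" if "e \<in> edges (HTG 2 s 0)" for e
    using that
  proof (cases rule: HTG_edge_cases)
    case (vertical i j)
    then show ?thesis using GP_outer[of j s 1] GP_inner[of j s 1] by (cases "i = 0") auto
  next
    case (horizontal i j)
    then show ?thesis using GP_spoke[of j s 1] by simp
  next
    case (jump j)
    then show ?thesis using GP_spoke[of j s 1] by (simp add: insert_commute)
  qed
  show "?g ` e \<in> edges (HTG 2 s 0)" if "e \<in> edges (GP s 1)" for e
    using that
  proof (cases rule: GP_edge_cases)
    case (outer j)
    then show ?thesis using HTG_vertical[of 0 2 j s 0] by simp
  next
    case (spoke j)
    show ?thesis
    proof (cases "even j")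
      case True
      then show ?thesis using HTG_jump[of j s 2 0] spoke by (simp add: insert_commute)
    next
      case False
      then have "(0 + 1) mod 2 = j mod 2" by presburger
      then show ?thesis using HTG_horizontal[of 0 2 j s 0] spoke by simp
    qed
  next
    case (inner j)
    then show ?thesis using HTG_vertical[of 1 2 j s 0] by simp
  qed
qed (auto simp: verts_HTG verts_GP)

text \<open>The cycle of length \<open>2 * s\<close> is cut into two rails. Since \<open>s\<close>
  is odd, exactly one of \<open>j\<close> and \<open>j + s\<close> is odd, so every rung comes from
  exactly one jump.\<close>

lemma HTG_iso_Moebius_ladder:
  assumes "odd s" "3 \<le> s" shows "HTG 1 (2 * s) s \<cong>\<^sub>G Moebius_ladder s"
proof (rule graph_isoI)
  let ?f = "\<lambda>(i :: nat, j). if j < s then Inl j else (Inr (j - s) :: nat + nat)"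
  let ?g = "case_sum (\<lambda>j. (0, j)) (\<lambda>j. (0 :: nat, j + s))"
  have rung: "{Inl j, Inr j} \<in> edges (Moebius_ladder s)" if "j < s" for j
    using that unfolding Moebius_ladder_def Prism_def by auto
  have rails: "{Inl j, Inl (Suc j)} \<in> edges (Moebius_ladder s)" "{Inr j, Inr (Suc j)} \<in> edges (Moebius_ladder s)"
    if "Suc j < s" for j
  proof -
    have "Suc j = (j + 1) mod s" using that by simp
    then have "{Inl j, Inl (Suc j)} \<in> edges (Prism s)" "{Inr j, Inr (Suc j)} \<in> edges (Prism s)"
      using that unfolding Prism_def by (auto intro!: exI[of _ j])
    then show "{Inl j, Inl (Suc j)} \<in> edges (Moebius_ladder s)" "{Inr j, Inr (Suc j)} \<in> edges (Moebius_ladder s)"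
      using that assms unfolding Moebius_ladder_def by (auto simp: doubleton_eq_iff)
  qed
  have twist: "{Inl (s - 1), Inr 0} \<in> edges (Moebius_ladder s)" "{Inr (s - 1), Inl 0} \<in> edges (Moebius_ladder s)"
    unfolding Moebius_ladder_def by auto
  show "?f ` e \<in> edges (Moebius_ladder s)" if e: "e \<in> edges (HTG 1 (2 * s) s)" for e
  proof -
    consider (V) j where "j < 2 * s" "e = {(0, j), (0, (j + 1) mod (2 * s))}"
      | (J) j where "j < 2 * s" "e = {(0, j), (0, (j + s) mod (2 * s))}"
      using e by (cases rule: HTG_edge_cases) simp_all
    then show ?thesis
    proof cases
      case V
      consider "Suc j < s" | "Suc j = s" | "s \<le> j" "Suc j < 2 * s" | "Suc j = 2 * s"
        using V(1) by linarith
      then show ?thesis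
      proof cases
        case 1
        then show ?thesis using V rails(1)[of j] by simp
      next
        case 2
        then have "j = s - 1" by simp
        then show ?thesis using V 2 twist(1) assms by simp
      next
        case 3
        then show ?thesis using V rails(2)[of "j - s"] by (simp add: Suc_diff_le)
      next
        case 4
        then have "j - s = s - 1" "\<not> j < s" using assms by linarith+
        then show ?thesis using V 4 twist(2) assms by simp
      qed
    next
      case J
      show ?thesis
      proof (cases "j < s")
        case True
        then show ?thesis using J rung[of j] by simp
      next
        case False
        then have "(j + s) mod (2 * s) = j - s" using J(1) by (simp add: mod_if)
        moreover have "j - s < s" using False J(1) by linarith
        ultimately show ?thesis using False J rung[of "j - s"] by (simp add: insert_commute)
      qed
    qed
  qed
  have vertical: "{(0, j), (0, (j + 1) mod (2 * s))} \<in> edges (HTG 1 (2 * s) s)" if "j < 2 * s" for j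
    using HTG_vertical[of 0 1 j "2 * s" s] that by simp
  have jump: "{(0, j), (0, j + s)} \<in> edges (HTG 1 (2 * s) s)" if "j < s" for j
  proof (cases "odd j")
    case True
    then have "j mod 2 = 1 mod 2" by presburger
    moreover have "(j + s) mod (2 * s) = j + s" using that by simp
    ultimately show ?thesis using HTG_jump[of j "2 * s" 1 s] that by simp
  next
    case False
    then have "(j + s) mod 2 = 1 mod 2" using assms by presburger
    moreover have "(j + s + s) mod (2 * s) = j" using that by (simp add: mod_if)
    ultimately have "{(0, j + s), (0, j)} \<in> edges (HTG 1 (2 * s) s)"
      using HTG_jump[of "j + s" "2 * s" 1 s] that by simp
    then show ?thesis by (simp add: insert_commute)
  qed
  show "?g ` e \<in> edges (HTG 1 (2 * s) s)" if e: "e \<in> edges (Moebius_ladder s)" for e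
  proof -
    consider (P) "e \<in> edges (GP s 1)" "e \<noteq> {Inl (s - 1), Inl 0}" "e \<noteq> {Inr (s - 1), Inr 0}"
      | (T) "e = {Inl (s - 1), Inr 0}" | (T') "e = {Inr (s - 1), Inl 0}"
      using e unfolding Moebius_ladder_def Prism_eq_GP snd_conv by blast
    then show ?thesis
    proof cases
      case P
      from P(1) show ?thesis
      proof (cases rule: GP_edge_cases)
        case (outer j)
        then have "Suc j < s" using P(2) by (cases "Suc j = s") auto
        then show ?thesis using outer vertical[of j] by simp
      next
        case (spoke j)
        then show ?thesis using jump[of j] by simp
      next
        case (inner j)
        then have "Suc j < s" using P(3) by (cases "Suc j = s") auto
        then show ?thesis using inner vertical[of "j + s"] by simp
      qed
    next
      case T
      then show ?thesis using vertical[of "s - 1"] assms by simp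
    next
      case T'
      then show ?thesis using vertical[of "s - 1 + s"] assms by (simp flip: mult_2)
    qed
  qed
qed (auto simp: verts_HTG Moebius_ladder_def Prism_def split: sum.splits if_splits)

text \<open>Jumps at even heights are shifted by half the column, so the even vertices of column 1
  are relabelled by that shift to straighten the spokes. A vertical edge then joins labels that
  differ by \<open>s div 2 - 1\<close> up to sign.\<close>

lemma HTG_2_half_iso_GP:
  assumes "s mod 4 = 0" "4 \<le> s" shows "HTG 2 s (s div 2) \<cong>\<^sub>G GP s (s div 2 - 1)"
proof -
  define h where "h = s div 2"
  have h: "s = 2 * h" "even h" "2 \<le> h" using assms unfolding h_def by presburger+
  \<comment> \<open>An involution, because \<open>h\<close> is even (parity is kept) and
    \<open>2 * h = s\<close>.\<close>
  let ?t = "\<lambda>j. if odd j then j else (j + h) mod s"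
  have tt: "?t (?t j) = j" "?t j < s" if "j < s" for j
    using that h by (auto simp: mod_if split: if_splits)
  have par: "even (j mod s) = even j" for j using h(1) by (simp add: dvd_mod_iff)
  let ?f = "\<lambda>(i :: nat, j). if i = 0 then Inl j else (Inr (?t j) :: nat + nat)"
  let ?g = "case_sum (\<lambda>j. (0, j)) (\<lambda>j. (1 :: nat, ?t j))"
  have inner: "{Inr i, Inr i'} \<in> edges (GP s (h - 1))" if "i < s" "i' = (i + (h - 1)) mod s" for i i'
    using GP_inner[of i s "h - 1"] that by simp
  have col: "{(1, i), (1, i')} \<in> edges (HTG 2 s h)" if "i < s" "i' = (i + 1) mod s" for i i'
    using HTG_vertical[of 1 2 i s h] that by simp
  have "HTG 2 s h \<cong>\<^sub>G GP s (h - 1)"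
  proof (rule graph_isoI)
    show "?f ` e \<in> edges (GP s (h - 1))" if e: "e \<in> edges (HTG 2 s h)" for e
    proof -
      consider (U) j where "j < s" "e = {(0, j), (0, (j + 1) mod s)}"
        | (V) j where "j < s" "e = {(1, j), (1, (j + 1) mod s)}"
        | (H) j where "j < s" "odd j" "e = {(0, j), (1, j)}"
        | (J) j where "j < s" "even j" "e = {(1, j), (0, (j + h) mod s)}"
        using e
      proof (cases rule: HTG_edge_cases)
        case (vertical i j)
        then have "i = 0 \<or> i = 1" by linarith
        then show ?thesis using that(1)[OF vertical(2)] that(2)[OF vertical(2)] vertical(3) by blast
      next
        case (horizontal i j)
        then have "i = 0" by simp
        moreover from this have "odd j" using horizontal(3) by presburger
        ultimately show ?thesis using that(3) horizontal by simp
      next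
        case (jump j)
        then have "even j" by presburger
        then show ?thesis using that(4) jump by simp
      qed
      then show ?thesis
      proof cases
        case V
        show ?thesis
        proof (cases "odd j")
          case True
          have "((j + 1 + h) mod s + (h - 1)) mod s = ((j + 1 + h) + (h - 1)) mod s"
            by (rule mod_add_left_eq)
          also have "(j + 1 + h) + (h - 1) = j + s" using h by simp
          finally have "((j + 1 + h) mod s + (h - 1)) mod s = j" using V(1) by simp
          moreover have "((j + 1) mod s + h) mod s = (j + 1 + h) mod s" by (rule mod_add_left_eq)
          ultimately have "j = (((j + 1) mod s + h) mod s + (h - 1)) mod s" by simp
          moreover have "even ((j + 1) mod s)" using True par by simp
          ultimately show ?thesis using inner[of "((j + 1) mod s + h) mod s" j] True V h
            by (simp add: insert_commute)
        next
          case False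
          then have "j + 1 < s" using V h by presburger
          moreover have "(j + h) mod s = (j + 1 + (h - 1)) mod s" using h by simp
          ultimately show ?thesis using inner[of "j + 1" "(j + h) mod s"] False V
            by (simp add: insert_commute)
        qed
      next
        case U
        then show ?thesis using GP_outer[of j s "h - 1"] by simp
      next
        case H
        then show ?thesis using GP_spoke[of j s "h - 1"] by simp
      next
        case J
        then show ?thesis using GP_spoke[of "(j + h) mod s" s "h - 1"] h by (simp add: insert_commute)
      qed
    qed
    show "?g ` e \<in> edges (HTG 2 s h)" if e: "e \<in> edges (GP s (h - 1))" for e
    proof -
      show ?thesis
        using e
      proof (cases rule: GP_edge_cases)
        case (outer j)
        then show ?thesis using HTG_vertical[of 0 2 j s h] by simp
      next
        case S: (spoke j)
        show ?thesis
        proof (cases "odd j")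
          case True
          then have "(0 + 1) mod 2 = j mod 2" by presburger
          then show ?thesis using S True HTG_horizontal[of 0 2 j s h] by simp
        next
          case False
          let ?j = "(j + h) mod s"
          have "?j < s" "even ?j" using False h par by auto
          then have "{(1, ?j), (0, (?j + h) mod s)} \<in> edges (HTG 2 s h)"
            using HTG_jump[of ?j s 2 h] by (simp add: even_iff_mod_2_eq_zero)
          moreover have "(?j + h) mod s = j" using tt(1)[OF S(1)] False \<open>even ?j\<close> by simp
          ultimately show ?thesis using S False by (simp add: insert_commute)
        qed
      next
        case V: (inner j)
        let ?j = "(j + (h - 1)) mod s"
        have pj: "even ?j \<longleftrightarrow> odd j" using h par by simp
        show ?thesis
        proof (cases "odd j")
          case True
          have "(?j + h) mod s = ((j + (h - 1)) + h) mod s" by (rule mod_add_left_eq)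
          also have "(j + (h - 1)) + h = j - 1 + s" using True h by (cases j) simp_all
          finally have "(?j + h) mod s = j - 1" using V by simp
          then show ?thesis using V True pj col[of "j - 1" j] by (simp add: insert_commute odd_pos)
        next
          case False
          have "(?j + 1) mod s = ((j + (h - 1)) + 1) mod s" by (rule mod_add_left_eq)
          also have "(j + (h - 1)) + 1 = j + h" using h by simp
          finally have "(?j + 1) mod s = (j + h) mod s" .
          then show ?thesis using V False pj col[of ?j "(j + h) mod s"] h by (simp add: insert_commute)
        qed
      qed
    qed
  qed (use tt in \<open>auto simp: verts_HTG verts_GP less_Suc_eq\<close>)
  then show ?thesis unfolding h_def .
qed

section \<open>Six-cycles in generalized Petersen graphs\<close>

lemma card_rooted_cycles_ge_3:
  assumes "card (rooted_cycles G k a b) = 2"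
    and "x \<in> rooted_cycles G k a b" "y \<in> rooted_cycles G k a b" "z \<in> rooted_cycles G k a b"
  shows "x = y \<or> x = z \<or> y = z"
proof (rule ccontr)
  assume "\<not> ?thesis"
  then have "card {x, y, z} = 3" by simp
  moreover have "finite (rooted_cycles G k a b)" using assms(1) card_ge_0_finite by force
  then have "card {x, y, z} \<le> 2" using card_mono[of "rooted_cycles G k a b" "{x, y, z}"] assms by simp
  ultimately show False by simp
qed

text \<open>Indices are integers modulo \<open>N\<close>, so that rotation becomes addition and
  adjacency a congruence. The bound \<open>N_ge\<close> keeps small differences nonzero modulo
  \<open>N\<close>.\<close>

locale petersen =
  fixes N k :: nat
  assumes k_pos: "1 \<le> k" and k_le: "2 * k \<le> N" and N_ge: "6 \<le> N"
begin

definition outer :: "int \<Rightarrow> nat + nat" where "outer x = Inl (nat (x mod int N))"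
definition inner :: "int \<Rightarrow> nat + nat" where "inner x = Inr (nat (x mod int N))"

lemma outer_inner_eq_iff [simp]:
  "outer x = outer y \<longleftrightarrow> int N dvd x - y" "inner x = inner y \<longleftrightarrow> int N dvd x - y"
  "outer x \<noteq> inner y" "inner y \<noteq> outer x"
  unfolding outer_def inner_def using N_ge by (auto simp: nat_eq_iff mod_eq_dvd_iff)

lemma outer_inner_mem_verts [simp]: "outer x \<in> verts (GP N k)" "inner x \<in> verts (GP N k)"
  unfolding verts_GP outer_def inner_def using N_ge by (auto simp: nat_less_iff)

lemma of_nat_index: "Inl i = outer (int i)" "Inr i = inner (int i)" if "i < N"
  unfolding outer_def inner_def using that by simp_all

lemma shift: "Inl ((i + c) mod N) = outer (int i + int c)" "Inr ((i + c) mod N) = inner (int i + int c)"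
  unfolding outer_def inner_def by (simp_all add: nat_mod_distrib nat_add_distrib)

lemma edge_cases:
  assumes "e \<in> edges (GP N k)"
  obtains x where "e = {outer x, outer (x + 1)}" | x where "e = {outer x, inner x}"
    | x where "e = {inner x, inner (x + int k)}"
  using assms
proof (cases rule: GP_edge_cases)
  case (outer i)
  then show ?thesis using that(1)[of "int i"] of_nat_index(1)[of i] shift(1)[of i 1] by simp
next
  case (spoke i)
  then show ?thesis using that(2)[of "int i"] of_nat_index[of i] by simp
next
  case (inner i)
  then show ?thesis using that(3)[of "int i"] of_nat_index(2)[of i] shift(2)[of i k] by simp
qed

lemma normal_form: "\<exists>i<N. outer x = Inl i \<and> inner x = Inr i \<and> outer (x + 1) = Inl ((i + 1) mod N) \<and>
    inner (x + int k) = Inr ((i + k) mod N)"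
proof (intro exI[of _ "nat (x mod int N)"] conjI)
  let ?i = "nat (x mod int N)"
  have i: "int ?i = x mod int N" using N_ge by simp
  show "?i < N" using N_ge by (simp add: nat_less_iff)
  show "outer (x + 1) = Inl ((?i + 1) mod N)" "inner (x + int k) = Inr ((?i + k) mod N)"
    using shift(1)[of ?i 1] shift(2)[of ?i k] unfolding i
    by (simp_all add: outer_def inner_def mod_simps)
qed (simp_all add: outer_def inner_def)

lemma generator_edges: "{outer x, outer (x + 1)} \<in> edges (GP N k)" "{outer x, inner x} \<in> edges (GP N k)"
  "{inner x, inner (x + int k)} \<in> edges (GP N k)"
  using normal_form[of x] GP_outer[of _ N k] GP_spoke[of _ N k] GP_inner[of _ N k] by metis+

lemma outer_edge: "int N dvd y - x - 1 \<Longrightarrow> {outer x, outer y} \<in> edges (GP N k)"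
  and outer_edge': "int N dvd y - x + 1 \<Longrightarrow> {outer x, outer y} \<in> edges (GP N k)"
  and spoke_edge: "int N dvd y - x \<Longrightarrow> {outer x, inner y} \<in> edges (GP N k)"
    "int N dvd y - x \<Longrightarrow> {inner x, outer y} \<in> edges (GP N k)"
  and inner_edge: "int N dvd y - x - int k \<Longrightarrow> {inner x, inner y} \<in> edges (GP N k)"
  and inner_edge': "int N dvd y - x + int k \<Longrightarrow> {inner x, inner y} \<in> edges (GP N k)"
proof -
  show "{outer x, outer y} \<in> edges (GP N k)" if "int N dvd y - x - 1"
  proof -
    have "outer y = outer (x + 1)" using that by (simp add: diff_diff_eq)
    then show ?thesis using generator_edges(1)[of x] by (simp only:)
  qed
  show "{outer x, outer y} \<in> edges (GP N k)" if "int N dvd y - x + 1"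
  proof -
    have "outer x = outer (y + 1)" using that dvd_diff_commute[of "int N" x "y + 1"] by (simp add: algebra_simps)
    then show ?thesis using generator_edges(1)[of y] by (simp only: insert_commute)
  qed
  show "{outer x, inner y} \<in> edges (GP N k)" if "int N dvd y - x"
  proof -
    have "inner y = inner x" using that by simp
    then show ?thesis using generator_edges(2)[of x] by (simp only:)
  qed
  show "{inner x, outer y} \<in> edges (GP N k)" if "int N dvd y - x"
  proof -
    have "outer y = outer x" using that by simp
    then show ?thesis using generator_edges(2)[of x] by (simp only: insert_commute)
  qed
  show "{inner x, inner y} \<in> edges (GP N k)" if "int N dvd y - x - int k"
  proof -
    have "inner y = inner (x + int k)" using that by (simp add: diff_diff_eq)
    then show ?thesis using generator_edges(3)[of x] by (simp only:)
  qed
  show "{inner x, inner y} \<in> edges (GP N k)" if "int N dvd y - x + int k"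
  proof -
    have "inner x = inner (y + int k)" using that dvd_diff_commute[of "int N" x "y + int k"] by (simp add: algebra_simps)
    then show ?thesis using generator_edges(3)[of y] by (simp only: insert_commute)
  qed
qed

lemma outer_nbr:
  assumes "{outer x, z} \<in> edges (GP N k)"
  shows "z = outer (x + 1) \<or> z = outer (x - 1) \<or> z = inner x"
  using assms
proof (cases rule: edge_cases)
  case (1 y)
  then consider "outer x = outer y" "z = outer (y + 1)" | "outer x = outer (y + 1)" "z = outer y"
    unfolding doubleton_eq_iff by blast
  then show ?thesis by cases (auto simp: algebra_simps dvd_diff_commute)
next
  case (2 y)
  then show ?thesis unfolding doubleton_eq_iff by (auto simp: dvd_diff_commute)
qed (auto simp: doubleton_eq_iff)

lemma inner_nbr:
  assumes "{inner x, z} \<in> edges (GP N k)"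
  shows "z = inner (x + int k) \<or> z = inner (x - int k) \<or> z = outer x"
  using assms
proof (cases rule: edge_cases)
  case (3 y)
  then consider "inner x = inner y" "z = inner (y + int k)" | "inner x = inner (y + int k)" "z = inner y"
    unfolding doubleton_eq_iff by blast
  then show ?thesis by cases (auto simp: algebra_simps dvd_diff_commute)
next
  case (2 y)
  then show ?thesis unfolding doubleton_eq_iff by (auto simp: dvd_diff_commute)
qed (auto simp: doubleton_eq_iff)

lemma not_dvd: "0 < x \<Longrightarrow> x < 6 \<Longrightarrow> \<not> int N dvd x"
  using N_ge zdvd_imp_le[of "int N" x] by linarith

lemma six_cycleI:
  assumes "distinct [a, b, c, d, e, f]" "set [a, b, c, d, e, f] \<subseteq> verts (GP N k)"
    and "{a, b} \<in> edges (GP N k)" "{b, c} \<in> edges (GP N k)" "{c, d} \<in> edges (GP N k)"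
    "{d, e} \<in> edges (GP N k)" "{e, f} \<in> edges (GP N k)" "{f, a} \<in> edges (GP N k)"
  shows "[a, b, c, d, e, f] \<in> rooted_cycles (GP N k) 6 a b"
proof -
  let ?xs = "[a, b, c, d, e, f]"
  have "{?xs ! i, ?xs ! ((i + 1) mod 6)} \<in> edges (GP N k)" if "i < 6" for i
  proof -
    have "i = 0 \<or> i = 1 \<or> i = 2 \<or> i = 3 \<or> i = 4 \<or> i = 5" using that by linarith
    then show ?thesis using assms(3-8) by (elim disjE) simp_all
  qed
  moreover have "length ?xs = 6" by simp
  ultimately show ?thesis
    unfolding rooted_cycles_def is_cycle_def using assms(1,2) by (simp only: mem_Collect_eq) simp
qed

lemma four_cycleI:
  assumes "distinct [a, b, c, d]" "set [a, b, c, d] \<subseteq> verts (GP N k)"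
    and "{a, b} \<in> edges (GP N k)" "{b, c} \<in> edges (GP N k)" "{c, d} \<in> edges (GP N k)"
    "{d, a} \<in> edges (GP N k)"
  shows "is_cycle (GP N k) [a, b, c, d]"
proof -
  let ?xs = "[a, b, c, d]"
  have "{?xs ! i, ?xs ! ((i + 1) mod 4)} \<in> edges (GP N k)" if "i < 4" for i
  proof -
    have "i = 0 \<or> i = 1 \<or> i = 2 \<or> i = 3" using that by linarith
    then show ?thesis using assms(3-6) by (elim disjE) simp_all
  qed
  moreover have "length ?xs = 4" by simp
  ultimately show ?thesis unfolding is_cycle_def using assms(1,2) by (simp only:) simp
qed

text \<open>Such a cycle continues to \<open>inner a\<close> with a = k or -k and returns through
  \<open>outer b\<close> with b = 1 or -1. Two further vertices are chosen next to these, and the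
  edge between them closes the cycle exactly under a congruence; the set lists the possibilities up
  to sign.\<close>

lemma spoke_cycle_congruence:
  assumes "xs \<in> rooted_cycles (GP N k) 6 (outer 0) (inner 0)"
  shows "\<exists>c\<in>{int k - 1, int k + 1, int k - 3, int k + 3, 3 * int k - 1, 3 * int k + 1,
    2 * int k - 2, 2 * int k + 2}. int N dvd c" (is "\<exists>c\<in>?S. _")
proof -
  let ?E = "edges (GP N k)"
  have c: "is_cycle (GP N k) xs" "length xs = 6" "xs ! 0 = outer 0" "xs ! 1 = inner 0"
    using assms unfolding rooted_cycles_def by auto
  have d: "distinct xs" and e: "\<And>i. i < 6 \<Longrightarrow> {xs ! i, xs ! ((i + 1) mod 6)} \<in> ?E"
    using c unfolding is_cycle_def by auto
  have ne: "xs ! i \<noteq> xs ! j" if "i < 6" "j < 6" "i \<noteq> j" for i j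
    using d c(2) that by (simp add: nth_eq_iff_index_eq)
  have e12: "{inner 0, xs ! 2} \<in> ?E" using e[of 1] c(4) by (simp add: numeral_2_eq_2)
  have e23: "{xs ! 2, xs ! 3} \<in> ?E" and e34: "{xs ! 3, xs ! 4} \<in> ?E"
    and e45: "{xs ! 5, xs ! 4} \<in> ?E" and e50: "{outer 0, xs ! 5} \<in> ?E"
    using e[of 2] e[of 3] e[of 4] e[of 5] c(3) by (simp_all add: insert_commute)
  have n: "xs ! 2 \<noteq> outer 0" "xs ! 5 \<noteq> inner 0" "xs ! 3 \<noteq> inner 0" "xs ! 4 \<noteq> outer 0" "xs ! 2 \<noteq> xs ! 4"
    using ne[of 2 0] ne[of 5 1] ne[of 3 1] ne[of 4 0] ne[of 2 4] c(3,4) by simp_all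
  obtain a where a: "xs ! 2 = inner a" "a = int k \<or> a = - int k"
    using inner_nbr[OF e12] n(1) by auto
  obtain b where b: "xs ! 5 = outer b" "b = 1 \<or> b = -1"
    using outer_nbr[OF e50] n(2) by auto
  have x3: "xs ! 3 = inner (a + int k) \<or> xs ! 3 = inner (a - int k) \<or> xs ! 3 = outer a"
    using inner_nbr e23 unfolding a(1) by blast
  have x4: "xs ! 4 = outer (b + 1) \<or> xs ! 4 = outer (b - 1) \<or> xs ! 4 = inner b"
    using outer_nbr e45 unfolding b(1) by blast
  have x3': "xs ! 3 = inner (2 * a) \<or> xs ! 3 = outer a"
    using x3 a(2) n(3) by auto
  have x4': "xs ! 4 = outer (2 * b) \<or> xs ! 4 = inner b"
    using x4 b(2) n(4) by auto
  have five: "int N dvd 2 * a - 2 * b \<or> int N dvd 2 * a - b + int k \<or> int N dvd 2 * a - b - int k \<or>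
      int N dvd a - 2 * b + 1 \<or> int N dvd a - 2 * b - 1"
  proof -
    consider "xs ! 3 = inner (2 * a)" "xs ! 4 = outer (2 * b)" | "xs ! 3 = inner (2 * a)" "xs ! 4 = inner b"
      | "xs ! 3 = outer a" "xs ! 4 = outer (2 * b)" | "xs ! 3 = outer a" "xs ! 4 = inner b"
      using x3' x4' by blast
    then show ?thesis
    proof cases
      case 1
      then show ?thesis using inner_nbr[of "2 * a" "xs ! 4"] e34 by (auto simp: dvd_diff_commute)
    next
      case 2
      then have "int N dvd b - (2 * a + int k) \<or> int N dvd b - (2 * a - int k)"
        using inner_nbr[of "2 * a" "xs ! 4"] e34 by auto
      then show ?thesis by (auto simp: dvd_diff_commute algebra_simps)
    next
      case 3
      then have "int N dvd 2 * b - (a + 1) \<or> int N dvd 2 * b - (a - 1)"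
        using outer_nbr[of a "xs ! 4"] e34 by auto
      then show ?thesis by (auto simp: dvd_diff_commute algebra_simps)
    next
      case 4
      \<comment> \<open>Only a spoke joins an outer to an inner vertex, and this spoke would lead
        back to \<open>xs ! 2\<close>.\<close>
      then have "xs ! 4 = inner a" using outer_nbr[of a "xs ! 4"] e34 by auto
      then show ?thesis using a(1) n(5) by simp
    qed
  qed
  have key: ?thesis if "int N dvd x" "x \<in> ?S \<or> - x \<in> ?S" for x
    using that dvd_minus_iff[of "int N" x] by blast
  show ?thesis
    by (insert five a(2) b(2), elim disjE) (rule key, assumption, simp)+
qed

text \<open>The edges of a generalized Petersen graph split into three orbits under rotation. A six-cycle through
  a spoke other than those with \<open>2 k \<equiv> \<plusminus> 2\<close> modulo \<open>N\<close> has three consecutive outer or three consecutive inner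
  edges, and its rotations put three six-cycles on each of these.\<close>

lemma parameter_of_two_six_cycles:
  assumes g: "girth (GP N k) = 6"
    and two: "\<And>a b. {a, b} \<in> edges (GP N k) \<Longrightarrow> card (rooted_cycles (GP N k) 6 a b) = 2"
  shows "N = 2 * k + 2"
proof -
  have "rooted_cycles (GP N k) 6 (outer 0) (inner 0) \<noteq> {}"
    using two[OF spoke_edge(1)[of 0 0]] by auto
  then obtain c where c: "c \<in> {int k - 1, int k + 1, int k - 3, int k + 3, 3 * int k - 1, 3 * int k + 1,
      2 * int k - 2, 2 * int k + 2}" "int N dvd c"
    using spoke_cycle_congruence by blast
  have k1: "k \<noteq> 1"
  proof
    assume k: "k = 1"
    have chord: "{inner 1, inner 0} \<in> edges (GP N k)" using k by (intro inner_edge') simp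
    have "is_cycle (GP N k) [outer 0, outer 1, inner 1, inner 0]"
      by (rule four_cycleI)
        (use not_dvd[of 1] outer_edge[of 1 0] spoke_edge[of 1 1] spoke_edge[of 0 0] chord
          in \<open>simp_all add: insert_commute\<close>)
    then have "girth (GP N k) \<le> length [outer 0, outer 1, inner 1, inner 0]"
      unfolding girth_def_list by (intro Least_le) blast
    then show False using g by simp
  qed
  have no_3: "\<not> (int N dvd int k - 3 \<or> int N dvd int k + 3)"
  proof
    assume k: "int N dvd int k - 3 \<or> int N dvd int k + 3"
    have chord: "{inner x, inner y} \<in> edges (GP N k)" if "y - x = 3" for x y
      using k that inner_edge[of y x] inner_edge'[of y x] dvd_diff_commute[of "int N" "int k" 3]
      by (auto simp: add.commute)
    have "N \<noteq> Suc 0" using N_ge by simp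
    note simps = this not_dvd outer_edge outer_edge' spoke_edge chord
    have "[outer 0, outer 1, outer 2, outer 3, inner 3, inner 0] \<in> rooted_cycles (GP N k) 6 (outer 0) (outer 1)"
      by (rule six_cycleI) (use chord[of 3 0] in \<open>simp_all add: simps insert_commute\<close>)
    moreover have "[outer 0, outer 1, outer 2, inner 2, inner (-1), outer (-1)] \<in> rooted_cycles (GP N k) 6 (outer 0) (outer 1)"
      by (rule six_cycleI) (use chord[of 2 "-1"] in \<open>simp_all add: simps insert_commute\<close>)
    moreover have "[outer 0, outer 1, inner 1, inner (-2), outer (-2), outer (-1)] \<in> rooted_cycles (GP N k) 6 (outer 0) (outer 1)"
      by (rule six_cycleI) (use chord[of 1 "-2"] in \<open>simp_all add: simps insert_commute\<close>)
    ultimately show False using card_rooted_cycles_ge_3[OF two[OF outer_edge[of 1 0]]] by fastforce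
  qed
  have no_third: "\<not> (int N dvd 3 * int k - 1 \<or> int N dvd 3 * int k + 1)"
  proof
    assume k: "int N dvd 3 * int k - 1 \<or> int N dvd 3 * int k + 1"
    \<comment> \<open>Since 6 k is 2 or -2 modulo \<open>N\<close>, its vanishing would make
      \<open>N\<close> divide 2. This keeps k, 2 k and 3 k nonzero, hence the vertices of the cycles
      below distinct.\<close>
    have nd6: "\<not> int N dvd 6 * int k"
    proof
      assume *: "int N dvd 6 * int k"
      from k have "int N dvd 2 * (3 * int k - 1) \<or> int N dvd 2 * (3 * int k + 1)" by (meson dvd_mult)
      then have "int N dvd 6 * int k - 2 \<or> int N dvd 6 * int k + 2" by (simp add: algebra_simps)
      then have "int N dvd 2" using * by (auto simp: dvd_diff_right_iff dvd_add_right_iff)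
      then show False using not_dvd[of 2] by simp
    qed
    have nd: "\<not> int N dvd int k" "\<not> int N dvd 2 * int k" "\<not> int N dvd 3 * int k"
      using nd6 dvd_mult[of "int N" "int k" 6] dvd_mult[of "int N" "2 * int k" 3]
        dvd_mult[of "int N" "3 * int k" 2] by auto
    have chord: "{outer x, outer y} \<in> edges (GP N k)" if "y - x = 3 * int k" for x y
      using k that outer_edge[of y x] outer_edge'[of y x] by auto
    have link: "{inner x, inner y} \<in> edges (GP N k)" if "y - x = int k" for x y
      using that by (intro inner_edge) simp
    let ?k = "int k"
    have "\<not> N dvd k" using nd(1) by simp
    note simps = this nd spoke_edge insert_commute
    have "[inner 0, inner ?k, inner (2 * ?k), inner (3 * ?k), outer (3 * ?k), outer 0] \<in>
        rooted_cycles (GP N k) 6 (inner 0) (inner ?k)"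
      by (rule six_cycleI) (use chord[of "3 * ?k" 0] link[of ?k 0] link[of "2 * ?k" ?k] link[of "3 * ?k" "2 * ?k"]
        in \<open>simp_all add: simps\<close>)
    moreover have "[inner 0, inner ?k, inner (2 * ?k), outer (2 * ?k), outer (- ?k), inner (- ?k)] \<in>
        rooted_cycles (GP N k) 6 (inner 0) (inner ?k)"
      by (rule six_cycleI) (use chord[of "2 * ?k" "- ?k"] link[of ?k 0] link[of "2 * ?k" ?k] link[of 0 "- ?k"]
        in \<open>simp_all add: simps\<close>)
    moreover have "[inner 0, inner ?k, outer ?k, outer (- 2 * ?k), inner (- 2 * ?k), inner (- ?k)] \<in>
        rooted_cycles (GP N k) 6 (inner 0) (inner ?k)"
      by (rule six_cycleI) (use chord[of ?k "- 2 * ?k"] link[of ?k 0] link[of "- ?k" "- 2 * ?k"] link[of 0 "- ?k"]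
        in \<open>simp_all add: simps\<close>)
    ultimately show False using card_rooted_cycles_ge_3[OF two[OF link[of ?k 0]]] by fastforce
  qed
  have "int N \<le> x" if "int N dvd x" "0 < x" for x using that zdvd_imp_le by blast
  note le = this
  \<comment> \<open>Here \<open>k\<close> lies between 2 and N / 2, so these three numbers are
    positive and smaller than \<open>N\<close>. The surviving 2 k + 2 is at most N + 2, hence less
    than 2 N, and must equal \<open>N\<close>.\<close>
  have "\<not> int N dvd int k - 1" "\<not> int N dvd int k + 1" "\<not> int N dvd 2 * int k - 2"
    using le[of "int k - 1"] le[of "int k + 1"] le[of "2 * int k - 2"] k_pos k1 k_le N_ge by linarith+
  then have "int N dvd 2 * int k + 2" using c no_3 no_third by auto
  then have "int N dvd 2 * int k + 2 - int N" by simp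
  then have "\<not> 0 < 2 * int k + 2 - int N" using le[of "2 * int k + 2 - int N"] k_le N_ge by linarith
  moreover have "int N \<le> 2 * int k + 2" using le[OF \<open>int N dvd 2 * int k + 2\<close>] by simp
  ultimately show ?thesis by linarith
qed

text \<open>The inner edge from 0 to \<open>k\<close>, two spokes and \<open>k\<close> outer edges
  form a closed walk of length k + 3, which must be even.\<close>

lemma odd_parameter_of_bipartite:
  fixes col :: "nat + nat \<Rightarrow> bool"
  assumes col: "\<And>y z. {y, z} \<in> edges (GP N k) \<Longrightarrow> col y \<noteq> col z"
  shows "odd k"
proof -
  have "col (outer (int n)) \<longleftrightarrow> (col (outer 0) \<longleftrightarrow> even n)" for n
  proof (induction n)
    case (Suc n)
    then show ?case using col[OF generator_edges(1)[of "int n"]] by (auto simp: add.commute)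
  qed simp
  moreover have "col (outer 0) \<noteq> col (outer (int k))"
    using col[OF generator_edges(2)[of 0]] col[OF generator_edges(3)[of 0]] col[OF generator_edges(2)[of "int k"]] by simp
  ultimately show ?thesis by blast
qed

end

lemma has_signature_const_eps:
  assumes "has_signature G [c, c, c]" "v \<in> verts G" "e \<in> edges G" "v \<in> e"
  shows "eps G e = c"
proof -
  let ?E = "{e \<in> edges G. v \<in> e}"
  have "vertex_signature G v = [c, c, c]" using assms unfolding has_signature_def by blast
  then have M: "image_mset (eps G) (mset_set ?E) = {#c, c, c#}"
    unfolding vertex_signature_def by (metis mset.simps mset_sorted_list_of_multiset)
  then have fin: "finite ?E" by (metis (lifting) image_mset_is_empty_iff mset_set.infinite empty_not_add_mset)
  then have "eps G ` ?E = {c}" using M by (metis (lifting) finite_set_mset_mset_set set_image_mset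
      set_mset_add_mset_insert set_mset_empty insert_absorb2)
  then show ?thesis using assms(3,4) by blast
qed

context hex_cover
begin

text \<open>The signature says that every edge lies in exactly two six-cycles, which gives N = 2 k +
  2; bipartiteness makes \<open>k\<close> odd, so 4 divides \<open>N\<close>.\<close>

lemma parameters_of_iso_GP:
  assumes iso: "G \<cong>\<^sub>G GP N k" and k: "1 \<le> k" "2 * k \<le> N" and N: "6 \<le> N"
    and g: "girth G = 6" and sig: "has_signature G [2, 2, 2]"
  shows "N mod 4 = 0 \<and> k = N div 2 - 1"
proof -
  interpret petersen N k using k N by unfold_locales
  obtain f where f: "bij_betw f (verts G) (verts (GP N k))"
    and e: "\<And>u v. u \<in> verts G \<Longrightarrow> v \<in> verts G \<Longrightarrow> {u, v} \<in> edges G \<longleftrightarrow> {f u, f v} \<in> edges (GP N k)"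
    using iso unfolding graph_iso_def by blast
  have g': "girth (GP N k) = 6" using graph_iso_girth[OF iso] g by simp
  have lift: "\<exists>u s. y = f (\<phi> u) \<and> z = f (\<phi> (step s u))" if "{y, z} \<in> edges (GP N k)" for y z
  proof -
    have "y \<in> verts (GP N k)" "z \<in> verts (GP N k)"
      using that by (auto elim!: edge_cases simp: doubleton_eq_iff)
    then obtain u v where uv: "y = f (\<phi> u)" "z = f (\<phi> v)"
      using f unfolding bij_betw_def verts_eq by blast
    then have "{\<phi> u, \<phi> v} \<in> edges G" using e[of "\<phi> u" "\<phi> v"] that verts_eq by blast
    then obtain s where "\<phi> v = \<phi> (step s u)" using edge_iff[of u "\<phi> v"] by blast
    then show ?thesis using uv by metis
  qed
  have "card (rooted_cycles (GP N k) 6 y z) = 2" if yz: "{y, z} \<in> edges (GP N k)" for y z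
  proof -
    obtain u s where u: "y = f (\<phi> u)" "z = f (\<phi> (step s u))" using lift[OF yz] by blast
    have mem: "\<phi> u \<in> verts G" "\<phi> (step s u) \<in> verts G" using verts_eq by auto
    have ne: "\<phi> u \<noteq> \<phi> (step s u)" using step_ne by metis
    have "eps G {\<phi> u, \<phi> (step s u)} = 2"
      using has_signature_const_eps[OF sig mem(1)] edgeI[of u s] by simp
    then have "eps (GP N k) {y, z} = 2" using graph_iso_eps[OF f e mem ne] u by simp
    moreover have "y \<noteq> z" using u ne f mem unfolding bij_betw_def inj_on_def by blast
    ultimately show ?thesis using eps_eq_card_rooted_cycles[of y z "GP N k"] g' by simp
  qed
  from parameter_of_two_six_cycles[OF g' this] have Nk: "N = 2 * k + 2" .
  \<comment> \<open>The bipartition of the brick wall, transported through the cover and the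
    isomorphism. The chosen preimage does not matter, because lattice vectors are even.\<close>
  define col where "col = (\<lambda>y. odd_point (SOME u. f (\<phi> u) = y))"
  have col: "col (f (\<phi> u)) = odd_point u" for u
  proof -
    have "f (\<phi> (SOME v. f (\<phi> v) = f (\<phi> u))) = f (\<phi> u)" by (rule someI) simp
    then have "\<phi> (SOME v. f (\<phi> v) = f (\<phi> u)) = \<phi> u"
      using f unfolding bij_betw_def inj_on_def verts_eq by blast
    then show ?thesis unfolding col_def by (rule fiber_odd_point)
  qed
  have "odd k"
  proof (rule odd_parameter_of_bipartite)
    show "col y \<noteq> col z" if yz: "{y, z} \<in> edges (GP N k)" for y z
    proof -
      obtain u s where "y = f (\<phi> u)" "z = f (\<phi> (step s u))" using lift[OF yz] by blast
      then show ?thesis using col[of u] col[of "step s u"] odd_point_step[of s u] by metis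
    qed
  qed
  then show ?thesis using Nk by presburger
qed

end

section \<open>Assembly of the classification\<close>

lemma graph_iso_card_verts: "G \<cong>\<^sub>G H \<Longrightarrow> card (verts G) = card (verts H)"
  unfolding graph_iso_def using bij_betw_same_card by blast

lemma HTG_1_3_ladder:
  assumes "0 < s" "s mod 3 = 0"
  shows "s mod 6 = 0 \<and> HTG 1 (2 * s) 3 \<cong>\<^sub>G Prism s \<and> Prism s \<cong>\<^sub>G GP s 1 \<and> GP s 1 \<cong>\<^sub>G HTG 2 s 0 \<or>
    s mod 6 = 3 \<and> HTG 1 (2 * s) 3 \<cong>\<^sub>G Moebius_ladder s \<and> Moebius_ladder s \<cong>\<^sub>G HTG 1 (2 * s) s"
proof (cases "even s")
  case True
  then have "s mod 6 = 0" using assms(2) by presburger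
  moreover have "GP s 1 \<cong>\<^sub>G HTG 2 s 0" by (rule GP_1_iso_HTG[OF True assms(1)])
  moreover from this have "HTG 1 (2 * s) 3 \<cong>\<^sub>G GP s 1"
    using graph_iso_trans[OF HTG_1_3_iso_even[OF assms(1) True]] graph_iso_sym by blast
  ultimately show ?thesis unfolding Prism_eq_GP using graph_iso_refl by blast
next
  case False
  then have s: "s mod 6 = 3" "3 \<le> s" using assms by presburger+
  have "HTG 1 (2 * s) s \<cong>\<^sub>G Moebius_ladder s" using False s(2) by (rule HTG_iso_Moebius_ladder)
  then show ?thesis
    using s(1) graph_iso_trans[OF HTG_1_3_iso_odd[OF False]] graph_iso_sym by blast
qed

text \<open>Used in the case without short vectors: there a listed triple can only belong to the
  generalized Petersen family.\<close>

lemma listed_triple_short_vector: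
  assumes "(m, n, l) \<in> listed_triples" "1 \<le> m" "4 \<le> n"
  shows "m = 2 \<and> n mod 4 = 0 \<and> l = n div 2 \<or>
    (\<exists>v \<in> {(1, -3), (2, 0), (0, 6), (3, 3), (3, -3)}. v \<in> HTG_lattice m n l)"
proof -
  have "m = 1 \<and> l = 3 \<or> m = 2 \<and> l = 0 \<or> (\<exists>s. m = 1 \<and> n = 2 * s \<and> l = s) \<or> n = 6 \<or> m = 3 \<and> l = 3 \<or>
      (\<exists>s>0. m = 1 \<and> n = 6 * s \<and> l = 2 * s - 1) \<or> (\<exists>s. m = 1 \<and> n = 6 * s \<and> l = 2 * s + 1) \<or>
      m = 2 \<and> n mod 4 = 0 \<and> l = n div 2"
    using assms(1,3) unfolding listed_triples_def by (elim UnE; clarsimp)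
  then show ?thesis
  proof (elim disjE exE conjE)
    \<comment> \<open>Positivity of \<open>s\<close> guards the truncated subtraction; then 3 + 3 (2
      s - 1) = 6 s shows that (3, 3) is in the lattice.\<close>
    fix s assume "0 < s" "m = 1" "n = 6 * s" "l = 2 * s - 1"
    moreover from this have "int l = 2 * int s - 1" by simp
    ultimately have "(3, 3) \<in> HTG_lattice m n l" unfolding HTG_lattice_def by simp
    then show ?thesis by blast
  qed (simp_all add: HTG_lattice_def)
qed

theorem theorem4p6:
  fixes m n l :: nat and X :: "(nat \<times> nat) graph"
  assumes "HTG_params m n l"
    and "X = HTG m n l"
    and "is_3RDR X"
  shows "(even m \<and> n mod 6 = 0 \<and> l mod 6 = 0 \<or> odd m \<and> n mod 6 = 0 \<and> l mod 6 = 3) \<and>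
    ((girth X = 4 \<and>
      has_signature X (if (m, n, l) = (1, 6, 3) then [4, 4, 4] else [1, 1, 2]) \<and>
      (\<exists>s. X \<cong>\<^sub>G HTG 1 (2 * s) 3 \<and>
         (s mod 6 = 0 \<and> HTG 1 (2 * s) 3 \<cong>\<^sub>G Prism s \<and> Prism s \<cong>\<^sub>G GP s 1 \<and>
            GP s 1 \<cong>\<^sub>G HTG 2 s 0 \<or>
          s mod 6 = 3 \<and> HTG 1 (2 * s) 3 \<cong>\<^sub>G Moebius_ladder s \<and>
            Moebius_ladder s \<cong>\<^sub>G HTG 1 (2 * s) s)))
    \<or> (girth X = 6 \<and> has_signature X [4, 4, 4] \<and> X \<cong>\<^sub>G HTG 3 6 3)
    \<or> (girth X = 6 \<and> has_signature X [3, 3, 3] \<and>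
      (\<exists>s>6. X \<cong>\<^sub>G HTG 3 s 3 \<and>
         (s mod 12 = 0 \<and> HTG 3 s 3 \<cong>\<^sub>G HTG (s div 2) 6 0 \<or>
          s mod 12 = 6 \<and> HTG 3 s 3 \<cong>\<^sub>G HTG (s div 2) 6 3)))
    \<or> (girth X = 6 \<and> has_signature X [2, 3, 3] \<and>
      ((\<exists>s. even s \<and> X \<cong>\<^sub>G HTG s 6 0 \<and>
          (s mod 6 = 2 \<longrightarrow> HTG s 6 0 \<cong>\<^sub>G HTG 1 (6 * s) (2 * s - 1)) \<and>
          (s mod 6 = 4 \<longrightarrow> HTG s 6 0 \<cong>\<^sub>G HTG 1 (6 * s) (2 * s + 1))) \<or>
       (\<exists>s\<ge>5. odd s \<and> X \<cong>\<^sub>G HTG s 6 3 \<and>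
          (s mod 6 = 5 \<longrightarrow> HTG s 6 3 \<cong>\<^sub>G HTG 1 (6 * s) (2 * s - 1)) \<and>
          (s mod 6 = 1 \<longrightarrow> HTG s 6 3 \<cong>\<^sub>G HTG 1 (6 * s) (2 * s + 1)))))
    \<or> (girth X = 6 \<and> has_signature X [2, 2, 2] \<and>
      ((\<exists>s. s mod 4 = 0 \<and> X \<cong>\<^sub>G HTG 2 s (s div 2) \<and>
          HTG 2 s (s div 2) \<cong>\<^sub>G GP s (s div 2 - 1)) \<or>
       ((m, n, l) \<notin> listed_triples \<and>
          \<not> (\<exists>N k. 1 \<le> k \<and> 2 * k \<le> N \<and> X \<cong>\<^sub>G GP N k)))))"
  (is "?P \<and> (?A \<or> ?B \<or> ?C \<or> ?D \<or> ?E)")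
proof -
  have p: "1 \<le> m" "even n" "4 \<le> n" "2 * l \<le> n" "l mod 2 = m mod 2"
    using assms(1) unfolding HTG_params_def by auto
  define L where "L = HTG_lattice m n l"
  interpret H: hex_cover X "HTG_map m n l" L
    unfolding assms(2) L_def using p by (intro hex_cover_HTG) auto
  interpret R: rainbow_hex_cover X "HTG_map m n l" L
    by unfold_locales (rule H.three_dvd_lattice[OF assms(3)])
  \<comment> \<open>The divisibility is applied to the two generators of the lattice, which yields
    the congruences for \<open>n\<close> and \<open>l\<close>.\<close>
  have "(0, int n) \<in> L" "(int m, - int l) \<in> L" unfolding L_def HTG_lattice_def using p by auto
  then have "3 dvd int n" "3 dvd - int l" using R.three_dvd by blast+
  then have nl: "n mod 6 = 0" "l mod 3 = 0" using p(2) by presburger+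
  then have P: ?P using p(5) by presburger
  have card: "card (verts X) = m * n" unfolding assms(2) verts_HTG by simp
  have HTG_iso: "X \<cong>\<^sub>G HTG m' n' l'"
    if "hex_cover X \<psi> (HTG_lattice m' n' l')" "1 \<le> m'" "1 \<le> n'" "even n'" "l' mod 2 = m' mod 2" for \<psi> m' n' l'
    using hex_cover_iso[OF that(1) hex_cover_HTG[OF that(2-5)]] .
  consider (two) "(1, 3) \<in> L \<or> (1, -3) \<in> L \<or> (2, 0) \<in> L"
    | (three) "(1, 3) \<notin> L" "(1, -3) \<notin> L" "(2, 0) \<notin> L" "(0, 6) \<in> L \<or> (3, 3) \<in> L \<or> (3, -3) \<in> L"
    | (long) "(1, 3) \<notin> L" "(1, -3) \<notin> L" "(2, 0) \<notin> L" "(0, 6) \<notin> L" "(3, 3) \<notin> L" "(3, -3) \<notin> L"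
    by blast
  then have "?A \<or> ?B \<or> ?C \<or> ?D \<or> ?E"
  proof cases
    case two
    then obtain \<psi> L' where R': "rainbow_hex_cover X \<psi> L'" and L': "(1, -3) \<in> L'"
      using R.normalise_norm_2 by blast
    interpret R': rainbow_hex_cover X \<psi> L' by (rule R')
    from R'.lattice_of_norm_2[OF L'] obtain s where s: "0 < s" "s mod 3 = 0"
      and Ls: "L' = HTG_lattice 1 (2 * s) 3" by (elim exE conjE) (rule that)
    have iso: "X \<cong>\<^sub>G HTG 1 (2 * s) 3"
      by (rule HTG_iso[OF R'.hex_cover_axioms[unfolded Ls]]) (use s in simp_all)
    have sig: "has_signature X (if (m, n, l) = (1, 6, 3) then [4, 4, 4] else [1, 1, 2])"
    proof (cases "(m, n, l) = (1, 6, 3)")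
      case True
      then have "(1, -3) \<in> L" "(1, 3) \<in> L" "(2, 0) \<in> L" unfolding L_def HTG_lattice_def by auto
      then show ?thesis using R.signature_K33 True by simp
    next
      case False
      \<comment> \<open>In \<open>L'\<close> each of (1, 3) and (2, 0) amounts to
        \<open>2 * s\<close> dividing 6. That would mean six vertices, and the only parameters with
        six vertices here are (1, 6, 3).\<close>
      have "\<not> int (2 * s) dvd 6"
      proof
        assume "int (2 * s) dvd 6"
        then have "2 * s dvd 6" by (metis int_dvd_int_iff of_nat_numeral)
        then have "2 * s \<le> 6" by (rule dvd_imp_le) simp
        then have "s = 3" using s by presburger
        then have "m * n = 6" using graph_iso_card_verts[OF iso] card by (simp add: verts_HTG)
        moreover from this have "n dvd 6" by (metis dvd_triv_right)
        then have "n \<le> 6" by (rule dvd_imp_le) simp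
        then have "n = 6" using nl(1) p(3) by presburger
        ultimately have "m = 1" by simp
        then have "l = 3" using \<open>n = 6\<close> p(4,5) nl(2) by presburger
        then show False using False \<open>m = 1\<close> \<open>n = 6\<close> by simp
      qed
      then have "(1, 3) \<notin> L'" "(2, 0) \<notin> L'" unfolding Ls HTG_lattice_1 by simp_all
      from R'.signature_ladder[OF L' this] show ?thesis using False by (simp only: if_False)
    qed
    have ?A by (intro conjI exI[of _ s] R'.girth_4[OF L'] sig iso HTG_1_3_ladder[OF s])
    then show ?thesis by (rule disjI1)
  next
    case three
    have g: "girth X = 6" using three by (intro R.girth_6)
    obtain \<psi> L' where R': "rainbow_hex_cover X \<psi> L'" and L': "(0, 6) \<in> L'"
      using R.normalise_norm_3[OF three(4)] by blast
    interpret R': rainbow_hex_cover X \<psi> L' by (rule R')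
    \<comment> \<open>The change of coordinates need not keep the individual vectors out of the
      lattice, but a vector at distance two in \<open>L'\<close> would again give girth
      four.\<close>
    have "\<not> ((1, 3) \<in> L' \<or> (1, -3) \<in> L' \<or> (2, 0) \<in> L')"
    proof
      assume "(1, 3) \<in> L' \<or> (1, -3) \<in> L' \<or> (2, 0) \<in> L'"
      then obtain \<psi>' L'' where "rainbow_hex_cover X \<psi>' L''" "(1, -3) \<in> L''"
        using R'.normalise_norm_2 by blast
      then have "girth X = 4" by (rule rainbow_hex_cover.girth_4)
      then show False using g by simp
    qed
    then have no2: "(1, 3) \<notin> L'" "(1, -3) \<notin> L'" "(2, 0) \<notin> L'" by auto
    from R'.lattice_of_norm_3[OF L'] obtain s where s: "0 < s" and Ls: "L' = column_lattice s"
      by (elim exE conjE) (rule that)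
    \<comment> \<open>For these values the column lattice contains (1, 3) or (2, 0),
      respectively.\<close>
    have "s \<noteq> 1" "s \<noteq> 2" using no2 unfolding Ls column_lattice_def by auto
    then have s3: "3 \<le> s" using s by linarith
    have iso: "X \<cong>\<^sub>G HTG s 6 (if even s then 0 else 3)"
      by (rule HTG_iso[OF R'.hex_cover_axioms[unfolded Ls HTG_lattice_column[OF s, symmetric]]])
        (use s column_parity[of s] in simp_all)
    show ?thesis
    proof (cases "s = 3")
      case True
      \<comment> \<open>For horizontal period three, all three kinds of vectors at distance three
        are present: this is the Pappus graph.\<close>
      then have "(3, 3) \<in> L'" "(3, -3) \<in> L'" unfolding Ls column_lattice_def by auto
      then have ?B using R'.signature_6(3)[OF no2 L'] g iso True by simp
      then show ?thesis by (rule disjI2[OF disjI1])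
    next
      case False
      then have s4: "4 \<le> s" using s3 by simp
      then have "\<not> int s dvd 3" using zdvd_imp_le[of "int s" 3] by auto
      then have "(3, 3) \<notin> L'" "(3, -3) \<notin> L'" unfolding Ls column_lattice_def by auto
      then have sig: "has_signature X [2, 3, 3]" using R'.signature_6(2)[OF no2 L'] by blast
      have minus: "HTG s 6 (if even s then 0 else 3) \<cong>\<^sub>G HTG 1 (6 * s) (2 * s - 1)" if "s mod 6 = 2 \<or> s mod 6 = 5"
        using that by (intro HTG_column_iso_minus) presburger
      have plus: "HTG s 6 (if even s then 0 else 3) \<cong>\<^sub>G HTG 1 (6 * s) (2 * s + 1)" if "s mod 6 = 4 \<or> s mod 6 = 1"
        using that by (intro HTG_column_iso_plus) presburger
      have ?D
      proof (cases "even s")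
        case True
        then show ?thesis using g sig iso minus plus by (intro conjI disjI1 exI[of _ s]) simp_all
      next
        case odd: False
        then have "5 \<le> s" using s4 by presburger
        then show ?thesis using g sig iso minus plus odd by (intro conjI disjI2 exI[of _ s]) simp_all
      qed
      then show ?thesis by (rule disjI2[OF disjI2[OF disjI2[OF disjI1]]])
    qed
  next
    case long
    have g: "girth X = 6" using long by (intro R.girth_6)
    have sig: "has_signature X [2, 2, 2]" using long by (intro R.signature_6(1))
    have "(\<exists>s. s mod 4 = 0 \<and> X \<cong>\<^sub>G HTG 2 s (s div 2) \<and> HTG 2 s (s div 2) \<cong>\<^sub>G GP s (s div 2 - 1)) \<or>
        (m, n, l) \<notin> listed_triples \<and> \<not> (\<exists>N k. 1 \<le> k \<and> 2 * k \<le> N \<and> X \<cong>\<^sub>G GP N k)"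
    proof (cases "\<exists>N k. 1 \<le> k \<and> 2 * k \<le> N \<and> X \<cong>\<^sub>G GP N k")
      case True
      then obtain N k where k: "1 \<le> k" "2 * k \<le> N" and iso: "X \<cong>\<^sub>G GP N k" by blast
      \<comment> \<open>For \<open>n = 6\<close> the vector (0, 6) would be in the lattice. So
        \<open>n\<close> is at least 12, and the vertex count gives the bound
        \<open>6 \<le> N\<close> required for the analysis of the generalized Petersen
        graph.\<close>
      have "n \<noteq> 6" using long(4) unfolding L_def HTG_lattice_def by auto
      then have "12 \<le> n" using nl(1) p(3) by presburger
      then have "12 \<le> m * n" using p(1) mult_le_mono[of 1 m 12 n] by simp
      moreover have "card (verts (GP N k)) = 2 * N"
        unfolding verts_GP by (subst card_Un_disjoint) (auto simp: card_image)
      ultimately have "6 \<le> N" using graph_iso_card_verts[OF iso] card by simp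
      then have N: "N mod 4 = 0" "k = N div 2 - 1" "4 \<le> N"
        using H.parameters_of_iso_GP[OF iso k _ g sig] by auto
      have "HTG 2 N (N div 2) \<cong>\<^sub>G GP N (N div 2 - 1)" by (rule HTG_2_half_iso_GP[OF N(1,3)])
      moreover from this have "X \<cong>\<^sub>G HTG 2 N (N div 2)"
        using graph_iso_trans[OF iso[unfolded N(2)] graph_iso_sym] by blast
      ultimately show ?thesis using N(1) by (intro disjI1 exI[of _ N] conjI)
    next
      case no_GP: False
      have "(m, n, l) \<notin> listed_triples"
      proof
        assume "(m, n, l) \<in> listed_triples"
        from listed_triple_short_vector[OF this p(1,3)] show False
        proof
          assume "m = 2 \<and> n mod 4 = 0 \<and> l = n div 2"
          then have "X \<cong>\<^sub>G GP n (n div 2 - 1)" using HTG_2_half_iso_GP[of n] p(3) assms(2) by simp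
          moreover have "1 \<le> n div 2 - 1" "2 * (n div 2 - 1) \<le> n" using p(3) by presburger+
          ultimately show False using no_GP by blast
        next
          assume "\<exists>v \<in> {(1, -3), (2, 0), (0, 6), (3, 3), (3, -3)}. v \<in> HTG_lattice m n l"
          then show False using long unfolding L_def by blast
        qed
      qed
      then show ?thesis using no_GP by blast
    qed
    with g sig have ?E by (intro conjI)
    then show ?thesis by (rule disjI2[OF disjI2[OF disjI2[OF disjI2]]])
  qed
  with P show ?thesis by (rule conjI)
qed

end
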